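(* Let $K$ be a field of characteristic zero and let a Poisson algebra $\mathcal{A}=S^{-1}(P_n/I)$ be a domain of essentially finite type over $K$, where $I=(f_1,\ldots,f_m)$ is a prime but not maximal ideal of $P_n=K[x_1,\ldots,x_n]$, and let $d$ be the rank of $\mathcal{C}_{\mathcal{A}}=(\{x_i,x_j\})$. Let $\overline{\mathcal{U}}=\overline{\mathcal{U}}(\mathcal{A})=\mathcal{U}(\mathcal{A})/\kappa_{\mathcal{A}}$, $\phi:\mathcal{U}(\mathcal{A})\to\overline{\mathcal{U}}(\mathcal{A})$, $u\mapsto u+\kappa_{\mathcal{A}}$, and $\overline{\pi}_{\mathcal{A}}:\overline{\mathcal{U}}(\mathcal{A})\to P\mathcal{D}(\mathcal{A})$, $a+\kappa_{\mathcal{A}}\mapsto a$, $\delta_i+\kappa_{\mathcal{A}}\mapsto\{x_i,\cdot\}$, where $a\in\mathcal{A}$. Then for all $\mathbf{i}\in\mathbb{I}_{\mathcal{A}}(d)$, $\mathbf{j}\in\mathbb{J}_{\mathcal{A}}(d)$ and $t\gg0$: (1) $\ker(\pi_{\mathcal{A}})=\phi^{-1}(T_{\overline{\mathcal{U}}(\mathcal{A})})=\phi^{-1}(\mathrm{tor}_{S_{\mu(\mathbf{i},\mathbf{j})}}(\overline{\mathcal{U}}(\mathcal{A})))=\phi^{-1}(\mathrm{r.ann}_{\overline{\mathcal{U}}}(\mathfrak{c}_{\mathcal{A},d}^t))=\phi^{-1}(\mathrm{l.ann}_{\overline{\mathcal{U}}}(\mathfrak{c}_{\mathcal{A},d}^t))$.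 (2) $\ker(\overline{\pi}_{\mathcal{A}})=T_{\overline{\mathcal{U}}(\mathcal{A})}=\mathrm{tor}_{S_{\mu(\mathbf{i},\mathbf{j})}}(\overline{\mathcal{U}}(\mathcal{A}))=\mathrm{r.ann}_{\overline{\mathcal{U}}(\mathcal{A})}(\mathfrak{c}_{\mathcal{A},d}^t)=\mathrm{l.ann}_{\overline{\mathcal{U}}(\mathcal{A})}(\mathfrak{c}_{\mathcal{A},d}^t)$.
   Context: A Poisson algebra over $K$ is a commutative associative (unital) $K$-algebra with a $K$-bilinear Lie bracket $\{\cdot,\cdot\}$ satisfying $\{a,xy\}=\{a,x\}y+x\{a,y\}$. An algebra of essentially finite type is a localization of an affine commutative algebra. Poisson enveloping algebra: $(\mathcal{U}(\mathcal{A}),\alpha,\beta)$ is the universal triple with $\mathcal{U}(\mathcal{A})$ an associative algebra, $\alpha:\mathcal{A}\to\mathcal{U}(\mathcal{A})$ an algebra homomorphism, $\beta:\mathcal{A}\to\mathcal{U}(\mathcal{A})$ a Lie algebra homomorphism, $[\beta(a),\alpha(b)]=\alpha(\{a,b\})$ and $\beta(ab)=\beta(a)\alpha(b)+\alpha(a)\beta(b)$. One writes $a=\alpha(a)$, $\delta_a=\beta(a)$, $\delta_i=\delta_{x_i}$. $P\mathcal{D}(\mathcal{A})$ is the subalgebra of $\mathrm{End}_K(\mathcal{A})$ generated by the multiplications by elements of $\mathcal{A}$ and all derivations $\{a,\cdot\}$, $a\in\mathcal{A}$; $\pi_{\mathcal{A}}:\mathcal{U}(\mathcal{A})\to P\mathcal{D}(\mathcal{A})$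 is the epimorphism $a\mapsto a$, $\delta_b\mapsto\{b,\cdot\}$. The rank $d$ is over the field of fractions of $\mathcal{A}$, and $\mathfrak{c}_{\mathcal{A},d}$ is the ideal of $\mathcal{A}$ generated by all $d\times d$ minors of $\mathcal{C}_{\mathcal{A}}$. For increasing $d$-tuples $\mathbf{i},\mathbf{j}$ of elements of $\{1,\ldots,n\}$ let $\mu(\mathbf{i},\mathbf{j})=\det(\{x_{i_s},x_{j_t}\})_{s,t=1}^d$. $\mathbb{I}_{\mathcal{A}}(d)$ (resp. $\mathbb{J}_{\mathcal{A}}(d)$) is the set of $\mathbf{i}$ (resp. $\mathbf{j}$) with $\mu(\mathbf{i},\mathbf{j})\neq0$ for some $\mathbf{j}$ (resp. some $\mathbf{i}$); in fact $\mathbb{I}_{\mathcal{A}}(d)=\mathbb{J}_{\mathcal{A}}(d)$ and $\mu(\mathbf{i},\mathbf{j})\ne0$ for all $\mathbf{i},\mathbf{j}$ in this set. For such $\mathbf{i},\mathbf{j}$ and $i_\nu\in\{1,\ldots,n\}\setminus\{i_1,\ldots,i_d\}$, $$\delta_{\mathbf{i},i_\nu;\mathbf{j}}=\mu(\mathbf{i},\mathbf{j})\delta_{i_\nu}+\sum_{s=1}^d(-1)^{s+d+1}\mu(i_1,\ldots,\widehat{i_s},\ldots,i_d,i_\nu;\mathbf{j})\,\delta_{i_s}\in\mathcal{U}(\mathcal{A}),$$ i.e. the determinant of the $(d+1)\times(d+1)$ matrix with rows $(\{x_{i},x_{j_1}\},\ldots,\{x_{i},x_{j_d}\},\delta_{i})$,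 $i=i_1,\ldots,i_d,i_\nu$. $\kappa_{\mathcal{A}}$ is the two-sided ideal of $\mathcal{U}(\mathcal{A})$ generated by all these elements; $\kappa_{\mathcal{A}}\subseteq\ker(\pi_{\mathcal{A}})$ and $\mathcal{A}\cap\kappa_{\mathcal{A}}=0$, so $\mathcal{A}\subseteq\overline{\mathcal{U}}(\mathcal{A})$. (If $d=0$ the tuples are empty and the empty minor is $1$.) $S_{\mu}=\{\mu^k\mid k\ge0\}$. $\mathcal{A}\setminus\{0\}$ and $S_{\mu(\mathbf{i},\mathbf{j})}$ are (left and right) denominator sets of the Noetherian algebra $\overline{\mathcal{U}}(\mathcal{A})$; for such a set $T$, $\mathrm{tor}_T(\overline{\mathcal{U}})=\{u\in\overline{\mathcal{U}}\mid\tau u=0\text{ for some }\tau\in T\}$, and $T_{\overline{\mathcal{U}}(\mathcal{A})}=\mathrm{tor}_{\mathcal{A}\setminus\{0\}}(\overline{\mathcal{U}}(\mathcal{A}))$. $\mathrm{l.ann}_R(X)=\{u\in R\mid uX=0\}$ and $\mathrm{r.ann}_R(X)=\{u\in R\mid Xu=0\}$.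
   Formalization: The defining relation β(ab)=β(a)α(b)+α(a)β(b) of the Poisson enveloping algebra is replaced by β(ab)=α(a)β(b)+α(b)β(a), since the printed one forces 2α({a,b})=0, so that π_A would not exist for a nonzero bracket. *)

theory Defs
  imports
    "HOL-Library.Poly_Mapping"
    "HOL-Algebra.Generated_Rings"
    "HOL-Algebra.Ideal_Product"
    "HOL-Algebra.QuotRing"
    "HOL-Computational_Algebra.Polynomial_Factorial"
    "Jordan_Normal_Form.DL_Rank"
begin

section \<open>Poisson algebras\<close>

locale comm_algebra = vector_space scale
  for scale :: "'k::field \<Rightarrow> 'a::comm_ring_1 \<Rightarrow> 'a" +
  assumes scale_mult: "scale c (a * b) = scale c a * b"

locale poisson_algebra = comm_algebra scale
  for scale :: "'k::field \<Rightarrow> 'a::comm_ring_1 \<Rightarrow> 'a" and br :: "'a \<Rightarrow> 'a \<Rightarrow> 'a" +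
  assumes br_add_left: "br (a + b) c = br a c + br b c"
    and br_add_right: "br a (b + c) = br a b + br a c"
    and br_scale_left: "br (scale r a) b = scale r (br a b)"
    and br_scale_right: "br a (scale r b) = scale r (br a b)"
    and br_self: "br a a = 0"
    and br_jacobi: "br a (br b c) + br b (br c a) + br c (br a b) = 0"
    and br_mult_right: "br a (b * c) = br a b * c + b * br a c"


section \<open>Polynomial rings and localizations\<close>

type_synonym 'k mpoly = "(nat \<Rightarrow>\<^sub>0 nat) \<Rightarrow>\<^sub>0 'k"

text \<open>The variables are indexed by \<open>0, \<dots>, n - 1\<close>.\<close>

definition mpoly_ring :: "nat \<Rightarrow> 'k::comm_ring_1 mpoly ring" where
  "mpoly_ring n = class_ring
     \<lparr>carrier := {p. \<forall>m \<in> Poly_Mapping.keys p. Poly_Mapping.keys m \<subseteq> {..<n}}\<rparr>"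

definition mpoly_var :: "nat \<Rightarrow> 'k::comm_ring_1 mpoly" where
  "mpoly_var i = Poly_Mapping.single (Poly_Mapping.single i 1) 1"

definition mpoly_const :: "'k::comm_ring_1 \<Rightarrow> 'k mpoly" where
  "mpoly_const c = Poly_Mapping.single 0 c"

text \<open>\<open>B\<close>, with the structure map \<open>h\<close>, is the localization \<open>S\<^sup>-\<^sup>1 R\<close>.\<close>

definition is_localization ::
  "('r, 'm) ring_scheme \<Rightarrow> 'r set \<Rightarrow> ('b, 'l) ring_scheme \<Rightarrow> ('r \<Rightarrow> 'b) \<Rightarrow> bool" where
  "is_localization R S B h \<longleftrightarrow>
     cring R \<and> cring B \<and> submonoid S R \<and> h \<in> Ring.ring_hom R B \<and>
     (\<forall>s \<in> S. h s \<in> Units B) \<and>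
     (\<forall>b \<in> carrier B. \<exists>r \<in> carrier R. \<exists>s \<in> S. b = h r \<otimes>\<^bsub>B\<^esub> inv\<^bsub>B\<^esub> (h s)) \<and>
     (\<forall>r \<in> carrier R. h r = \<zero>\<^bsub>B\<^esub> \<longrightarrow> (\<exists>s \<in> S. s \<otimes>\<^bsub>R\<^esub> r = \<zero>\<^bsub>R\<^esub>))"


section \<open>Free associative algebras\<close>

text \<open>
  The free monoid, written additively because the product of \<open>'m \<Rightarrow>\<^sub>0 'k\<close> convolves along the
  addition of \<open>'m\<close>; \<open>'g free_word \<Rightarrow>\<^sub>0 'k\<close> is then the free associative unital
  algebra over \<open>'k\<close> on the generators \<open>'g\<close>.
\<close>

datatype 'g free_word = Word (letters: "'g list")

instantiation free_word :: (type) monoid_add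
begin
definition zero_free_word :: "'a free_word" where
  "zero_free_word = Word []"
definition plus_free_word :: "'a free_word \<Rightarrow> 'a free_word \<Rightarrow> 'a free_word" where
  "plus_free_word v w = Word (letters v @ letters w)"
instance
  by standard (simp_all add: zero_free_word_def plus_free_word_def)
end

definition free_gen :: "'g \<Rightarrow> 'g free_word \<Rightarrow>\<^sub>0 'k::comm_ring_1" where
  "free_gen g = Poly_Mapping.single (Word [g]) 1"

definition free_const :: "'k \<Rightarrow> 'g free_word \<Rightarrow>\<^sub>0 'k::comm_ring_1" where
  "free_const c = Poly_Mapping.single 0 c"

text \<open>
  The extension of \<open>v\<close> to the free algebra, with values in a ring \<open>B\<close> whose
  algebra structure is given by a ring homomorphism \<open>\<eta>\<close> from the scalars to the centre of \<open>B\<close>.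
\<close>

definition word_val :: "('b, 'm) ring_scheme \<Rightarrow> ('g \<Rightarrow> 'b) \<Rightarrow> 'g free_word \<Rightarrow> 'b" where
  "word_val B v w = foldr (\<lambda>g r. v g \<otimes>\<^bsub>B\<^esub> r) (letters w) \<one>\<^bsub>B\<^esub>"

definition free_lift :: "('b, 'm) ring_scheme \<Rightarrow> ('k::comm_ring_1 \<Rightarrow> 'b) \<Rightarrow> ('g \<Rightarrow> 'b)
    \<Rightarrow> ('g free_word \<Rightarrow>\<^sub>0 'k) \<Rightarrow> 'b" where
  "free_lift B \<eta> v p =
     (\<Oplus>\<^bsub>B\<^esub>w \<in> Poly_Mapping.keys p. \<eta> (Poly_Mapping.lookup p w) \<otimes>\<^bsub>B\<^esub> word_val B v w)"


section \<open>The Poisson enveloping algebra\<close>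

text \<open>
  The rule for \<open>\<beta> (a b)\<close> is \<open>\<beta> (a b) = \<alpha> a \<beta> b + \<alpha> b \<beta> a\<close>.  The order of the factors matters: together
  with \<open>[\<beta> a, \<alpha> b] = \<alpha> {a, b}\<close>, the variant \<open>\<beta> (a b) = \<beta> a \<alpha> b + \<alpha> a \<beta> b\<close> would, by commutativity
  of \<open>a b\<close>, force \<open>2 \<alpha> {a, b} = 0\<close>.
\<close>

datatype 'a env_gen = Alg 'a | Lie 'a

type_synonym ('k, 'a) env_free = "'a env_gen free_word \<Rightarrow>\<^sub>0 'k"

definition env_rels :: "('k::field \<Rightarrow> 'a::comm_ring_1 \<Rightarrow> 'a) \<Rightarrow> ('a \<Rightarrow> 'a \<Rightarrow> 'a)
    \<Rightarrow> ('k, 'a) env_free set" where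
  "env_rels scale br =
    (let A = (\<lambda>a. free_gen (Alg a)); L = (\<lambda>a. free_gen (Lie a)) in
      {A 1 - 1}
    \<union> {A (a + b) - (A a + A b) | a b. True}
    \<union> {A (a * b) - A a * A b | a b. True}
    \<union> {A (scale c a) - free_const c * A a | c a. True}
    \<union> {L (a + b) - (L a + L b) | a b. True}
    \<union> {L (scale c a) - free_const c * L a | c a. True}
    \<union> {L (br a b) - (L a * L b - L b * L a) | a b. True}
    \<union> {A (br a b) - (L a * A b - A b * L a) | a b. True}
    \<union> {L (a * b) - (A a * L b + A b * L a) | a b. True})"

definition env_ideal :: "('k::field \<Rightarrow> 'a::comm_ring_1 \<Rightarrow> 'a) \<Rightarrow> ('a \<Rightarrow> 'a \<Rightarrow> 'a)
    \<Rightarrow> ('k, 'a) env_free set" where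
  "env_ideal scale br = Idl\<^bsub>class_ring\<^esub> (env_rels scale br)"

definition env :: "('k::field \<Rightarrow> 'a::comm_ring_1 \<Rightarrow> 'a) \<Rightarrow> ('a \<Rightarrow> 'a \<Rightarrow> 'a)
    \<Rightarrow> ('k, 'a) env_free set ring" where
  "env scale br = class_ring Quot env_ideal scale br"

definition env_const :: "('k::field \<Rightarrow> 'a::comm_ring_1 \<Rightarrow> 'a) \<Rightarrow> ('a \<Rightarrow> 'a \<Rightarrow> 'a)
    \<Rightarrow> 'k \<Rightarrow> ('k, 'a) env_free set" where
  "env_const scale br c = env_ideal scale br +>\<^bsub>class_ring\<^esub> free_const c"

definition env_alpha :: "('k::field \<Rightarrow> 'a::comm_ring_1 \<Rightarrow> 'a) \<Rightarrow> ('a \<Rightarrow> 'a \<Rightarrow> 'a)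
    \<Rightarrow> 'a \<Rightarrow> ('k, 'a) env_free set" where
  "env_alpha scale br a = env_ideal scale br +>\<^bsub>class_ring\<^esub> free_gen (Alg a)"

definition env_beta :: "('k::field \<Rightarrow> 'a::comm_ring_1 \<Rightarrow> 'a) \<Rightarrow> ('a \<Rightarrow> 'a \<Rightarrow> 'a)
    \<Rightarrow> 'a \<Rightarrow> ('k, 'a) env_free set" where
  "env_beta scale br a = env_ideal scale br +>\<^bsub>class_ring\<^esub> free_gen (Lie a)"

definition env_lift :: "('b, 'm) ring_scheme \<Rightarrow> ('k::field \<Rightarrow> 'b) \<Rightarrow> ('a \<Rightarrow> 'b) \<Rightarrow> ('a \<Rightarrow> 'b)
    \<Rightarrow> ('k, 'a) env_free set \<Rightarrow> 'b" where
  "env_lift B \<eta> \<alpha> \<beta> C = the_elem (free_lift B \<eta> (case_env_gen \<alpha> \<beta>) ` C)"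

text \<open>
  The triples among which the enveloping algebra is universal.  The ring homomorphism \<open>\<eta>\<close> gives
  the algebra structure of \<open>B\<close>.
\<close>

locale poisson_triple = poisson_algebra scale br
  for scale :: "'k::field \<Rightarrow> 'a::comm_ring_1 \<Rightarrow> 'a" and br :: "'a \<Rightarrow> 'a \<Rightarrow> 'a"
    and B :: "('b, 'm) ring_scheme" (structure) +
  fixes \<eta> :: "'k \<Rightarrow> 'b" and \<alpha> :: "'a \<Rightarrow> 'b" and \<beta> :: "'a \<Rightarrow> 'b"
  assumes ring_B: "ring B"
    and eta_hom: "\<eta> \<in> Ring.ring_hom class_ring B"
    and eta_central: "y \<in> carrier B \<Longrightarrow> \<eta> c \<otimes> y = y \<otimes> \<eta> c"
    and alpha_hom: "\<alpha> \<in> Ring.ring_hom class_ring B"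
    and alpha_scale: "\<alpha> (scale c a) = \<eta> c \<otimes> \<alpha> a"
    and beta_closed: "\<beta> a \<in> carrier B"
    and beta_add: "\<beta> (a + b) = \<beta> a \<oplus> \<beta> b"
    and beta_scale: "\<beta> (scale c a) = \<eta> c \<otimes> \<beta> a"
    and beta_br: "\<beta> (br a b) = \<beta> a \<otimes> \<beta> b \<ominus> \<beta> b \<otimes> \<beta> a"
    and alpha_br: "\<alpha> (br a b) = \<beta> a \<otimes> \<alpha> b \<ominus> \<alpha> b \<otimes> \<beta> a"
    and beta_mult: "\<beta> (a * b) = \<alpha> a \<otimes> \<beta> b \<oplus> \<alpha> b \<otimes> \<beta> a"

subsection \<open>Its universal property\<close>

lemma env_ideal_ideal: "ideal (env_ideal scale br) class_ring"
  unfolding env_ideal_def by (rule ring.genideal_ideal[OF class_ring.ring_axioms]) simp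

lemma env_rels_sub: "env_rels scale br \<subseteq> env_ideal scale br"
  unfolding env_ideal_def by (rule ring.genideal_self[OF class_ring.ring_axioms]) simp

lemma ring_env: "ring (env scale br)"
  unfolding env_def by (rule ideal.quotient_is_ring[OF env_ideal_ideal])

lemma env_coset_hom: "(+>\<^bsub>class_ring\<^esub>) (env_ideal scale br) \<in> Ring.ring_hom class_ring (env scale br)"
  unfolding env_def by (rule ideal.rcos_ring_hom[OF env_ideal_ideal])

lemma env_coset_eq:
  assumes "p - q \<in> env_rels scale br"
  shows "env_ideal scale br +>\<^bsub>class_ring\<^esub> p = env_ideal scale br +>\<^bsub>class_ring\<^esub> q"
proof -
  have "p - q \<in> env_ideal scale br"
    using assms env_rels_sub by blast
  then show ?thesis
    using ring.quotient_eq_iff_same_a_r_cos[OF class_ring.ring_axioms env_ideal_ideal, of p q scale br]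
    by (simp add: class_ring_simps)
qed

lemma env_coset_simps:
  fixes scale :: "'k::field \<Rightarrow> 'a::comm_ring_1 \<Rightarrow> 'a" and br :: "'a \<Rightarrow> 'a \<Rightarrow> 'a"
    and p q :: "('k, 'a) env_free"
  defines "J \<equiv> env_ideal scale br" and "U \<equiv> env scale br"
  shows "J +>\<^bsub>class_ring\<^esub> p \<in> carrier U"
    and "J +>\<^bsub>class_ring\<^esub> (p + q) = (J +>\<^bsub>class_ring\<^esub> p) \<oplus>\<^bsub>U\<^esub> (J +>\<^bsub>class_ring\<^esub> q)"
    and "J +>\<^bsub>class_ring\<^esub> (p * q) = (J +>\<^bsub>class_ring\<^esub> p) \<otimes>\<^bsub>U\<^esub> (J +>\<^bsub>class_ring\<^esub> q)"
    and "J +>\<^bsub>class_ring\<^esub> (p - q) = (J +>\<^bsub>class_ring\<^esub> p) \<ominus>\<^bsub>U\<^esub> (J +>\<^bsub>class_ring\<^esub> q)"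
    and "J +>\<^bsub>class_ring\<^esub> 1 = \<one>\<^bsub>U\<^esub>"
proof -
  interpret U: ring U unfolding U_def by (rule ring_env)
  note hom = env_coset_hom[of scale br, folded J_def U_def]
  show cl: "J +>\<^bsub>class_ring\<^esub> p \<in> carrier U" for p
    using ring_hom_closed[OF hom, of p] by simp
  show add: "J +>\<^bsub>class_ring\<^esub> (p + q) = (J +>\<^bsub>class_ring\<^esub> p) \<oplus>\<^bsub>U\<^esub> (J +>\<^bsub>class_ring\<^esub> q)" for p q
    using ring_hom_add[OF hom, of p q] by simp
  show "J +>\<^bsub>class_ring\<^esub> (p * q) = (J +>\<^bsub>class_ring\<^esub> p) \<otimes>\<^bsub>U\<^esub> (J +>\<^bsub>class_ring\<^esub> q)"
    using ring_hom_mult[OF hom, of p q] by simp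
  show "J +>\<^bsub>class_ring\<^esub> 1 = \<one>\<^bsub>U\<^esub>"
    using ring_hom_one[OF hom] by simp
  have "J +>\<^bsub>class_ring\<^esub> p = (J +>\<^bsub>class_ring\<^esub> (p - q)) \<oplus>\<^bsub>U\<^esub> (J +>\<^bsub>class_ring\<^esub> q)"
    using add[of "p - q" q] by simp
  then show "J +>\<^bsub>class_ring\<^esub> (p - q) = (J +>\<^bsub>class_ring\<^esub> p) \<ominus>\<^bsub>U\<^esub> (J +>\<^bsub>class_ring\<^esub> q)"
    using cl[of p] cl[of q] cl[of "p - q"]
    by (simp add: U.minus_eq U.a_assoc U.r_neg)
qed

lemma free_const_add: "free_const (c + d) = free_const c + free_const d"
  by (simp add: free_const_def single_add)

lemma free_const_mult: "free_const (c * d) = free_const c * free_const d"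
  by (simp add: free_const_def mult_single)

lemma free_const_one: "free_const 1 = 1"
  by (simp add: free_const_def)

lemma free_add_induct [case_names single add]:
  fixes p :: "'g free_word \<Rightarrow>\<^sub>0 'k::comm_ring_1"
  assumes single: "\<And>w c. P (Poly_Mapping.single w c)"
    and add: "\<And>p q. P p \<Longrightarrow> P q \<Longrightarrow> P (p + q)"
  shows "P p"
proof -
  have "P (\<Sum>w\<in>W. Poly_Mapping.single w (Poly_Mapping.lookup p w))" if "finite W" for W
    using that
  proof induction
    case empty
    then show ?case using single[of 0 0] by simp
  next
    case (insert w W)
    then show ?case using add single by simp
  qed
  moreover have "(\<Sum>w\<in>Poly_Mapping.keys p. Poly_Mapping.single w (Poly_Mapping.lookup p w)) = p"
    by (rule poly_mapping_eqI)
      (simp add: lookup_sum lookup_single when_def in_keys_iff)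
  ultimately show ?thesis
    by (metis finite_keys)
qed

lemma free_const_central: "free_const c * p = p * free_const c"
  by (induction p rule: free_add_induct)
    (simp_all add: free_const_def mult_single mult.commute distrib_left distrib_right)

lemma free_algebra_induct [case_names const gen add mult]:
  fixes p :: "'g free_word \<Rightarrow>\<^sub>0 'k::comm_ring_1"
  assumes const: "\<And>c. P (free_const c)" and gen: "\<And>g. P (free_gen g)"
    and add: "\<And>p q. P p \<Longrightarrow> P q \<Longrightarrow> P (p + q)" and mult: "\<And>p q. P p \<Longrightarrow> P q \<Longrightarrow> P (p * q)"
  shows "P p"
proof -
  have word: "P (Poly_Mapping.single (Word gs) 1)" for gs
  proof (induction gs)
    case Nil
    show ?case using const[of 1] by (simp add: free_const_def zero_free_word_def)
  next
    case (Cons g gs)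
    have "Poly_Mapping.single (Word (g # gs)) (1::'k) = free_gen g * Poly_Mapping.single (Word gs) 1"
      by (simp add: free_gen_def mult_single plus_free_word_def)
    then show ?case using mult[OF gen Cons.IH] by simp
  qed
  have single: "P (Poly_Mapping.single w c)" for w c
    using mult[OF const[of c] word[of "letters w"]] by (simp add: free_const_def mult_single)
  show ?thesis
    by (induction p rule: free_add_induct) (use single add in auto)
qed

theorem env_poisson_triple:
  assumes "poisson_algebra scale br"
  shows "poisson_triple scale br (env scale br)
    (env_const scale br) (env_alpha scale br) (env_beta scale br)"
proof -
  interpret poisson_algebra scale br by fact
  let ?J = "env_ideal scale br" and ?U = "env scale br"
  interpret U: ring ?U by (rule ring_env)
  note defs = env_const_def env_alpha_def env_beta_def
  note simps = env_coset_simps[of scale br]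
  have A1: "?J +>\<^bsub>class_ring\<^esub> free_gen (Alg 1) = ?J +>\<^bsub>class_ring\<^esub> 1"
    by (rule env_coset_eq) (auto simp: env_rels_def Let_def)
  have A_add: "?J +>\<^bsub>class_ring\<^esub> free_gen (Alg (a + b)) =
      ?J +>\<^bsub>class_ring\<^esub> (free_gen (Alg a) + free_gen (Alg b))" for a b
    by (rule env_coset_eq) (unfold env_rels_def Let_def, blast)
  have A_mult: "?J +>\<^bsub>class_ring\<^esub> free_gen (Alg (a * b)) =
      ?J +>\<^bsub>class_ring\<^esub> (free_gen (Alg a) * free_gen (Alg b))" for a b
    by (rule env_coset_eq) (unfold env_rels_def Let_def, blast)
  have A_scale: "?J +>\<^bsub>class_ring\<^esub> free_gen (Alg (scale c a)) =
      ?J +>\<^bsub>class_ring\<^esub> (free_const c * free_gen (Alg a))" for c a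
    by (rule env_coset_eq) (unfold env_rels_def Let_def, blast)
  have L_add: "?J +>\<^bsub>class_ring\<^esub> free_gen (Lie (a + b)) =
      ?J +>\<^bsub>class_ring\<^esub> (free_gen (Lie a) + free_gen (Lie b))" for a b
    by (rule env_coset_eq) (unfold env_rels_def Let_def, blast)
  have L_scale: "?J +>\<^bsub>class_ring\<^esub> free_gen (Lie (scale c a)) =
      ?J +>\<^bsub>class_ring\<^esub> (free_const c * free_gen (Lie a))" for c a
    by (rule env_coset_eq) (unfold env_rels_def Let_def, blast)
  have L_br: "?J +>\<^bsub>class_ring\<^esub> free_gen (Lie (br a b)) =
      ?J +>\<^bsub>class_ring\<^esub>
        (free_gen (Lie a) * free_gen (Lie b) - free_gen (Lie b) * free_gen (Lie a))" for a b
    by (rule env_coset_eq) (unfold env_rels_def Let_def, blast)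
  have A_br: "?J +>\<^bsub>class_ring\<^esub> free_gen (Alg (br a b)) =
      ?J +>\<^bsub>class_ring\<^esub>
        (free_gen (Lie a) * free_gen (Alg b) - free_gen (Alg b) * free_gen (Lie a))" for a b
    by (rule env_coset_eq) (unfold env_rels_def Let_def, blast)
  have L_mult: "?J +>\<^bsub>class_ring\<^esub> free_gen (Lie (a * b)) =
      ?J +>\<^bsub>class_ring\<^esub>
        (free_gen (Alg a) * free_gen (Lie b) + free_gen (Alg b) * free_gen (Lie a))" for a b
    by (rule env_coset_eq) (unfold env_rels_def Let_def, blast)
  show ?thesis
  proof (unfold_locales, goal_cases)
    case 1
    show ?case
      by (rule ring_hom_memI)
        (simp_all add: defs simps free_const_add free_const_mult free_const_one)
  next
    case (2 y c)
    from 2 obtain p where "y = ?J +>\<^bsub>class_ring\<^esub> p"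
      by (auto simp: env_def FactRing_def A_RCOSETS_def' a_r_coset_def)
    then show ?case
      by (simp add: env_const_def simps(3)[symmetric] free_const_central)
  next
    case 3
    show ?case
      by (rule ring_hom_memI) (simp_all add: defs simps A1 A_add A_mult)
  next
    case (4 c a)
    show ?case by (simp add: defs simps A_scale)
  next
    case (5 a)
    show ?case by (simp add: defs simps)
  next
    case (6 a b)
    show ?case by (simp add: defs simps L_add)
  next
    case (7 c a)
    show ?case by (simp add: defs simps L_scale)
  next
    case (8 a b)
    show ?case by (simp add: defs simps L_br)
  next
    case (9 a b)
    show ?case by (simp add: defs simps A_br)
  next
    case (10 a b)
    show ?case by (simp add: defs simps L_mult)
  qed
qed

lemma word_val_closed:
  assumes "ring B" "\<And>g. v g \<in> carrier B"
  shows "word_val B v w \<in> carrier B"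
proof -
  interpret ring B by fact
  have "foldr (\<lambda>g r. v g \<otimes>\<^bsub>B\<^esub> r) gs \<one>\<^bsub>B\<^esub> \<in> carrier B" for gs
    by (induction gs) (simp_all add: assms)
  then show ?thesis unfolding word_val_def .
qed

lemma word_val_plus:
  assumes "ring B" "\<And>g. v g \<in> carrier B"
  shows "word_val B v (w + w') = word_val B v w \<otimes>\<^bsub>B\<^esub> word_val B v w'"
proof -
  interpret ring B by fact
  have cl: "foldr (\<lambda>g r. v g \<otimes>\<^bsub>B\<^esub> r) gs \<one>\<^bsub>B\<^esub> \<in> carrier B" for gs
    by (induction gs) (simp_all add: assms)
  have "foldr (\<lambda>g r. v g \<otimes>\<^bsub>B\<^esub> r) (gs @ hs) \<one>\<^bsub>B\<^esub> =
      foldr (\<lambda>g r. v g \<otimes>\<^bsub>B\<^esub> r) gs \<one>\<^bsub>B\<^esub> \<otimes>\<^bsub>B\<^esub> foldr (\<lambda>g r. v g \<otimes>\<^bsub>B\<^esub> r) hs \<one>\<^bsub>B\<^esub>" for gs hs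
  proof (induction gs)
    case Nil
    show ?case using cl[of hs] by simp
  next
    case (Cons g gs)
    show ?case using Cons.IH cl[of gs] cl[of hs] assms(2)[of g] by (simp add: m_assoc)
  qed
  then show ?thesis unfolding word_val_def plus_free_word_def by simp
qed

context
  fixes B :: "('b, 'm) ring_scheme" (structure) and \<eta> :: "'k::comm_ring_1 \<Rightarrow> 'b" and v :: "'g \<Rightarrow> 'b"
  assumes B: "ring B" and \<eta>: "\<eta> \<in> Ring.ring_hom class_ring B"
    and central: "\<And>c y. y \<in> carrier B \<Longrightarrow> \<eta> c \<otimes> y = y \<otimes> \<eta> c"
    and v: "\<And>g. v g \<in> carrier B"
begin

interpretation B: ring B by (rule B)

lemma eta_simps: "\<eta> c \<in> carrier B" "\<eta> (c + d) = \<eta> c \<oplus> \<eta> d" "\<eta> (c * d) = \<eta> c \<otimes> \<eta> d"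
  "\<eta> 1 = \<one>" "\<eta> 0 = \<zero>"
proof -
  show cl: "\<eta> c \<in> carrier B" for c using ring_hom_closed[OF \<eta>, of c] by simp
  show add: "\<eta> (c + d) = \<eta> c \<oplus> \<eta> d" for c d using ring_hom_add[OF \<eta>, of c d] by simp
  show "\<eta> (c * d) = \<eta> c \<otimes> \<eta> d" using ring_hom_mult[OF \<eta>, of c d] by simp
  show "\<eta> 1 = \<one>" using ring_hom_one[OF \<eta>] by simp
  have "\<eta> 0 = \<eta> 0 \<oplus> \<eta> 0" using add[of 0 0] by simp
  then show "\<eta> 0 = \<zero>" using cl[of 0] by (metis B.add.r_cancel_one')
qed

lemma free_lift_closed: "free_lift B \<eta> v p \<in> carrier B"
  unfolding free_lift_def
  by (intro B.finsum_closed) (auto intro!: B.m_closed eta_simps word_val_closed[of B v, OF B v])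

lemma free_lift_superset:
  assumes "finite W" "Poly_Mapping.keys p \<subseteq> W"
  shows "free_lift B \<eta> v p = (\<Oplus>w \<in> W. \<eta> (Poly_Mapping.lookup p w) \<otimes> word_val B v w)"
  unfolding free_lift_def
  using assms
  by (intro B.add.finprod_mono_neutral_cong_left)
    (auto simp: in_keys_iff eta_simps word_val_closed[of B v, OF B v])

lemma free_lift_add: "free_lift B \<eta> v (p + q) = free_lift B \<eta> v p \<oplus> free_lift B \<eta> v q"
proof -
  let ?W = "Poly_Mapping.keys p \<union> Poly_Mapping.keys q"
  have "free_lift B \<eta> v (p + q) =
      (\<Oplus>w \<in> ?W. \<eta> (Poly_Mapping.lookup (p + q) w) \<otimes> word_val B v w)"
    by (rule free_lift_superset) (simp_all add: Poly_Mapping.keys_add)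
  also have "\<dots> = (\<Oplus>w \<in> ?W. \<eta> (Poly_Mapping.lookup p w) \<otimes> word_val B v w \<oplus>
      \<eta> (Poly_Mapping.lookup q w) \<otimes> word_val B v w)"
    by (rule B.finsum_cong')
      (auto simp: lookup_add eta_simps B.l_distr word_val_closed[of B v, OF B v])
  also have "\<dots> = (\<Oplus>w \<in> ?W. \<eta> (Poly_Mapping.lookup p w) \<otimes> word_val B v w) \<oplus>
      (\<Oplus>w \<in> ?W. \<eta> (Poly_Mapping.lookup q w) \<otimes> word_val B v w)"
    by (rule B.finsum_addf) (auto simp: eta_simps word_val_closed[of B v, OF B v])
  also have "\<dots> = free_lift B \<eta> v p \<oplus> free_lift B \<eta> v q"
    by (simp add: free_lift_superset[symmetric])
  finally show ?thesis .
qed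

lemma free_lift_single: "free_lift B \<eta> v (Poly_Mapping.single w c) = \<eta> c \<otimes> word_val B v w"
  by (subst free_lift_superset[of "{w}"]) (auto simp: eta_simps word_val_closed[of B v, OF B v])

lemma free_lift_const: "free_lift B \<eta> v (free_const c) = \<eta> c"
  unfolding free_const_def free_lift_single
  by (simp add: word_val_def zero_free_word_def eta_simps)

lemma free_lift_gen: "free_lift B \<eta> v (free_gen g) = v g"
  unfolding free_gen_def free_lift_single by (simp add: word_val_def eta_simps v)

lemma free_lift_mult_single:
  "free_lift B \<eta> v (Poly_Mapping.single w c * q) = \<eta> c \<otimes> word_val B v w \<otimes> free_lift B \<eta> v q"
proof (induction q rule: free_add_induct)
  case (single w' c')
  note cl = eta_simps(1) word_val_closed[of B v, OF B v]
  have "\<eta> c \<otimes> word_val B v w \<otimes> (\<eta> c' \<otimes> word_val B v w') =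
      \<eta> c \<otimes> (word_val B v w \<otimes> \<eta> c') \<otimes> word_val B v w'"
    using cl by (simp add: B.m_assoc)
  also have "\<dots> = \<eta> c \<otimes> (\<eta> c' \<otimes> word_val B v w) \<otimes> word_val B v w'"
    using central[OF cl(2), of c' w] by simp
  finally show ?case
    using cl by (simp add: mult_single free_lift_single eta_simps(3) word_val_plus[of B v, OF B v] B.m_assoc)
next
  case (add p q)
  then show ?case
    by (simp add: distrib_left free_lift_add B.r_distr free_lift_closed eta_simps(1)
        word_val_closed[of B v, OF B v])
qed

lemma free_lift_mult: "free_lift B \<eta> v (p * q) = free_lift B \<eta> v p \<otimes> free_lift B \<eta> v q"
  by (induction p rule: free_add_induct)
    (simp_all add: free_lift_mult_single free_lift_single distrib_right free_lift_add B.l_distr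
      free_lift_closed)

lemma free_lift_hom: "free_lift B \<eta> v \<in> Ring.ring_hom class_ring B"
proof (rule ring_hom_memI)
  show "free_lift B \<eta> v \<one>\<^bsub>class_ring\<^esub> = \<one>"
    using free_lift_const[of 1] by (simp add: free_const_one eta_simps)
qed (simp_all add: free_lift_closed free_lift_mult free_lift_add)

end

theorem env_universal:
  assumes T: "poisson_triple scale br B \<eta> \<alpha> \<beta>"
  shows "env_lift B \<eta> \<alpha> \<beta> \<in> Ring.ring_hom (env scale br) B"
    and "env_lift B \<eta> \<alpha> \<beta> (env_const scale br c) = \<eta> c"
    and "env_lift B \<eta> \<alpha> \<beta> (env_alpha scale br a) = \<alpha> a"
    and "env_lift B \<eta> \<alpha> \<beta> (env_beta scale br a) = \<beta> a"
    and "h \<in> Ring.ring_hom (env scale br) B \<Longrightarrow> (\<And>c. h (env_const scale br c) = \<eta> c) \<Longrightarrow>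
      (\<And>a. h (env_alpha scale br a) = \<alpha> a) \<Longrightarrow> (\<And>a. h (env_beta scale br a) = \<beta> a) \<Longrightarrow>
      u \<in> carrier (env scale br) \<Longrightarrow> h u = env_lift B \<eta> \<alpha> \<beta> u"
proof -
  interpret poisson_triple scale br B \<eta> \<alpha> \<beta> by (rule T)
  interpret B: ring B by (rule ring_B)
  let ?J = "env_ideal scale br" and ?U = "env scale br"
  let ?v = "case_env_gen \<alpha> \<beta>"
  let ?L = "free_lift B \<eta> ?v"
  have alpha: "\<alpha> a \<in> carrier B" "\<alpha> (a + b) = \<alpha> a \<oplus>\<^bsub>B\<^esub> \<alpha> b" "\<alpha> (a * b) = \<alpha> a \<otimes>\<^bsub>B\<^esub> \<alpha> b"
    "\<alpha> 1 = \<one>\<^bsub>B\<^esub>" for a b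
    using ring_hom_closed[OF alpha_hom, of a] ring_hom_add[OF alpha_hom, of a b]
      ring_hom_mult[OF alpha_hom, of a b] ring_hom_one[OF alpha_hom] by simp_all
  have v: "?v g \<in> carrier B" for g
    by (cases g) (simp_all add: alpha beta_closed)
  note fl = free_lift_closed[where v = ?v, OF ring_B eta_hom eta_central v]
    free_lift_add[where v = ?v, OF ring_B eta_hom eta_central v] free_lift_mult[where v = ?v, OF ring_B eta_hom eta_central v]
    free_lift_const[where v = ?v, OF ring_B eta_hom eta_central v] free_lift_gen[where v = ?v, OF ring_B eta_hom eta_central v]
  have hom: "?L \<in> Ring.ring_hom class_ring B"
    by (rule free_lift_hom[where v = ?v, OF ring_B eta_hom eta_central v])
  interpret L: ring_hom_ring class_ring B ?L
    by (rule ring_hom_ringI2[OF class_ring.ring_axioms ring_B hom])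
  have diff: "?L (p - q) = ?L p \<ominus>\<^bsub>B\<^esub> ?L q" for p q
  proof -
    have "?L p = ?L (p - q) \<oplus>\<^bsub>B\<^esub> ?L q" using fl(2)[of "p - q" q] by simp
    then show ?thesis using fl(1) by (simp add: B.minus_eq B.a_assoc B.r_neg)
  qed
  have one: "?L 1 = \<one>\<^bsub>B\<^esub>"
    using ring_hom_one[OF hom] by simp
  note cl = fl(1) alpha(1) beta_closed ring_hom_closed[OF eta_hom, simplified]
  have zero: "?L r = \<zero>\<^bsub>B\<^esub>" if "r \<in> env_rels scale br" for r
    using that unfolding env_rels_def Let_def
    by (auto simp: diff one fl alpha alpha_scale beta_add beta_scale beta_br alpha_br beta_mult cl
        B.minus_eq B.r_neg)
  have "env_rels scale br \<subseteq> a_kernel class_ring B ?L"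
  proof
    fix r assume "r \<in> env_rels scale br"
    from zero[OF this] show "r \<in> a_kernel class_ring B ?L"
      unfolding a_kernel_def' by simp
  qed
  then have "?J \<subseteq> a_kernel class_ring B ?L"
    unfolding env_ideal_def
    by (rule ring.genideal_minimal[OF class_ring.ring_axioms L.kernel_is_ideal])
  then have J: "?L p = \<zero>\<^bsub>B\<^esub>" if "p \<in> ?J" for p
    using that unfolding a_kernel_def' by blast
  have J0: "0 \<in> ?J"
    using additive_subgroup.zero_closed[OF ideal.axioms(1)[OF env_ideal_ideal]] by simp
  have lift: "env_lift B \<eta> \<alpha> \<beta> (?J +>\<^bsub>class_ring\<^esub> p) = ?L p" for p
  proof -
    have "?L ` (?J +>\<^bsub>class_ring\<^esub> p) = {?L p}"
      using J J0 fl(1,2) by (force simp: a_r_coset_def')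
    then show ?thesis by (simp add: env_lift_def)
  qed
  have coset: "\<exists>p. u = ?J +>\<^bsub>class_ring\<^esub> p" if "u \<in> carrier ?U" for u
    using that by (auto simp: env_def FactRing_def A_RCOSETS_def' a_r_coset_def)
  note cs = env_coset_simps[of scale br]
  show "env_lift B \<eta> \<alpha> \<beta> \<in> Ring.ring_hom ?U B"
  proof (rule ring_hom_memI)
    fix u w assume "u \<in> carrier ?U" "w \<in> carrier ?U"
    then obtain p q where [simp]: "u = ?J +>\<^bsub>class_ring\<^esub> p" "w = ?J +>\<^bsub>class_ring\<^esub> q"
      using coset by metis
    show "env_lift B \<eta> \<alpha> \<beta> (u \<otimes>\<^bsub>?U\<^esub> w) = env_lift B \<eta> \<alpha> \<beta> u \<otimes>\<^bsub>B\<^esub> env_lift B \<eta> \<alpha> \<beta> w"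
      "env_lift B \<eta> \<alpha> \<beta> (u \<oplus>\<^bsub>?U\<^esub> w) = env_lift B \<eta> \<alpha> \<beta> u \<oplus>\<^bsub>B\<^esub> env_lift B \<eta> \<alpha> \<beta> w"
      by (simp_all add: cs(2,3)[symmetric] lift fl)
  next
    fix u assume "u \<in> carrier ?U"
    then obtain p where "u = ?J +>\<^bsub>class_ring\<^esub> p"
      using coset by metis
    then show "env_lift B \<eta> \<alpha> \<beta> u \<in> carrier B"
      by (simp add: lift fl)
  next
    show "env_lift B \<eta> \<alpha> \<beta> \<one>\<^bsub>?U\<^esub> = \<one>\<^bsub>B\<^esub>"
      by (simp add: cs(5)[symmetric] lift one)
  qed
  show "env_lift B \<eta> \<alpha> \<beta> (env_const scale br c) = \<eta> c"
    "env_lift B \<eta> \<alpha> \<beta> (env_alpha scale br a) = \<alpha> a"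
    "env_lift B \<eta> \<alpha> \<beta> (env_beta scale br a) = \<beta> a"
    by (simp_all add: env_const_def env_alpha_def env_beta_def lift fl)
  assume h: "h \<in> Ring.ring_hom ?U B" "\<And>c. h (env_const scale br c) = \<eta> c"
    "\<And>a. h (env_alpha scale br a) = \<alpha> a" "\<And>a. h (env_beta scale br a) = \<beta> a"
    and u: "u \<in> carrier ?U"
  have "h (?J +>\<^bsub>class_ring\<^esub> p) = ?L p" for p
  proof (induction p rule: free_algebra_induct)
    case (const c)
    show ?case using h(2)[of c] by (simp add: env_const_def fl)
  next
    case (gen g)
    show ?case using h(3,4) by (cases g) (simp_all add: env_alpha_def env_beta_def fl)
  next
    case (add p q)
    then show ?case by (simp add: cs ring_hom_add[OF h(1)] fl)
  next
    case (mult p q)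
    then show ?case by (simp add: cs ring_hom_mult[OF h(1)] fl)
  qed
  then show "h u = env_lift B \<eta> \<alpha> \<beta> u"
    using coset[OF u] lift by metis
qed


section \<open>Poisson differential operators\<close>

definition endo_ring :: "('k::field \<Rightarrow> 'a::comm_ring_1 \<Rightarrow> 'a) \<Rightarrow> ('a \<Rightarrow> 'a) ring" where
  "endo_ring scale = \<lparr>carrier = {f. Vector_Spaces.linear scale scale f},
     mult = (\<circ>), one = id, zero = (\<lambda>_. 0), add = (\<lambda>f g y. f y + g y)\<rparr>"

text \<open>
  The multiplications by elements of the algebra include those by scalars, so the subring they
  generate together with the derivations is a subalgebra.
\<close>

definition poisson_diff_ops :: "('k::field \<Rightarrow> 'a::comm_ring_1 \<Rightarrow> 'a) \<Rightarrow> ('a \<Rightarrow> 'a \<Rightarrow> 'a)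
    \<Rightarrow> ('a \<Rightarrow> 'a) ring" where
  "poisson_diff_ops scale br = (endo_ring scale)
     \<lparr>carrier := generate_ring (endo_ring scale) (range (*) \<union> range br)\<rparr>"

definition env_pi :: "('k::field \<Rightarrow> 'a::comm_ring_1 \<Rightarrow> 'a) \<Rightarrow> ('a \<Rightarrow> 'a \<Rightarrow> 'a)
    \<Rightarrow> ('k, 'a) env_free set \<Rightarrow> 'a \<Rightarrow> 'a" where
  "env_pi scale br = env_lift (poisson_diff_ops scale br) scale (*) br"


lemma ring_endo_ring:
  fixes scale :: "'k::field \<Rightarrow> 'a::comm_ring_1 \<Rightarrow> 'a"
  assumes "vector_space scale"
  shows "ring (endo_ring scale)"
proof -
  interpret vector_space_pair scale scale
    by (intro vector_space_pair.intro assms)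
  show ?thesis
  proof (rule ringI)
    show "abelian_group (endo_ring scale)"
    proof (rule abelian_groupI)
      fix f assume "f \<in> carrier (endo_ring scale)"
      then show "\<exists>g \<in> carrier (endo_ring scale). g \<oplus>\<^bsub>endo_ring scale\<^esub> f = \<zero>\<^bsub>endo_ring scale\<^esub>"
        by (intro bexI[of _ "\<lambda>y. - f y"]) (auto simp: endo_ring_def linear_compose_neg)
    qed (auto simp: endo_ring_def linear_compose_add linear_zero add_ac)
    show "monoid (endo_ring scale)"
      by (rule monoidI)
        (auto simp: endo_ring_def o_assoc vs1.linear_id intro: Vector_Spaces.linear_compose)
  qed (auto simp: endo_ring_def linear_add fun_eq_iff)
qed

lemma poisson_diff_ops_triple:
  assumes "poisson_algebra scale br"
  shows "poisson_triple scale br (poisson_diff_ops scale br) scale (*) br"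
proof -
  interpret poisson_algebra scale br by fact
  interpret vector_space_pair scale scale
    by (intro vector_space_pair.intro vector_space_axioms)
  interpret E: ring "endo_ring scale" by (rule ring_endo_ring[OF vector_space_axioms])
  let ?G = "range (*) \<union> range br" and ?P = "poisson_diff_ops scale br"
  have scale_mult_right: "scale c (a * b) = a * scale c b" for a b c
    by (metis scale_mult mult.commute)
  have lin: "Vector_Spaces.linear scale scale (br a)" for a
    by unfold_locales (simp_all add: br_add_right br_scale_right)
  have lin_mult: "Vector_Spaces.linear scale scale ((*) a)" for a
    by unfold_locales (simp_all add: distrib_left scale_mult_right)
  have G: "?G \<subseteq> carrier (endo_ring scale)"
    by (auto simp: endo_ring_def lin lin_mult)
  have sub: "subring (generate_ring (endo_ring scale) ?G) (endo_ring scale)"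
    by (rule E.generate_ring_is_subring[OF G])
  have ring: "ring ?P"
    unfolding poisson_diff_ops_def by (rule E.subring_is_ring[OF sub])
  interpret P: ring ?P by (rule ring)
  have carr: "carrier ?P = generate_ring (endo_ring scale) ?G"
    by (simp add: poisson_diff_ops_def)
  have lin_P: "Vector_Spaces.linear scale scale f" if "f \<in> carrier ?P" for f
    using that E.generate_ring_in_carrier[OF G] by (auto simp: carr endo_ring_def)
  have ops: "f \<otimes>\<^bsub>?P\<^esub> g = f \<circ> g" "f \<oplus>\<^bsub>?P\<^esub> g = (\<lambda>y. f y + g y)" "\<one>\<^bsub>?P\<^esub> = id" for f g
    by (simp_all add: poisson_diff_ops_def endo_ring_def)
  have mult_in: "(*) a \<in> carrier ?P" and br_in: "br a \<in> carrier ?P" for a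
    by (auto simp: carr intro: generate_ring.incl)
  have scale_eq: "scale c = (*) (scale c 1)" for c
    by (rule ext) (metis scale_mult mult_1)
  have scale_in: "scale c \<in> carrier ?P" for c
    by (subst scale_eq) (rule mult_in)
  have minus: "f \<ominus>\<^bsub>?P\<^esub> g = (\<lambda>y. f y - g y)" if "f \<in> carrier ?P" "g \<in> carrier ?P" for f g
  proof -
    have "f = (f \<ominus>\<^bsub>?P\<^esub> g) \<oplus>\<^bsub>?P\<^esub> g"
      using that by (simp add: P.minus_eq P.a_assoc P.l_neg)
    then have "f y = ((f \<ominus>\<^bsub>?P\<^esub> g) \<oplus>\<^bsub>?P\<^esub> g) y" for y
      by (rule fun_cong)
    then have "f y = (f \<ominus>\<^bsub>?P\<^esub> g) y + g y" for y
      by (simp only: ops(2))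
    then show ?thesis by (simp add: fun_eq_iff)
  qed
  have comp_in: "f \<circ> g \<in> carrier ?P" if "f \<in> carrier ?P" "g \<in> carrier ?P" for f g
    using P.m_closed[OF that] by (simp add: ops)
  have br_swap: "br a b = - br b a" for a b
  proof -
    have "br a b + br b a = 0"
      using br_self[of "a + b"] unfolding br_add_left br_add_right
      by (simp add: br_self add.commute)
    then show ?thesis by (simp only: eq_neg_iff_add_eq_0)
  qed
  have br_minus: "br a (- b) = - br a b" for a b
  proof -
    have "br a 0 = 0" using br_add_right[of a 0 0] by simp
    then have "br a (- b) + br a b = 0" using br_add_right[of a "- b" b] by simp
    then show ?thesis by (simp only: eq_neg_iff_add_eq_0)
  qed
  have br_br: "br (br a b) y = br a (br b y) - br b (br a y)" for a b y
  proof -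
    have "br a (br b y) + br b (- br a y) + - br (br a b) y = 0"
      using br_jacobi[of a b y] by (simp only: br_swap[of y "br a b"] br_swap[of y a])
    then show ?thesis by (simp add: br_minus)
  qed
  have br_mult_left: "br (a * b) y = a * br b y + b * br a y" for a b y
  proof -
    have "br (a * b) y = - (br y a * b + a * br y b)"
      by (simp only: br_swap[of "a * b" y] br_mult_right)
    also have "\<dots> = - ((- br a y) * b + a * (- br b y))"
      by (simp only: br_swap[of y a] br_swap[of y b])
    finally show ?thesis by (simp add: mult.commute add.commute)
  qed
  show ?thesis
  proof (unfold_locales, goal_cases)
    case 1
    show ?case
      by (rule ring_hom_memI)
        (simp_all add: ops scale_in scale_left_distrib fun_eq_iff)
  next
    case (2 y c)
    show ?case
      using linear_scale[OF lin_P[OF 2]] by (simp add: ops fun_eq_iff)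
  next
    case 3
    show ?case
      by (rule ring_hom_memI) (auto simp: ops mult_in fun_eq_iff algebra_simps)
  next
    case (4 c a)
    show ?case by (simp add: ops fun_eq_iff scale_mult)
  next
    case (5 a)
    show ?case by (rule br_in)
  next
    case (6 a b)
    show ?case by (simp add: ops fun_eq_iff br_add_left)
  next
    case (7 c a)
    show ?case by (simp add: ops fun_eq_iff br_scale_left)
  next
    case (8 a b)
    show ?case by (simp add: ops minus comp_in br_in fun_eq_iff br_br)
  next
    case (9 a b)
    show ?case by (simp add: ops minus comp_in br_in mult_in fun_eq_iff br_mult_right)
  next
    case (10 a b)
    show ?case by (simp add: ops fun_eq_iff br_mult_left)
  qed
qed

theorem env_pi_hom:
  assumes "poisson_algebra scale br"
  shows "env_pi scale br \<in> Ring.ring_hom (env scale br) (poisson_diff_ops scale br)"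
    and "env_pi scale br (env_alpha scale br a) = (*) a"
    and "env_pi scale br (env_beta scale br a) = br a"
  using env_universal(1,3,4)[OF poisson_diff_ops_triple[OF assms]] by (simp_all add: env_pi_def)


section \<open>Minors of the Poisson matrix\<close>

definition poisson_rank :: "('a::idom \<Rightarrow> 'a \<Rightarrow> 'a) \<Rightarrow> nat \<Rightarrow> (nat \<Rightarrow> 'a) \<Rightarrow> nat" where
  "poisson_rank br n x =
     vec_space.rank n (map_mat to_fract (mat n n (\<lambda>(i, j). br (x i) (x j))))"

definition index_tuples :: "nat \<Rightarrow> nat \<Rightarrow> nat list set" where
  "index_tuples n d = {is. sorted_wrt (<) is \<and> length is = d \<and> set is \<subseteq> {..<n}}"

definition minor :: "('a::comm_ring_1 \<Rightarrow> 'a \<Rightarrow> 'a) \<Rightarrow> (nat \<Rightarrow> 'a) \<Rightarrow> nat list \<Rightarrow> nat list \<Rightarrow> 'a" where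
  "minor br x is js = det (mat (length is) (length js) (\<lambda>(s, t). br (x (is ! s)) (x (js ! t))))"

definition minor_rows :: "('a::comm_ring_1 \<Rightarrow> 'a \<Rightarrow> 'a) \<Rightarrow> nat \<Rightarrow> (nat \<Rightarrow> 'a) \<Rightarrow> nat
    \<Rightarrow> nat list set" where
  "minor_rows br n x d =
     {is \<in> index_tuples n d. \<exists>js \<in> index_tuples n d. minor br x is js \<noteq> 0}"

definition minor_cols :: "('a::comm_ring_1 \<Rightarrow> 'a \<Rightarrow> 'a) \<Rightarrow> nat \<Rightarrow> (nat \<Rightarrow> 'a) \<Rightarrow> nat
    \<Rightarrow> nat list set" where
  "minor_cols br n x d =
     {js \<in> index_tuples n d. \<exists>is \<in> index_tuples n d. minor br x is js \<noteq> 0}"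

definition minor_ideal :: "('a::comm_ring_1 \<Rightarrow> 'a \<Rightarrow> 'a) \<Rightarrow> nat \<Rightarrow> (nat \<Rightarrow> 'a) \<Rightarrow> nat \<Rightarrow> 'a set" where
  "minor_ideal br n x d =
     Idl\<^bsub>class_ring\<^esub> {minor br x is js | is js. is \<in> index_tuples n d \<and> js \<in> index_tuples n d}"

text \<open>
  \<open>kappa_gen scale br x is \<nu> js\<close> is the element \<open>\<delta>\<^bsub>is,\<nu>;js\<^esub>\<close>; the list obtained from \<open>is\<close> by omitting
  an entry and appending \<open>\<nu>\<close> is in general not increasing.  Positions \<open>s\<close> in \<open>is\<close> count from \<open>0\<close>,
  whence the exponent \<open>Suc s + d + 1\<close>.
\<close>

definition kappa_gen :: "('k::field \<Rightarrow> 'a::comm_ring_1 \<Rightarrow> 'a) \<Rightarrow> ('a \<Rightarrow> 'a \<Rightarrow> 'a) \<Rightarrow> (nat \<Rightarrow> 'a)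
    \<Rightarrow> nat list \<Rightarrow> nat \<Rightarrow> nat list \<Rightarrow> ('k, 'a) env_free set" where
  "kappa_gen scale br x is \<nu> js =
    (let U = env scale br; \<alpha> = env_alpha scale br; \<delta> = (\<lambda>i. env_beta scale br (x i)); d = length is in
      \<alpha> (minor br x is js) \<otimes>\<^bsub>U\<^esub> \<delta> \<nu> \<oplus>\<^bsub>U\<^esub>
      (\<Oplus>\<^bsub>U\<^esub>s \<in> {..<d}. \<alpha> ((-1) ^ (Suc s + d + 1)
          * minor br x (take s is @ drop (Suc s) is @ [\<nu>]) js) \<otimes>\<^bsub>U\<^esub> \<delta> (is ! s)))"

definition kappa :: "('k::field \<Rightarrow> 'a::comm_ring_1 \<Rightarrow> 'a) \<Rightarrow> ('a \<Rightarrow> 'a \<Rightarrow> 'a) \<Rightarrow> nat \<Rightarrow> (nat \<Rightarrow> 'a)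
    \<Rightarrow> nat \<Rightarrow> ('k, 'a) env_free set set" where
  "kappa scale br n x d = Idl\<^bsub>env scale br\<^esub>
     {kappa_gen scale br x is \<nu> js | is \<nu> js.
        is \<in> minor_rows br n x d \<and> js \<in> minor_cols br n x d \<and> \<nu> \<in> {..<n} - set is}"


section \<open>Torsion and annihilators\<close>

definition torsion :: "('r, 'm) ring_scheme \<Rightarrow> 'r set \<Rightarrow> 'r set" where
  "torsion R T = {u \<in> carrier R. \<exists>\<tau> \<in> T. \<tau> \<otimes>\<^bsub>R\<^esub> u = \<zero>\<^bsub>R\<^esub>}"

definition left_ann :: "('r, 'm) ring_scheme \<Rightarrow> 'r set \<Rightarrow> 'r set" where
  "left_ann R C = {u \<in> carrier R. \<forall>y \<in> C. u \<otimes>\<^bsub>R\<^esub> y = \<zero>\<^bsub>R\<^esub>}"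

definition right_ann :: "('r, 'm) ring_scheme \<Rightarrow> 'r set \<Rightarrow> 'r set" where
  "right_ann R C = {u \<in> carrier R. \<forall>y \<in> C. y \<otimes>\<^bsub>R\<^esub> u = \<zero>\<^bsub>R\<^esub>}"

end

(*
Write U for the enveloping algebra, work modulo the ideal kappa, and fix a non-zero minor mu of
size d with rows i_s and columns j_t.  Cramer's rule and the generators of kappa express mu L(b), for
every b, through Delta_t = sum_s adj(t,s) L(x_(i_s)): mu L(b) = sum_t {b, x_(j_t)} Delta_t.  Hence
Euler's formula sum_t [u, x_(j_t)] Delta_t = N mu u + (terms of degree < N) holds for u of degree N.
If u lies in ker pi, then so do the commutators [u, x_(j_t)], which have lower degree, and induction
on N (in characteristic zero) gives mu^k u = 0 for some k.  The left and right Noetherian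
properties of U make k uniform and transfer the statement to u mu^k = 0; a high power of the ideal
of minors is contained in the ideal generated by these powers of minors.  Conversely pi(u) is a
differential operator on a domain, so a pi(u) = 0 or pi(u) a = 0 with a non-zero forces pi(u) = 0.
*)

theory Submission
  imports Defs "HOL-Library.Multiset_Order"
begin

section \<open>Chains of submodules spanned by monomials\<close>

text \<open>The monomials in the \<open>L (x i)\<close> span the enveloping algebra over the Poisson
  algebra, but in general they satisfy relations, those coming from the \<open>f j\<close> and from
  kappa. So no element has a well-defined leading coefficient, and the Noetherian property is drawn
  from spanning alone, through the set of all leading coefficients that occur. It is needed on both
  sides. The exponent that Euler's formula yields depends on the element; chains of right ideals
  make it uniform, only a uniform exponent lets the power of the minor change sides, and chains of
  left ideals make the result uniform again. The chain condition for right ideals comes from that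
  for left ideals by reversing the product and the sign of the bracket. All computations take place
  in the free algebra, as congruences modulo the preimage \<open>K\<close> of kappa; the defining
  relations and the generators of kappa are thereby treated alike. Statements about an arbitrary
  element of the localized algebra are reduced to the variables by an induction over constants,
  variables, sums, products and inverses.\<close>

definition ring_ideal :: "'r::comm_ring_1 set \<Rightarrow> bool" where
  "ring_ideal I \<longleftrightarrow> 0 \<in> I \<and> (\<forall>a\<in>I. \<forall>b\<in>I. a + b \<in> I) \<and> (\<forall>a\<in>I. \<forall>r. r * a \<in> I)"

lemma ring_idealD:
  assumes "ring_ideal I"
  shows "0 \<in> I" "a \<in> I \<Longrightarrow> b \<in> I \<Longrightarrow> a + b \<in> I" "a \<in> I \<Longrightarrow> r * a \<in> I" "a \<in> I \<Longrightarrow> - a \<in> I"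
proof -
  show "a \<in> I \<Longrightarrow> - a \<in> I"
    using assms mult_minus_left[of 1 a] unfolding ring_ideal_def by (metis mult_1)
qed (use assms in \<open>auto simp: ring_ideal_def\<close>)

text \<open>A property of the type, so that the coefficient ring can be varied: the scalar field
  when the Poisson algebra is studied, the Poisson algebra itself when its enveloping algebra
  is.\<close>

definition acc_ideals :: "'r::comm_ring_1 itself \<Rightarrow> bool" where
  "acc_ideals _ \<longleftrightarrow> (\<forall>I :: nat \<Rightarrow> 'r set. (\<forall>k. ring_ideal (I k)) \<longrightarrow> mono I \<longrightarrow>
     (\<exists>k0. \<forall>k\<ge>k0. I k = I k0))"

lemma acc_ideals_field: "acc_ideals TYPE('k::field)"
  unfolding acc_ideals_def
proof (intro allI impI)
  fix I :: "nat \<Rightarrow> 'k set" assume id: "\<forall>k. ring_ideal (I k)" and mono: "mono I"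
  show "\<exists>k0. \<forall>k\<ge>k0. I k = I k0"
  proof (cases "\<exists>k. \<exists>a\<in>I k. a \<noteq> 0")
    case True
    then obtain k0 a where a: "a \<in> I k0" "a \<noteq> 0" by blast
    have "I k = UNIV" if "k \<ge> k0" for k
    proof -
      have "a \<in> I k" using mono that a by (meson monoD subsetD)
      then have "b / a * a \<in> I k" for b using id ring_idealD(3) by blast
      then show ?thesis using a by auto
    qed
    then show ?thesis by blast
  next
    case False
    then have "I k = {0}" for k using id ring_idealD(1) by blast
    then show ?thesis by auto
  qed
qed

text \<open>Exponent vectors are multisets of indices. The subsequence is refined one coordinate at
  a time, each time to a monotone one; among natural numbers a non-increasing sequence can be
  refined to a constant one.\<close>

lemma dickson:
  fixes g :: "nat \<Rightarrow> nat multiset"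
  assumes "\<And>k. set_mset (g k) \<subseteq> {..<n}"
  shows "\<exists>r :: nat \<Rightarrow> nat. strict_mono r \<and> (\<forall>i j. i \<le> j \<longrightarrow> g (r i) \<subseteq># g (r j))"
proof -
  have "\<exists>r. strict_mono (r :: nat \<Rightarrow> nat) \<and> (\<forall>l<m. \<forall>i j. i \<le> j \<longrightarrow> count (g (r i)) l \<le> count (g (r j)) l)" for m
  proof (induction m)
    case 0
    show ?case by (rule exI[of _ id]) (simp add: strict_mono_def)
  next
    case (Suc m)
    then obtain r where r: "strict_mono (r :: nat \<Rightarrow> nat)"
      "\<And>l i j. l < m \<Longrightarrow> i \<le> j \<Longrightarrow> count (g (r i)) l \<le> count (g (r j)) l" by blast
    define s where "s = (\<lambda>i. count (g (r i)) m)"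
    obtain q :: "nat \<Rightarrow> nat" where q: "strict_mono q" "\<And>i j. i \<le> j \<Longrightarrow> s (q i) \<le> s (q j)"
    proof -
      obtain f :: "nat \<Rightarrow> nat" where f: "strict_mono f" "monoseq (\<lambda>i. s (f i))" using seq_monosub by blast
      show ?thesis
      proof (cases "\<forall>i. \<forall>j\<ge>i. s (f i) \<le> s (f j)")
        case True
        show ?thesis by (rule that[OF f(1)]) (use True in blast)
      next
        case False
        with f(2) have dec: "\<forall>i. \<forall>j\<ge>i. s (f j) \<le> s (f i)" unfolding monoseq_def by blast
        \<comment> \<open>A non-increasing sequence of natural numbers is constant from any place
          \<open>i0\<close> on where it takes its least value.\<close>
        define v where "v = (LEAST v. v \<in> range (\<lambda>i. s (f i)))"
        have "v \<in> range (\<lambda>i. s (f i))" unfolding v_def by (rule LeastI[of _ "s (f 0)"]) simp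
        then obtain i0 where i0: "v = s (f i0)" by auto
        have le: "v \<le> s (f i)" for i unfolding v_def by (rule Least_le) simp
        have eq: "s (f (i0 + i)) = v" for i using dec i0 le[of "i0 + i"] by (simp add: antisym)
        show ?thesis
          by (rule that[of "\<lambda>i. f (i0 + i)"]) (use f(1) eq in \<open>auto simp: strict_mono_def\<close>)
      qed
    qed
    have qle: "q i \<le> q j" if "i \<le> j" for i j using q(1) that by (simp add: strict_mono_less_eq)
    have "count (g ((r \<circ> q) i)) l \<le> count (g ((r \<circ> q) j)) l" if "l < Suc m" "i \<le> j" for l i j
      using that q(2)[OF that(2)] r(2)[OF _ qle[OF that(2)], of l] by (cases "l = m") (auto simp: s_def)
    then show ?case using strict_mono_o[OF r(1) q(1)] by blast
  qed
  from this[of n] obtain r :: "nat \<Rightarrow> nat" where r: "strict_mono r"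
    and "\<forall>l<n. \<forall>i j. i \<le> j \<longrightarrow> count (g (r i)) l \<le> count (g (r j)) l" by (elim exE conjE)
  then have rc: "count (g (r i)) l \<le> count (g (r j)) l" if "l < n" "i \<le> j" for l i j
    using that by simp
  have "g (r i) \<subseteq># g (r j)" if "i \<le> j" for i j
  proof (rule mset_subset_eqI)
    fix l
    show "count (g (r i)) l \<le> count (g (r j)) l"
    proof (cases "l < n")
      case False
      then have "count (g (r i)) l = 0" using assms[of "r i"] by (auto simp: not_in_iff[symmetric])
      then show ?thesis by simp
    qed (use rc that in auto)
  qed
  then show ?thesis using r by blast
qed

text \<open>Degree comes first because commuting two generators leaves terms of smaller degree. Ties
  are broken by the multiset order, which over \<open>nat\<close> is total and respected by
  \<open>add_mset\<close>.\<close>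

definition mon_less :: "nat multiset \<Rightarrow> nat multiset \<Rightarrow> bool" where
  "mon_less \<gamma> \<gamma>' \<longleftrightarrow> size \<gamma> < size \<gamma>' \<or> size \<gamma> = size \<gamma>' \<and> \<gamma> < \<gamma>'"

lemma wfp_mon_less: "wfp mon_less"
proof -
  have "wf (inv_image (less_than <*lex*> {(x, y :: nat multiset). x < y}) (\<lambda>\<gamma>. (size \<gamma>, \<gamma>)))"
    by (intro wf_inv_image wf_lex_prod wf_less_than wf)
  moreover have "inv_image (less_than <*lex*> {(x, y :: nat multiset). x < y}) (\<lambda>\<gamma>. (size \<gamma>, \<gamma>))
      = {(x, y). mon_less x y}"
    by (auto simp: mon_less_def)
  ultimately show ?thesis by (simp add: wfp_def)
qed

lemma mon_less_trans: "mon_less \<alpha> \<beta> \<Longrightarrow> mon_less \<beta> \<gamma> \<Longrightarrow> mon_less \<alpha> \<gamma>"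
  unfolding mon_less_def by auto

lemma mon_less_linear: "mon_less \<alpha> \<beta> \<or> \<alpha> = \<beta> \<or> mon_less \<beta> \<alpha>"
  unfolding mon_less_def by (metis linorder_less_linear)

lemma mon_less_add: "mon_less \<alpha> \<beta> \<Longrightarrow> mon_less (add_mset i \<alpha>) (add_mset i \<beta>)"
  unfolding mon_less_def by simp

text \<open>
  The laws of a module are required only modulo \<open>K\<close>, because the enveloping algebra will be replaced
  by a free algebra in which its relations hold modulo an ideal.
\<close>

locale monomial_module =
  fixes n :: nat and K :: "'m::ab_group_add set" and sm :: "'r::comm_ring_1 \<Rightarrow> 'm \<Rightarrow> 'm"
    and X :: "nat \<Rightarrow> 'm \<Rightarrow> 'm" and mon :: "nat multiset \<Rightarrow> 'm"
  assumes K_zero: "0 \<in> K" and K_add: "p \<in> K \<Longrightarrow> q \<in> K \<Longrightarrow> p + q \<in> K" and K_uminus: "p \<in> K \<Longrightarrow> - p \<in> K"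
    and K_sm: "p \<in> K \<Longrightarrow> sm a p \<in> K" and K_X: "p \<in> K \<Longrightarrow> X i p \<in> K"
    and sm_add_right: "sm a (p + q) = sm a p + sm a q"
    and sm_add_left: "sm (a + b) p - (sm a p + sm b p) \<in> K"
    and sm_mult: "sm (a * b) p - sm a (sm b p) \<in> K"
    and X_add: "X i (p + q) = X i p + X i q"
begin

text \<open>What counts as a lower term at \<open>\<gamma>\<close>. The monomials used have indices
  below \<open>n\<close>, but the bound \<open>\<gamma>\<close> may use any index, so large bounds
  exist even for \<open>n = 0\<close>.\<close>

inductive_set low :: "nat multiset \<Rightarrow> 'm set" for \<gamma> :: "nat multiset" where
  K: "p \<in> K \<Longrightarrow> p \<in> low \<gamma>"
| mon: "mon_less \<gamma>' \<gamma> \<Longrightarrow> set_mset \<gamma>' \<subseteq> {..<n} \<Longrightarrow> sm a (mon \<gamma>') \<in> low \<gamma>"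
| add: "p \<in> low \<gamma> \<Longrightarrow> q \<in> low \<gamma> \<Longrightarrow> p + q \<in> low \<gamma>"

lemma sm_zero_right: "sm a 0 = 0"
  using sm_add_right[of a 0 0] by simp

lemma sm_uminus_right: "sm a (- p) = - sm a p"
  using sm_add_right[of a p "- p"] by (simp add: sm_zero_right minus_unique)

lemma sm_diff_right: "sm a (p - q) = sm a p - sm a q"
  using sm_add_right[of a p "- q"] by (simp add: sm_uminus_right)

lemma X_zero: "X i 0 = 0"
  using X_add[of i 0 0] by simp

lemma X_uminus: "X i (- p) = - X i p"
  using X_add[of i p "- p"] by (simp add: X_zero minus_unique)

lemma X_diff: "X i (p - q) = X i p - X i q"
  using X_add[of i p "- q"] by (simp add: X_uminus)

lemma sm_zero_left: "sm 0 p \<in> K"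
  using K_uminus[OF sm_add_left[of 0 0 p]] by simp

lemma sm_uminus_left: "sm (- a) p + sm a p \<in> K"
proof -
  have "sm (a + - a) p - (sm a p + sm (- a) p) \<in> K" by (rule sm_add_left)
  from K_add[OF sm_zero_left[of p] K_uminus[OF this]] show ?thesis by (simp add: algebra_simps)
qed

lemma low_zero: "0 \<in> low \<gamma>"
  by (rule low.K[OF K_zero])

lemma low_uminus: "p \<in> low \<gamma> \<Longrightarrow> - p \<in> low \<gamma>"
proof (induction rule: low.induct)
  case (K p)
  then show ?case using K_uminus low.K by blast
next
  case (mon \<gamma>' a)
  have "- (sm (- a) (mon \<gamma>') + sm a (mon \<gamma>')) + sm (- a) (mon \<gamma>') \<in> low \<gamma>"
    by (intro low.add low.K[OF K_uminus] sm_uminus_left low.mon mon)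
  then show ?case by simp
next
  case (add p q)
  then show ?case using low.add[of "- p" \<gamma> "- q"] by simp
qed

lemma low_diff: "p \<in> low \<gamma> \<Longrightarrow> q \<in> low \<gamma> \<Longrightarrow> p - q \<in> low \<gamma>"
  using low.add[of p \<gamma> "- q"] low_uminus by simp

lemma low_sm: "p \<in> low \<gamma> \<Longrightarrow> sm a p \<in> low \<gamma>"
proof (induction rule: low.induct)
  case (K p)
  then show ?case using K_sm low.K by blast
next
  case (mon \<gamma>' b)
  have "sm (a * b) (mon \<gamma>') - (sm (a * b) (mon \<gamma>') - sm a (sm b (mon \<gamma>'))) \<in> low \<gamma>"
    by (intro low_diff low.K sm_mult low.mon mon)
  then show ?case by simp
next
  case (add p q)
  then show ?case by (simp add: sm_add_right low.add)
qed

lemma low_lead_add: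
  assumes "u - sm a p \<in> low \<gamma>" "v - sm b p \<in> low \<gamma>"
  shows "u + v - sm (a + b) p \<in> low \<gamma>"
  using low_diff[OF low.add[OF assms] low.K[OF sm_add_left[of a b p]]] by (simp add: algebra_simps)

lemma low_mono: "p \<in> low \<gamma> \<Longrightarrow> mon_less \<gamma> \<gamma>' \<Longrightarrow> p \<in> low \<gamma>'"
  by (induction rule: low.induct) (auto intro: low.intros mon_less_trans)

lemma low_bound:
  assumes "p \<in> low \<gamma>" "q \<in> low \<delta>"
  shows "\<exists>\<epsilon>. p + q \<in> low \<epsilon>"
proof -
  \<comment> \<open>A power of the index 0 of larger size than both bounds.\<close>
  let ?\<epsilon> = "replicate_mset (Suc (size \<gamma> + size \<delta>)) 0"
  have "mon_less \<gamma> ?\<epsilon>" "mon_less \<delta> ?\<epsilon>" by (auto simp: mon_less_def)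
  then have "p + q \<in> low ?\<epsilon>" using low_mono[OF assms(1)] low_mono[OF assms(2)] by (blast intro: low.add)
  then show ?thesis by blast
qed

text \<open>Some presentation has a leading term; neither its monomial nor its coefficient is
  unique, and the coefficient may vanish. In a sum the larger leading monomial wins, and
  coefficients at equal monomials are added.\<close>

lemma low_leading:
  assumes "p \<in> low \<gamma>"
  shows "p \<in> K \<or> (\<exists>\<gamma>' a. mon_less \<gamma>' \<gamma> \<and> set_mset \<gamma>' \<subseteq> {..<n} \<and> p - sm a (mon \<gamma>') \<in> low \<gamma>')"
  using assms
proof (induction rule: low.induct)
  case (K p)
  then show ?case by blast
next
  case (mon \<gamma>' a)
  then show ?case by (metis diff_self low_zero)
next
  case (add p q)
  \<comment> \<open>A summand below the leading monomial of the other one leaves that leading term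
    in place.\<close>
  have *: "p + q \<in> K \<or> (\<exists>\<gamma>' a. mon_less \<gamma>' \<gamma> \<and> set_mset \<gamma>' \<subseteq> {..<n} \<and> p + q - sm a (mon \<gamma>') \<in> low \<gamma>')"
    if "p \<in> low \<gamma>1" "mon_less \<gamma>1 \<gamma>" "set_mset \<gamma>1 \<subseteq> {..<n}" "q - sm b (mon \<gamma>1) \<in> low \<gamma>1" for p q \<gamma>1 b
  proof -
    have "p + q - sm b (mon \<gamma>1) \<in> low \<gamma>1"
      using low.add[OF that(1,4)] by (simp add: algebra_simps)
    with that show ?thesis by blast
  qed
  have lead_low: "p \<in> low \<gamma>2" if "mon_less \<gamma>1 \<gamma>2" "set_mset \<gamma>1 \<subseteq> {..<n}" "p - sm a (mon \<gamma>1) \<in> low \<gamma>1"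
    for p \<gamma>1 \<gamma>2 a
    using low.add[OF low_mono[OF that(3,1)] low.mon[OF that(1,2)], of a] by simp
  show ?case
  proof (cases "p \<in> K \<or> q \<in> K")
    case True
    then show ?thesis
    proof
      assume p: "p \<in> K"
      show ?thesis using add.IH(2) *[of p _ q] K_add[OF p] low.K[OF p] by blast
    next
      assume q: "q \<in> K"
      have "q + p \<in> K \<or> (\<exists>\<gamma>' a. mon_less \<gamma>' \<gamma> \<and> set_mset \<gamma>' \<subseteq> {..<n} \<and> q + p - sm a (mon \<gamma>') \<in> low \<gamma>')"
        using add.IH(1) *[of q _ p] K_add[OF q] low.K[OF q] by blast
      then show ?thesis by (simp add: add.commute)
    qed
  next
    case False
    with add.IH obtain \<gamma>1 a \<gamma>2 b where
      1: "mon_less \<gamma>1 \<gamma>" "set_mset \<gamma>1 \<subseteq> {..<n}" "p - sm a (mon \<gamma>1) \<in> low \<gamma>1" and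
      2: "mon_less \<gamma>2 \<gamma>" "set_mset \<gamma>2 \<subseteq> {..<n}" "q - sm b (mon \<gamma>2) \<in> low \<gamma>2" by blast
    consider "mon_less \<gamma>1 \<gamma>2" | "\<gamma>1 = \<gamma>2" | "mon_less \<gamma>2 \<gamma>1" using mon_less_linear by blast
    then show ?thesis
    proof cases
      case 1
      with lead_low[OF this \<open>set_mset \<gamma>1 \<subseteq> {..<n}\<close> \<open>p - sm a (mon \<gamma>1) \<in> low \<gamma>1\<close>] 2 * show ?thesis by blast
    next
      case 3
      with lead_low[OF this 2(2,3)] 1 *[of q \<gamma>1 p] show ?thesis by (simp add: add.commute)
    next
      case eq: 2
      have "p + q - sm (a + b) (mon \<gamma>1) \<in> low \<gamma>1"
        using low_lead_add[OF 1(3)] 2(3) eq by blast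
      with 1 show ?thesis by blast
    qed
  qed
qed

text \<open>The last condition says that the monomials exhaust \<open>L\<close> modulo
  \<open>K\<close>; it provides the starting point of the descent along
  \<open>mon_less\<close>.\<close>

definition submod :: "'m set \<Rightarrow> bool" where
  "submod L \<longleftrightarrow> K \<subseteq> L \<and> (\<forall>p\<in>L. \<forall>q\<in>L. p + q \<in> L) \<and> (\<forall>p\<in>L. - p \<in> L) \<and> (\<forall>a. \<forall>p\<in>L. sm a p \<in> L)
     \<and> (\<forall>i<n. \<forall>p\<in>L. X i p \<in> L) \<and> (\<forall>p\<in>L. \<exists>\<gamma>. p \<in> low \<gamma>)"

text \<open>All coefficients that some presentation of some element of \<open>L\<close> has at
  \<open>\<gamma>\<close>. Relations among the monomials may give one element several of
  them.\<close>

definition lead :: "'m set \<Rightarrow> nat multiset \<Rightarrow> 'r set" where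
  "lead L \<gamma> = {a. \<exists>u\<in>L. u - sm a (mon \<gamma>) \<in> low \<gamma>}"

lemma lead_mono: "L \<subseteq> L' \<Longrightarrow> lead L \<gamma> \<subseteq> lead L' \<gamma>"
  unfolding lead_def by auto

lemma ring_ideal_lead:
  assumes L: "submod L"
  shows "ring_ideal (lead L \<gamma>)"
  unfolding ring_ideal_def
proof (intro conjI ballI allI)
  have "0 - sm 0 (mon \<gamma>) \<in> low \<gamma>" by (intro low_diff low_zero low.K sm_zero_left)
  then show "0 \<in> lead L \<gamma>" using L K_zero unfolding lead_def submod_def by blast
next
  fix a b assume "a \<in> lead L \<gamma>" "b \<in> lead L \<gamma>"
  then obtain u v where uv: "u \<in> L" "v \<in> L" "u - sm a (mon \<gamma>) \<in> low \<gamma>" "v - sm b (mon \<gamma>) \<in> low \<gamma>"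
    unfolding lead_def by blast
  from low_lead_add[OF uv(3,4)] have "u + v - sm (a + b) (mon \<gamma>) \<in> low \<gamma>" .
  then show "a + b \<in> lead L \<gamma>" using uv L unfolding lead_def submod_def by blast
next
  fix a r assume "a \<in> lead L \<gamma>"
  then obtain u where u: "u \<in> L" "u - sm a (mon \<gamma>) \<in> low \<gamma>"
    unfolding lead_def by blast
  have "sm r (u - sm a (mon \<gamma>)) - (sm (r * a) (mon \<gamma>) - sm r (sm a (mon \<gamma>))) \<in> low \<gamma>"
    by (rule low_diff[OF low_sm[OF u(2)] low.K[OF sm_mult]])
  then have "sm r u - sm (r * a) (mon \<gamma>) \<in> low \<gamma>" by (simp add: sm_diff_right)
  then show "r * a \<in> lead L \<gamma>" using u L unfolding lead_def submod_def by blast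
qed

text \<open>Reduction as for Groebner bases: subtracting an element of \<open>L\<close> with the
  same leading term moves \<open>u\<close> to a smaller bound, and well-foundedness ends the process
  in \<open>K\<close>.\<close>

lemma subset_of_lead_eq:
  assumes L: "submod L" and L': "submod L'" and sub: "L \<subseteq> L'"
    and eq: "\<And>\<gamma>. set_mset \<gamma> \<subseteq> {..<n} \<Longrightarrow> lead L' \<gamma> = lead L \<gamma>"
  shows "L' = L"
proof -
  have "\<forall>u\<in>L' \<inter> low \<gamma>. u \<in> L" for \<gamma>
    using wfp_mon_less
  proof (induction \<gamma> rule: wfp_induct_rule)
    case (less \<gamma>)
    show ?case
    proof
      fix u assume u: "u \<in> L' \<inter> low \<gamma>"
      then consider "u \<in> K" | \<gamma>' a where "mon_less \<gamma>' \<gamma>" "set_mset \<gamma>' \<subseteq> {..<n}" "u - sm a (mon \<gamma>') \<in> low \<gamma>'"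
        using low_leading by blast
      then show "u \<in> L"
      proof cases
        case 1
        then show ?thesis using L by (auto simp: submod_def)
      next
        case 2
        have "a \<in> lead L' \<gamma>'" using 2 u unfolding lead_def by blast
        then obtain v where v: "v \<in> L" "v - sm a (mon \<gamma>') \<in> low \<gamma>'"
          using eq[OF 2(2)] unfolding lead_def by blast
        have "u - v \<in> low \<gamma>'" using low_diff[OF 2(3) v(2)] by simp
        moreover have "u + - v \<in> L'" using u v sub L' unfolding submod_def by blast
        ultimately have "u - v \<in> L" using less.IH[OF 2(1)] by simp
        then have "(u - v) + v \<in> L" using v(1) L unfolding submod_def by blast
        then show ?thesis by simp
      qed
    qed
  qed
  then show ?thesis using L' sub unfolding submod_def by blast
qed

text \<open>Up to lower terms \<open>X i\<close> multiplies monomials as in a commutative polynomial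
  ring. This hypothesis can only be stated here, since it speaks of \<open>low\<close>.\<close>

context
  assumes X_mon: "i < n \<Longrightarrow> set_mset \<gamma> \<subseteq> {..<n} \<Longrightarrow>
    X i (sm a (mon \<gamma>)) - sm a (mon (add_mset i \<gamma>)) \<in> low (add_mset i \<gamma>)"
begin

lemma X_low: "p \<in> low \<gamma> \<Longrightarrow> i < n \<Longrightarrow> X i p \<in> low (add_mset i \<gamma>)"
proof (induction rule: low.induct)
  case (K p)
  then show ?case using K_X low.K by blast
next
  case (mon \<gamma>' a)
  have "(X i (sm a (mon \<gamma>')) - sm a (mon (add_mset i \<gamma>'))) + sm a (mon (add_mset i \<gamma>')) \<in> low (add_mset i \<gamma>)"
    using mon by (intro low.add low_mono[OF X_mon] low.mon mon_less_add) auto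
  then show ?case by simp
next
  case (add p q)
  then show ?case by (simp add: X_add low.add)
qed

lemma lead_subset_add:
  assumes L: "submod L" and "set_mset \<gamma> \<subseteq> {..<n}" "i < n"
  shows "lead L \<gamma> \<subseteq> lead L (add_mset i \<gamma>)"
proof
  fix a assume "a \<in> lead L \<gamma>"
  then obtain u where u: "u \<in> L" "u - sm a (mon \<gamma>) \<in> low \<gamma>"
    unfolding lead_def by blast
  have "X i (u - sm a (mon \<gamma>)) + (X i (sm a (mon \<gamma>)) - sm a (mon (add_mset i \<gamma>))) \<in> low (add_mset i \<gamma>)"
    using assms u by (intro low.add X_low X_mon)
  then have "X i u - sm a (mon (add_mset i \<gamma>)) \<in> low (add_mset i \<gamma>)" by (simp add: X_diff)
  then show "a \<in> lead L (add_mset i \<gamma>)" using u L assms(3) unfolding lead_def submod_def by blast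
qed

lemma lead_subset:
  assumes L: "submod L" and sub: "\<gamma> \<subseteq># \<gamma>'" and n: "set_mset \<gamma>' \<subseteq> {..<n}"
  shows "lead L \<gamma> \<subseteq> lead L \<gamma>'"
proof -
  obtain \<delta> where \<delta>: "\<gamma>' = \<gamma> + \<delta>" using sub by (metis subset_mset.add_diff_inverse)
  have "set_mset (\<gamma> + \<delta>) \<subseteq> {..<n} \<Longrightarrow> lead L \<gamma> \<subseteq> lead L (\<gamma> + \<delta>)"
  proof (induction \<delta>)
    case (add i \<delta>)
    then show ?case using lead_subset_add[OF L, of "\<gamma> + \<delta>" i] by auto
  qed simp
  then show ?thesis using n \<delta> by simp
qed

text \<open>
  The leading coefficient ideals increase with \<open>L\<close> and with the monomial, so by Dickson's lemma a
  chain of submodules that never stabilizes yields a strictly increasing chain of ideals.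
\<close>

theorem acc_submod:
  assumes acc: "acc_ideals TYPE('r)" and L: "\<And>k::nat. submod (L k)" and mono: "mono L"
  shows "\<exists>k0. \<forall>k\<ge>k0. L k = L k0"
proof (rule ccontr)
  assume nstab: "\<not> ?thesis"
  \<comment> \<open>Each growth of the chain is visible at some monomial, by the comparison of
    leading coefficients.\<close>
  have "\<exists>k' \<gamma>. k' \<ge> k \<and> set_mset \<gamma> \<subseteq> {..<n} \<and> lead (L k') \<gamma> \<noteq> lead (L k) \<gamma>" for k
  proof -
    obtain k' where k': "k' \<ge> k" "L k' \<noteq> L k" using nstab by blast
    have "L k \<subseteq> L k'" using mono k'(1) by (rule monoD)
    with k' subset_of_lead_eq[OF L L] show ?thesis by blast
  qed
  then obtain next_idx \<Gamma> where nx: "\<And>k. next_idx k \<ge> k" "\<And>k. set_mset (\<Gamma> k) \<subseteq> {..<n}"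
    "\<And>k. lead (L (next_idx k)) (\<Gamma> k) \<noteq> lead (L k) (\<Gamma> k)" by metis
  define f where "f = (\<lambda>i. (next_idx ^^ i) 0)"
  define g where "g = (\<lambda>i. \<Gamma> (f i))"
  have f_Suc: "f (Suc i) = next_idx (f i)" for i by (simp add: f_def)
  have f_mono: "f i \<le> f j" if "i \<le> j" for i j
    by (rule lift_Suc_mono_le[OF _ that]) (simp add: f_Suc nx)
  have "set_mset (g k) \<subseteq> {..<n}" for k by (simp add: g_def nx)
  from dickson[of g n, OF this] obtain r :: "nat \<Rightarrow> nat" where r1: "strict_mono r"
    and r2: "\<forall>i j. i \<le> j \<longrightarrow> g (r i) \<subseteq># g (r j)" by (elim exE conjE)
  note r = r1 r2[rule_format]
  define I where "I = (\<lambda>i. lead (L (f (r i))) (g (r i)))"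
  have step: "lead (L k) (g (r i)) \<subseteq> I j" if "i \<le> j" "k \<le> f (r j)" for i j k
  proof -
    have "lead (L k) (g (r i)) \<subseteq> lead (L (f (r j))) (g (r i))"
      using mono that by (intro lead_mono) (meson monoD)
    also have "\<dots> \<subseteq> lead (L (f (r j))) (g (r j))"
      by (rule lead_subset[OF L r(2)[OF that(1)]]) (simp add: g_def nx)
    finally show ?thesis by (simp add: I_def)
  qed
  have r_le: "r i \<le> r j" if "i \<le> j" for i j using r(1) that by (simp add: strict_mono_less_eq)
  have "mono I"
    by (rule monoI) (simp only: I_def, rule step[unfolded I_def], auto intro: f_mono r_le)
  moreover have "ring_ideal (I k)" for k unfolding I_def by (rule ring_ideal_lead[OF L])
  ultimately obtain k0 where k0: "\<And>k. k \<ge> k0 \<Longrightarrow> I k = I k0"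
    using acc unfolding acc_ideals_def by blast
  \<comment> \<open>At the index \<open>f (Suc (r k0))\<close> the leading ideal for
    \<open>\<Gamma> (f (r k0))\<close> has already changed. The subsequence reaches that index by
    \<open>Suc k0\<close>, so the change would be a proper step from \<open>I k0\<close> to
    \<open>I (Suc k0)\<close>.\<close>
  have "r k0 < r (Suc k0)" using r(1) by (simp add: strict_mono_def)
  then have "lead (L (f (Suc (r k0)))) (g (r k0)) \<subseteq> I (Suc k0)"
    by (intro step f_mono) auto
  also have "\<dots> = I k0" by (rule k0) simp
  finally have "lead (L (next_idx (f (r k0)))) (\<Gamma> (f (r k0))) \<subseteq> lead (L (f (r k0))) (\<Gamma> (f (r k0)))"
    by (simp add: I_def g_def f_Suc)
  moreover have "lead (L (f (r k0))) (\<Gamma> (f (r k0))) \<subseteq> lead (L (next_idx (f (r k0)))) (\<Gamma> (f (r k0)))"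
    using mono nx(1) by (intro lead_mono) (meson monoD)
  ultimately show False using nx(3) by blast
qed

end

end

section \<open>Algebras of essentially finite type are Noetherian\<close>

inductive_set poly_alg :: "('k::field \<Rightarrow> 'a::comm_ring_1 \<Rightarrow> 'a) \<Rightarrow> nat \<Rightarrow> (nat \<Rightarrow> 'a) \<Rightarrow> 'a set"
  for scale n x where
  const: "scale c 1 \<in> poly_alg scale n x"
| add: "p \<in> poly_alg scale n x \<Longrightarrow> q \<in> poly_alg scale n x \<Longrightarrow> p + q \<in> poly_alg scale n x"
| var: "i < n \<Longrightarrow> p \<in> poly_alg scale n x \<Longrightarrow> x i * p \<in> poly_alg scale n x"

text \<open>A localization of a finitely generated algebra, described elementwise: \<open>t\<close>
  is the inverse of the denominator \<open>s\<close>.\<close>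

locale ess_finite = comm_algebra scale
  for scale :: "'k::field \<Rightarrow> 'a::comm_ring_1 \<Rightarrow> 'a" +
  fixes n :: nat and x :: "nat \<Rightarrow> 'a"
  assumes fraction: "\<exists>r\<in>poly_alg scale n x. \<exists>s\<in>poly_alg scale n x. \<exists>t. s * t = 1 \<and> b = r * t"
begin

text \<open>The tool by which identities between derivations pass from the variables to the whole
  algebra; the case \<open>inv\<close> accounts for the localization.\<close>

lemma alg_induct [case_names const var add mult inv]:
  assumes const: "\<And>c. P (scale c 1)" and var: "\<And>i. i < n \<Longrightarrow> P (x i)"
    and add: "\<And>a b. P a \<Longrightarrow> P b \<Longrightarrow> P (a + b)" and mult: "\<And>a b. P a \<Longrightarrow> P b \<Longrightarrow> P (a * b)"
    and inv: "\<And>s t. P s \<Longrightarrow> s * t = 1 \<Longrightarrow> P t"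
  shows "P b"
proof -
  have P: "P p" if "p \<in> poly_alg scale n x" for p
    using that by induction (auto intro: assms)
  obtain r s t where "r \<in> poly_alg scale n x" "s \<in> poly_alg scale n x" "s * t = 1" "b = r * t"
    using fraction[of b] by blast
  then show ?thesis using P inv mult by metis
qed

lemma scale_eq_mult: "scale c a = scale c 1 * a"
  using scale_mult[of c 1 a] by simp

lemma scale_mult_right: "scale c (a * b) = a * scale c b"
  by (metis scale_mult mult.commute)

text \<open>Hilbert's basis theorem for the subalgebra generated by the variables, with coefficients
  in the field and \<open>K = {0}\<close>; ideals of the localization are then recovered from their
  contractions.\<close>

theorem acc: "acc_ideals TYPE('a)"
proof -
  define mon where "mon = (\<lambda>\<gamma>. \<Prod>i\<in>#\<gamma>. x i)"
  interpret M: monomial_module n "{0}" scale "\<lambda>i p. x i * p" mon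
    by standard (auto simp: scale_right_distrib scale_left_distrib distrib_left)
  have mon_add: "x i * scale c (mon \<gamma>) - scale c (mon (add_mset i \<gamma>)) \<in> M.low (add_mset i \<gamma>)" for i c \<gamma>
    using M.low_zero by (simp add: mon_def scale_mult_right)
  have low: "\<exists>\<gamma>. p \<in> M.low \<gamma>" if "p \<in> poly_alg scale n x" for p
    using that
  proof induction
    case (const c)
    have "scale c (mon {#}) \<in> M.low {#0#}" by (rule M.low.mon) (simp_all add: mon_less_def)
    then show ?case by (auto simp: mon_def)
  next
    case (add p q)
    then show ?case using M.low_bound by blast
  next
    case (var i p)
    then show ?case using M.X_low[OF mon_add] by blast
  qed
  show ?thesis
    unfolding acc_ideals_def
  proof (intro allI impI)
    fix I :: "nat \<Rightarrow> 'a set" assume id: "\<forall>k. ring_ideal (I k)" and mono: "mono I"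
    \<comment> \<open>The monomials span only the polynomial subalgebra, so the ideals are
      contracted to it.\<close>
    define L where "L = (\<lambda>k. I k \<inter> poly_alg scale n x)"
    have sc: "scale c p \<in> poly_alg scale n x" if "p \<in> poly_alg scale n x" for c p
      using that
    proof induction
      case (const d)
      then show ?case using poly_alg.const[of scale "c * d"] by simp
    next
      case (add p q)
      then show ?case by (simp add: scale_right_distrib poly_alg.add)
    next
      case (var i p)
      then show ?case by (simp add: scale_mult_right poly_alg.var)
    qed
    have um: "- p \<in> poly_alg scale n x" if "p \<in> poly_alg scale n x" for p
      using sc[OF that, of "-1"] by simp
    have zero: "0 \<in> poly_alg scale n x"
      using poly_alg.const[of scale 0 n x] by simp
    have "M.submod (L k)" for k
      unfolding M.submod_def
    proof (intro conjI ballI allI impI)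
      note idk = ring_idealD[OF id[rule_format, of k]]
      show "{0} \<subseteq> L k" using idk zero by (simp add: L_def)
      show "p + q \<in> L k" if "p \<in> L k" "q \<in> L k" for p q
        using that idk poly_alg.add by (auto simp: L_def)
      show "- p \<in> L k" if "p \<in> L k" for p using that idk um by (auto simp: L_def)
      show "scale c p \<in> L k" if "p \<in> L k" for c p
        using that sc idk(3)[of p "scale c 1"] by (auto simp: L_def scale_eq_mult[symmetric])
      show "x i * p \<in> L k" if "i < n" "p \<in> L k" for i p
        using that idk poly_alg.var by (auto simp: L_def)
      show "\<exists>\<gamma>. p \<in> M.low \<gamma>" if "p \<in> L k" for p using that low by (auto simp: L_def)
    qed
    moreover have "mono L" using mono by (auto simp: mono_def L_def)
    ultimately obtain k0 where k0: "\<forall>k\<ge>k0. L k = L k0"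
      using M.acc_submod[OF mon_add acc_ideals_field] by blast
    have "I k \<subseteq> I k0" if "k \<ge> k0" for k
    proof
      fix b assume b: "b \<in> I k"
      obtain r s t where rst: "r \<in> poly_alg scale n x" "s \<in> poly_alg scale n x" "s * t = 1" "b = r * t"
        using fraction[of b] by blast
      \<comment> \<open>Clearing the denominator leads into the contraction, and multiplying by
        \<open>t\<close> leads back.\<close>
      have "s * b = r" using rst by (simp add: algebra_simps)
      then have "r \<in> L k" using ring_idealD(3)[OF id[rule_format] b, of s] rst by (simp add: L_def)
      then have "r \<in> I k0" using k0 that by (auto simp: L_def)
      then show "b \<in> I k0" using ring_idealD(3)[OF id[rule_format], of r k0 t] rst by (simp add: mult.commute)
    qed
    then show "\<exists>k0. \<forall>k\<ge>k0. I k = I k0" using mono by (meson monoD subset_antisym)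
  qed
qed

end

section \<open>The Noetherian property of the enveloping algebra\<close>

text \<open>A ring presented like the enveloping algebra modulo a two-sided ideal \<open>K\<close>.
  It is kept abstract because it is used twice: for the free algebra with the preimage of kappa, and
  for the opposite ring. Scalars appear only as the elements \<open>scale c 1\<close>, which
  \<open>L\<close> sends into \<open>K\<close>.\<close>

locale env_mod = poisson_algebra scale br
  for scale :: "'k::field \<Rightarrow> 'a::comm_ring_1 \<Rightarrow> 'a" and br :: "'a \<Rightarrow> 'a \<Rightarrow> 'a" +
  fixes A L :: "'a \<Rightarrow> 'f::ring_1" and K :: "'f set"
  assumes K_zero: "0 \<in> K" and K_add: "p \<in> K \<Longrightarrow> q \<in> K \<Longrightarrow> p + q \<in> K"
    and K_lmult: "p \<in> K \<Longrightarrow> q * p \<in> K" and K_rmult: "p \<in> K \<Longrightarrow> p * q \<in> K"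
    and A_one: "A 1 - 1 \<in> K" and A_add: "A (a + b) - (A a + A b) \<in> K"
    and A_mult: "A (a * b) - A a * A b \<in> K"
    and L_add: "L (a + b) - (L a + L b) \<in> K" and L_const: "L (scale c 1) \<in> K"
    and L_br: "L (br a b) - (L a * L b - L b * L a) \<in> K"
    and A_br: "A (br a b) - (L a * A b - A b * L a) \<in> K"
    and L_mult: "L (a * b) - (A a * L b + A b * L a) \<in> K"
    and gen_induct [case_names K A L add mult]:
      "(\<And>p. p \<in> K \<Longrightarrow> P p) \<Longrightarrow> (\<And>a. P (A a)) \<Longrightarrow> (\<And>a. P (L a)) \<Longrightarrow>
       (\<And>p q. P p \<Longrightarrow> P q \<Longrightarrow> P (p + q)) \<Longrightarrow> (\<And>p q. P p \<Longrightarrow> P q \<Longrightarrow> P (p * q)) \<Longrightarrow> P u"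
begin

definition eqK :: "'f \<Rightarrow> 'f \<Rightarrow> bool" (infix "\<approx>" 50) where
  "p \<approx> q \<longleftrightarrow> p - q \<in> K"

lemma K_uminus: "p \<in> K \<Longrightarrow> - p \<in> K"
  using K_lmult[of p "-1"] by simp

lemma eqK_refl [simp]: "p \<approx> p"
  by (simp add: eqK_def K_zero)

lemma eqK_sym: "p \<approx> q \<Longrightarrow> q \<approx> p"
  using K_uminus[of "p - q"] by (simp add: eqK_def)

lemma eqK_trans [trans]: "p \<approx> q \<Longrightarrow> q \<approx> r \<Longrightarrow> p \<approx> r"
  using K_add[of "p - q" "q - r"] by (simp add: eqK_def)

lemma eqK_add: "p \<approx> p' \<Longrightarrow> q \<approx> q' \<Longrightarrow> p + q \<approx> p' + q'"
  using K_add[of "p - p'" "q - q'"] by (simp add: eqK_def algebra_simps)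

lemma eqK_uminus: "p \<approx> p' \<Longrightarrow> - p \<approx> - p'"
  using K_uminus[of "p - p'"] by (simp add: eqK_def)

lemma eqK_diff: "p \<approx> p' \<Longrightarrow> q \<approx> q' \<Longrightarrow> p - q \<approx> p' - q'"
  using eqK_add[of p p' "- q" "- q'"] eqK_uminus by simp

lemma eqK_mult: "p \<approx> p' \<Longrightarrow> q \<approx> q' \<Longrightarrow> p * q \<approx> p' * q'"
  using K_add[OF K_rmult[of "p - p'" q] K_lmult[of "q - q'" p']] by (simp add: eqK_def algebra_simps)

lemma eqK_sum: "(\<And>i. i \<in> I \<Longrightarrow> p i \<approx> q i) \<Longrightarrow> sum p I \<approx> sum q I"
  by (induction I rule: infinite_finite_induct) (auto intro: eqK_add)

lemma eqK_zero_iff: "p \<approx> 0 \<longleftrightarrow> p \<in> K"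
  by (simp add: eqK_def)

lemma eqK_mem: "p \<approx> q \<Longrightarrow> q \<in> K \<longleftrightarrow> p \<in> K"
  using eqK_trans[of p q 0] eqK_trans[of q p 0] eqK_sym[of p q] by (auto simp: eqK_zero_iff)

lemma sum_K: "(\<And>i. i \<in> I \<Longrightarrow> p i \<in> K) \<Longrightarrow> sum p I \<in> K"
  using eqK_sum[of I p "\<lambda>_. 0"] by (simp add: eqK_zero_iff)

lemmas rel_eqs = A_one[folded eqK_def] A_add[folded eqK_def] A_mult[folded eqK_def]
  L_add[folded eqK_def] L_br[folded eqK_def] A_br[folded eqK_def] L_mult[folded eqK_def]

lemma br_zero_right: "br a 0 = 0"
  using br_add_right[of a 0 0] by simp

lemma br_swap: "br a b = - br b a"
proof -
  have "br a b + br b a = 0"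
    using br_self[of "a + b"] unfolding br_add_left br_add_right
    by (simp add: br_self add.commute)
  then show ?thesis by (simp only: eq_neg_iff_add_eq_0)
qed

lemma br_uminus_right: "br a (- b) = - br a b"
  using br_add_right[of a b "- b"] by (simp add: br_zero_right minus_unique)

lemma A_zero: "A 0 \<in> K"
  using K_uminus[OF A_add[of 0 0]] by simp

lemma A_uminus: "A (- a) \<approx> - A a"
proof -
  have "A (a + - a) \<approx> A a + A (- a)" by (rule rel_eqs)
  then have "A a + A (- a) \<approx> 0" using A_zero eqK_zero_iff eqK_sym eqK_trans by (metis add.right_inverse)
  then show ?thesis by (simp add: eqK_def add.commute)
qed

lemma A_commute: "A a * A b \<approx> A b * A a"
  using eqK_trans[OF eqK_sym[OF rel_eqs(3)[of a b]]] rel_eqs(3)[of b a] by (simp add: mult.commute)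

lemma L_A: "L a * A b \<approx> A b * L a + A (br a b)"
  using eqK_add[OF eqK_refl[of "A b * L a"] eqK_sym[OF A_br[of a b, folded eqK_def]]] by simp

lemma L_L: "L a * L b \<approx> L b * L a + L (br a b)"
  using eqK_add[OF eqK_refl[of "L b * L a"] eqK_sym[OF L_br[of a b, folded eqK_def]]] by simp

lemma L_one: "L 1 \<in> K"
proof -
  have "L 1 \<approx> A 1 * L 1 + A 1 * L 1" using rel_eqs(7)[of 1 1] by simp
  also have "\<dots> \<approx> 1 * L 1 + 1 * L 1" by (intro eqK_add eqK_mult rel_eqs eqK_refl)
  finally have "L 1 - (1 * L 1 + 1 * L 1) \<in> K" by (simp only: eqK_def)
  then have "- L 1 \<in> K" by simp
  from K_uminus[OF this] show ?thesis by simp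
qed

text \<open>The rule for differentiating an inverse: apply the Leibniz rule to
  \<open>s * t = 1\<close>, where \<open>L 1\<close> vanishes modulo \<open>K\<close>, and multiply
  by \<open>A t\<close>.\<close>

lemma L_inverse:
  assumes "s * t = 1"
  shows "L t \<approx> - (A (t * t) * L s)"
proof -
  have "A s * L t + A t * L s \<approx> L 1" using eqK_sym[OF rel_eqs(7)[of s t]] assms by simp
  also have "L 1 \<approx> 0" by (simp add: eqK_zero_iff L_one)
  finally have *: "A s * L t \<approx> - (A t * L s)" by (simp add: eqK_def)
  have "1 * L t \<approx> A (t * s) * L t"
    using eqK_mult[OF eqK_sym[OF rel_eqs(1)] eqK_refl[of "L t"]] assms by (simp add: mult.commute)
  also have "\<dots> \<approx> (A t * A s) * L t" by (intro eqK_mult rel_eqs eqK_refl)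
  also have "\<dots> = A t * (A s * L t)" by (simp add: mult.assoc)
  also have "\<dots> \<approx> A t * - (A t * L s)" by (intro eqK_mult * eqK_refl)
  also have "\<dots> = - ((A t * A t) * L s)" by (simp add: mult.assoc)
  also have "\<dots> \<approx> - (A (t * t) * L s)" by (intro eqK_uminus eqK_mult eqK_sym[OF rel_eqs(3)] eqK_refl)
  finally show ?thesis by simp
qed

end

locale env_fin = env_mod scale br A L K + ess_finite scale n x
  for scale :: "'k::field \<Rightarrow> 'a::comm_ring_1 \<Rightarrow> 'a" and br :: "'a \<Rightarrow> 'a \<Rightarrow> 'a"
    and A L :: "'a \<Rightarrow> 'f::ring_1" and K :: "'f set" and n :: nat and x :: "nat \<Rightarrow> 'a"
begin

definition word :: "nat list \<Rightarrow> 'f" where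
  "word w = prod_list (map (\<lambda>i. L (x i)) w)"

text \<open>Poincare-Birkhoff-Witt monomials, with the letters in increasing order. They span over
  \<open>A\<close> modulo \<open>K\<close> but may be dependent.\<close>

definition mon :: "nat multiset \<Rightarrow> 'f" where
  "mon \<gamma> = word (sorted_list_of_multiset \<gamma>)"

inductive_set W :: "nat \<Rightarrow> 'f set" for N where
  K: "p \<in> K \<Longrightarrow> p \<in> W N"
| mon: "size \<gamma> \<le> N \<Longrightarrow> set_mset \<gamma> \<subseteq> {..<n} \<Longrightarrow> A a * mon \<gamma> \<in> W N"
| add: "p \<in> W N \<Longrightarrow> q \<in> W N \<Longrightarrow> p + q \<in> W N"

lemma W_mono: "p \<in> W N \<Longrightarrow> N \<le> M \<Longrightarrow> p \<in> W M"
  by (induction rule: W.induct) (auto intro: W.intros)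

lemma W_eqK: "p \<approx> q \<Longrightarrow> q \<in> W N \<Longrightarrow> p \<in> W N"
  using W.add[of "p - q" N q] W.K[of "p - q" N] by (simp add: eqK_def)

lemma W_A: "p \<in> W N \<Longrightarrow> A a * p \<in> W N"
proof (induction rule: W.induct)
  case (K p)
  then show ?case using K_lmult W.K by blast
next
  case (mon \<gamma> b)
  have "A a * (A b * mon \<gamma>) \<approx> A (a * b) * mon \<gamma>"
    using eqK_mult[OF eqK_sym[OF rel_eqs(3)] eqK_refl[of "mon \<gamma>"]] by (simp add: mult.assoc)
  then show ?case by (rule W_eqK) (intro W.mon mon)
next
  case (add p q)
  then show ?case by (simp add: distrib_left W.add)
qed

lemma W_uminus: "p \<in> W N \<Longrightarrow> - p \<in> W N"
proof (rule W_eqK)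
  assume "p \<in> W N"
  then show "A (- 1) * p \<in> W N" by (rule W_A)
  have "A (- 1) * p \<approx> - 1 * p"
    by (intro eqK_mult eqK_refl eqK_trans[OF A_uminus eqK_uminus[OF rel_eqs(1)]])
  then show "- p \<approx> A (- 1) * p" using eqK_sym by simp
qed

lemma mon_W:
  assumes "size \<gamma> \<le> N" "set_mset \<gamma> \<subseteq> {..<n}"
  shows "mon \<gamma> \<in> W N"
proof (rule W_eqK)
  show "A 1 * mon \<gamma> \<in> W N" by (intro W.mon assms)
  show "mon \<gamma> \<approx> A 1 * mon \<gamma>"
    using eqK_mult[OF eqK_sym[OF rel_eqs(1)] eqK_refl[of "mon \<gamma>"]] by simp
qed

text \<open>The straightening rule is assumed only up to degree \<open>N\<close>, because this lemma
  is used inside the induction that proves the rule. The passage from variables to all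
  \<open>b\<close> rests on the Leibniz rule for \<open>L\<close>.\<close>

lemma L_W_step:
  assumes mon_add: "\<And>i \<gamma>. i < n \<Longrightarrow> set_mset \<gamma> \<subseteq> {..<n} \<Longrightarrow> size \<gamma> \<le> N \<Longrightarrow>
      L (x i) * mon \<gamma> - mon (add_mset i \<gamma>) \<in> W (size \<gamma>)"
    and p: "p \<in> W N"
  shows "L b * p \<in> W (Suc N)"
proof (induction b rule: alg_induct)
  case (const c)
  show ?case by (intro W.K K_rmult L_const)
next
  case (var i)
  from p show ?case
  proof (induction rule: W.induct)
    case (K p)
    then show ?case using K_lmult W.K by blast
  next
    case (mon \<gamma> a)
    have "(L (x i) * mon \<gamma> - mon (add_mset i \<gamma>)) + mon (add_mset i \<gamma>) \<in> W (Suc N)"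
      using mon var by (intro W.add W_mono[OF mon_add] mon_W) auto
    then have "A a * (L (x i) * mon \<gamma>) + A (br (x i) a) * mon \<gamma> \<in> W (Suc N)"
      using mon by (intro W.add W_A W.mon) auto
    moreover have "L (x i) * (A a * mon \<gamma>) \<approx> A a * (L (x i) * mon \<gamma>) + A (br (x i) a) * mon \<gamma>"
      using eqK_mult[OF L_A[of "x i" a] eqK_refl[of "mon \<gamma>"]] by (simp add: algebra_simps)
    ultimately show ?case using W_eqK by blast
  next
    case (add p q)
    then show ?case by (simp add: distrib_left W.add)
  qed
next
  case (add a b)
  have "L (a + b) * p \<approx> L a * p + L b * p"
    using eqK_mult[OF rel_eqs(4) eqK_refl[of p]] by (simp add: distrib_right)
  with add W.add W_eqK show ?case by blast
next
  case (mult a b)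
  have "L (a * b) * p \<approx> A a * (L b * p) + A b * (L a * p)"
    using eqK_mult[OF rel_eqs(7) eqK_refl[of p]] by (simp add: distrib_right mult.assoc)
  with mult W.add W_A W_eqK show ?case by blast
next
  case (inv s t)
  have "L t * p \<approx> - (A (t * t) * (L s * p))"
    using eqK_mult[OF L_inverse[OF inv(2)] eqK_refl[of p]] by (simp add: mult.assoc)
  with inv W_uminus W_A W_eqK show ?case by blast
qed

text \<open>Straightening: inserting a letter at its sorted place costs only commutators, each of
  which replaces two letters by a single \<open>L\<close> of a bracket.\<close>

lemma L_mon:
  "i < n \<Longrightarrow> set_mset \<gamma> \<subseteq> {..<n} \<Longrightarrow> L (x i) * mon \<gamma> - mon (add_mset i \<gamma>) \<in> W (size \<gamma>)"
proof (induction "size \<gamma>" arbitrary: i \<gamma> rule: less_induct)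
  case less
  show ?case
  proof (cases "sorted_list_of_multiset \<gamma>")
    case Nil
    then show ?thesis using W.K[OF K_zero] by (simp add: mon_def word_def)
  next
    case (Cons j w)
    define \<gamma>' where "\<gamma>' = mset w"
    have \<gamma>: "\<gamma> = add_mset j \<gamma>'"
      using Cons mset_sorted_list_of_multiset[of \<gamma>] by (simp add: \<gamma>'_def)
    have "sorted (j # w)" using Cons sorted_sorted_list_of_multiset[of \<gamma>] by simp
    then have w: "sorted_list_of_multiset \<gamma>' = w"
      by (simp add: \<gamma>'_def sorted_sort_id)
    have \<gamma>'n: "set_mset \<gamma>' \<subseteq> {..<n}" "j < n" using less \<gamma> by auto
    have mon: "mon \<gamma> = L (x j) * mon \<gamma>'" by (simp add: mon_def w Cons word_def)
    have ins: "sorted_list_of_multiset (add_mset i \<gamma>) = insort i (j # w)"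
      using Cons by simp
    show ?thesis
    proof (cases "i \<le> j")
      case True
      then show ?thesis using W.K[OF K_zero] by (simp add: mon_def ins word_def Cons del: sorted_list_of_multiset_insert)
    next
      case False
      have mon_ins: "mon (add_mset i \<gamma>) = L (x j) * mon (add_mset i \<gamma>')"
        using False by (simp add: mon_def ins word_def w del: sorted_list_of_multiset_insert)
          (simp add: w)
      obtain N where N: "size \<gamma>' = N" "size \<gamma> = Suc N" using \<gamma> by simp
      \<comment> \<open>The induction hypothesis covers sizes up to \<open>N\<close>, one less than
        the size of \<open>\<gamma>\<close>.\<close>
      have step: "L b * p \<in> W (Suc M)" if "p \<in> W M" "M \<le> N" for b p M
        by (rule L_W_step[OF less(1) that(1)]) (use that N in auto)
      define v where "v = L (x i) * mon \<gamma>' - mon (add_mset i \<gamma>')"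
      have v: "v \<in> W N" unfolding v_def using less(1)[of \<gamma>' i] N \<gamma>'n less.prems by simp
      have "L (x i) * mon \<gamma> - mon (add_mset i \<gamma>) =
          L (x i) * L (x j) * mon \<gamma>' - L (x j) * mon (add_mset i \<gamma>')"
        by (simp add: mon mon_ins mult.assoc)
      \<comment> \<open>\<open>L (x i)\<close> is moved past the smaller letter. What remains is
        \<open>L (x j)\<close> applied to the error \<open>v\<close> of the shorter monomial, and
        the bracket applied to that monomial; both have degree at most \<open>Suc N\<close>.\<close>
      also have "\<dots> \<approx> (L (x j) * L (x i) + L (br (x i) (x j))) * mon \<gamma>' - L (x j) * mon (add_mset i \<gamma>')"
        by (intro eqK_diff eqK_mult L_L eqK_refl)
      also have "\<dots> = L (x j) * v + L (br (x i) (x j)) * mon \<gamma>'"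
        by (simp add: v_def algebra_simps)
      finally show ?thesis
        unfolding N(2) by (rule W_eqK) (intro W.add step[OF v] step[OF mon_W] \<gamma>'n, simp_all add: N)
    qed
  qed
qed

lemma L_W: "p \<in> W N \<Longrightarrow> L b * p \<in> W (Suc N)"
  by (rule L_W_step[OF L_mon])

text \<open>The induction concerns left multiplication by \<open>u\<close> on every
  \<open>W N\<close> instead of membership of \<open>u\<close>, so that products pose no problem;
  \<open>u\<close> is then applied to the empty monomial, which is 1.\<close>

lemma all_W: "\<exists>N. u \<in> W N"
proof -
  have "\<forall>N. \<forall>w\<in>W N. \<exists>M. u * w \<in> W M"
  proof (induction u rule: gen_induct)
    case (K p)
    then show ?case using W.K K_rmult by blast
  next
    case (A a)
    then show ?case using W_A by blast
  next
    case (L a)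
    then show ?case using L_W by blast
  next
    case (add p q)
    show ?case
    proof (intro allI ballI)
      fix N w assume "w \<in> W N"
      then obtain M M' where M: "p * w \<in> W M" "q * w \<in> W M'" using add by blast
      have "p * w + q * w \<in> W (max M M')" by (intro W.add W_mono[OF M(1)] W_mono[OF M(2)]) auto
      then show "\<exists>M. (p + q) * w \<in> W M" by (auto simp: distrib_right)
    qed
  next
    case (mult p q)
    then show ?case unfolding mult.assoc by blast
  qed
  moreover have "mon {#} \<in> W 0" by (rule mon_W) auto
  ultimately show ?thesis by (fastforce simp: mon_def word_def)
qed

theorem acc_left_ideals:
  fixes I :: "nat \<Rightarrow> 'f set"
  assumes acc_A: "acc_ideals TYPE('a)" and mono: "mono I" and KI: "\<And>k. K \<subseteq> I k"
    and I_add: "\<And>k p q. p \<in> I k \<Longrightarrow> q \<in> I k \<Longrightarrow> p + q \<in> I k"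
    and I_mult: "\<And>k p q. p \<in> I k \<Longrightarrow> q * p \<in> I k"
  shows "\<exists>k0. \<forall>k\<ge>k0. I k = I k0"
proof -
  interpret M: monomial_module n K "\<lambda>a p. A a * p" "\<lambda>i p. L (x i) * p" mon
  proof
    fix a b p
    show "A (a + b) * p - (A a * p + A b * p) \<in> K"
      using K_rmult[OF A_add, of a b p] by (simp add: algebra_simps)
    show "A (a * b) * p - A a * (A b * p) \<in> K"
      using K_rmult[OF A_mult, of a b p] by (simp add: algebra_simps)
  qed (auto simp: K_zero K_add K_uminus K_lmult distrib_left)
  \<comment> \<open>Degree is compared first in \<open>mon_less\<close>, so all of
    \<open>W N\<close> lies below any monomial of size greater than \<open>N\<close>.\<close>
  have W_low: "p \<in> M.low \<gamma>" if "p \<in> W N" "size \<gamma> > N" for p N \<gamma>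
    using that by (induction rule: W.induct) (auto intro: M.low.intros simp: mon_less_def)
  have X_mon: "L (x i) * (A a * mon \<gamma>) - A a * mon (add_mset i \<gamma>) \<in> M.low (add_mset i \<gamma>)"
    if "i < n" "set_mset \<gamma> \<subseteq> {..<n}" for i a \<gamma>
  proof -
    have "L (x i) * A a * mon \<gamma> - A a * mon (add_mset i \<gamma>) \<approx>
        (A a * L (x i) + A (br (x i) a)) * mon \<gamma> - A a * mon (add_mset i \<gamma>)"
      by (intro eqK_diff eqK_mult L_A eqK_refl)
    also have "\<dots> = A a * (L (x i) * mon \<gamma> - mon (add_mset i \<gamma>)) + A (br (x i) a) * mon \<gamma>"
      by (simp add: algebra_simps)
    finally have "L (x i) * A a * mon \<gamma> - A a * mon (add_mset i \<gamma>) \<in> W (size \<gamma>)"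
      by (rule W_eqK) (use that in \<open>auto intro!: W.add W.mon W_A[OF L_mon]\<close>)
    then show ?thesis using W_low by (simp add: mult.assoc)
  qed
  have "M.submod (I k)" for k
    unfolding M.submod_def
  proof (intro conjI ballI allI impI)
    show "- p \<in> I k" if "p \<in> I k" for p using I_mult[OF that, of "-1"] by simp
    show "\<exists>\<gamma>. p \<in> M.low \<gamma>" if "p \<in> I k" for p
    proof -
      obtain N where "p \<in> W N" using all_W by blast
      from W_low[OF this, of "replicate_mset (Suc N) 0"] show ?thesis by auto
    qed
  qed (use KI I_add I_mult in auto)
  from M.acc_submod[OF X_mon acc_A this mono] show ?thesis .
qed

end

section \<open>The opposite algebra and chains of right ideals\<close>

datatype 'f op = Op (unop: 'f)

instantiation op :: (ring_1) ring_1
begin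
definition "0 = Op 0"
definition "1 = Op 1"
definition "p + q = Op (unop p + unop q)"
definition "p - q = Op (unop p - unop q)"
definition "- p = Op (- unop p)"
definition "p * q = Op (unop q * unop p)"
instance
  by standard (auto simp: zero_op_def one_op_def plus_op_def minus_op_def uminus_op_def times_op_def
      algebra_simps)
end

lemmas op_defs = zero_op_def one_op_def plus_op_def minus_op_def uminus_op_def times_op_def

context env_fin
begin

text \<open>Reversing products changes the sign of every commutator, hence the bracket
  \<open>- br\<close>. The same \<open>A\<close> and \<open>L\<close> serve on both sides, so the
  chain condition for left ideals can be read for right ideals.\<close>

lemma env_fin_op: "env_fin scale (\<lambda>a b. - br a b) (\<lambda>a. Op (A a)) (\<lambda>a. Op (L a)) (Op ` K) n x"
proof -
  have poisson: "poisson_algebra scale (\<lambda>a b. - br a b)"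
  proof
    fix a b c :: 'a
    show "- br a (- br b c) + - br b (- br c a) + - br c (- br a b) = 0"
      using br_jacobi[of a b c] by (simp add: br_uminus_right)
  qed (simp_all add: br_add_left br_add_right br_scale_left br_scale_right br_self br_mult_right)
  interpret P: poisson_algebra scale "\<lambda>a b. - br a b" by (rule poisson)
  have Op_mem: "p \<in> Op ` K \<longleftrightarrow> unop p \<in> K" for p by (cases p) auto
  have "env_mod scale (\<lambda>a b. - br a b) (\<lambda>a. Op (A a)) (\<lambda>a. Op (L a)) (Op ` K)"
  proof (unfold_locales, goal_cases)
    case (10 a b)
    have "L (- br a b) \<approx> - L (br a b)"
    proof -
      have "L 0 \<in> K" using K_uminus[OF L_add[of 0 0]] by simp
      then have "L (br a b) + L (- br a b) \<approx> 0"
        using rel_eqs(4)[of "br a b" "- br a b"] eqK_zero_iff eqK_sym eqK_trans by (metis add.right_inverse)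
      then show ?thesis by (simp add: eqK_def add.commute)
    qed
    also have "\<dots> \<approx> - (L a * L b - L b * L a)" by (intro eqK_uminus rel_eqs)
    finally show ?case by (simp add: Op_mem op_defs eqK_def)
  next
    case (11 a b)
    have "A (- br a b) \<approx> - A (br a b)" by (rule A_uminus)
    also have "\<dots> \<approx> - (L a * A b - A b * L a)" by (intro eqK_uminus rel_eqs)
    finally show ?case by (simp add: Op_mem op_defs eqK_def)
  next
    case (12 a b)
    \<comment> \<open>Moving the two coefficients to the right of \<open>L b\<close> and
      \<open>L a\<close> produces \<open>A (br a b)\<close> and \<open>A (br b a)\<close>, which
      cancel.\<close>
    have "L (a * b) + (A (br a b) + A (br b a)) \<approx>
        (A a * L b + A b * L a) + ((L a * A b - A b * L a) + (L b * A a - A a * L b))"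
      by (intro eqK_add rel_eqs)
    moreover have "A (br a b) + A (br b a) \<approx> 0"
      using eqK_add[OF eqK_refl[of "A (br a b)"] A_uminus[of "br a b"]] by (simp add: br_swap[of b a])
    ultimately have "L (a * b) + (A (br a b) + A (br b a)) - (A (br a b) + A (br b a)) \<approx>
        (A a * L b + A b * L a) + ((L a * A b - A b * L a) + (L b * A a - A a * L b)) - 0"
      by (intro eqK_diff)
    then have "L (a * b) \<approx> L b * A a + L a * A b" by (simp add: algebra_simps)
    then show ?case by (simp add: Op_mem op_defs eqK_def)
  next
    case (13 P u)
    have "P (Op v)" for v
    proof (induction v rule: gen_induct)
      case (add p q)
      then show ?case using 13(4)[of "Op p" "Op q"] by (simp add: op_defs)
    next
      case (mult p q)
      then show ?case using 13(5)[of "Op q" "Op p"] by (simp add: op_defs)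
    qed (use 13 in auto)
    then show ?case by (metis op.exhaust)
  qed (use K_add K_lmult K_rmult in \<open>auto simp: Op_mem op_defs K_zero A_one A_add L_add L_const A_mult
      mult.commute intro: eqK_trans[OF rel_eqs(3) A_commute, unfolded eqK_def]\<close>)
  then interpret E: env_mod scale "\<lambda>a b. - br a b" "\<lambda>a. Op (A a)" "\<lambda>a. Op (L a)" "Op ` K" .
  show ?thesis ..
qed

theorem acc_right_ideals:
  fixes I :: "nat \<Rightarrow> 'f set"
  assumes acc_A: "acc_ideals TYPE('a)" and mono: "mono I" and KI: "\<And>k. K \<subseteq> I k"
    and I_add: "\<And>k p q. p \<in> I k \<Longrightarrow> q \<in> I k \<Longrightarrow> p + q \<in> I k"
    and I_mult: "\<And>k p q. p \<in> I k \<Longrightarrow> p * q \<in> I k"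
  shows "\<exists>k0. \<forall>k\<ge>k0. I k = I k0"
proof -
  interpret O: env_fin scale "\<lambda>a b. - br a b" "\<lambda>a. Op (A a)" "\<lambda>a. Op (L a)" "Op ` K" n x
    by (rule env_fin_op)
  have "\<exists>k0. \<forall>k\<ge>k0. Op ` I k = Op ` I k0"
  proof (rule O.acc_left_ideals[OF acc_A])
    show "mono (\<lambda>k. Op ` I k)" using mono by (auto simp: mono_def)
    show "Op ` K \<subseteq> Op ` I k" for k using KI by blast
  qed (use I_add I_mult in \<open>auto simp: op_defs\<close>)
  moreover have "inj (Op :: 'f \<Rightarrow> 'f op)" by (rule injI) simp
  ultimately show ?thesis by (simp add: inj_image_eq_iff)
qed

end

section \<open>The filtration by degree\<close>

lemma of_nat_left_commute: "p * (of_nat k * q) = of_nat k * (p * q :: 'r::ring_1)"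
  by (induction k) (simp_all add: algebra_simps)

context env_mod
begin

text \<open>\<open>Fil (Suc N) p\<close> means that \<open>p\<close> has degree at most \<open>N\<close> in the \<open>L b\<close>, modulo \<open>K\<close>; the shift makes
  \<open>Fil 0\<close> the ideal \<open>K\<close>.\<close>

inductive Fil :: "nat \<Rightarrow> 'f \<Rightarrow> bool" where
  K: "p \<in> K \<Longrightarrow> Fil N p"
| A: "Fil (Suc N) (A a)"
| L: "Fil (Suc (Suc N)) (L b)"
| add: "Fil N p \<Longrightarrow> Fil N q \<Longrightarrow> Fil N (p + q)"
| mult: "Fil (Suc m) p \<Longrightarrow> Fil (Suc k) q \<Longrightarrow> Fil (Suc (m + k)) (p * q)"

lemma Fil_0_iff: "Fil 0 p \<longleftrightarrow> p \<in> K"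
proof
  have "N = 0 \<longrightarrow> p \<in> K" if "Fil N p" for N
    using that by induction (auto intro: K_add)
  then show "Fil 0 p \<Longrightarrow> p \<in> K" by blast
qed (rule Fil.K)

lemma Fil_mono: "Fil N p \<Longrightarrow> N \<le> M \<Longrightarrow> Fil M p"
proof (induction arbitrary: M rule: Fil.induct)
  case (mult m p k q)
  then obtain m' where m': "M = Suc (m' + k)" "m \<le> m'"
    by (metis Suc_le_D Suc_le_mono add_le_cancel_right le_add_diff_inverse2 le_add2 order_trans)
  then show ?case using mult.IH(1)[of "Suc m'"] mult.hyps(2) Fil.mult by simp
next
  case (A N a)
  then show ?case using Fil.A by (metis Suc_le_D)
next
  case (L N b)
  then show ?case using Fil.L by (metis Suc_le_D Suc_le_mono)
qed (auto intro: Fil.intros)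

lemma Fil_eqK: "p \<approx> q \<Longrightarrow> Fil N q \<Longrightarrow> Fil N p"
  using Fil.add[OF Fil.K[of "p - q"], of N q] by (simp add: eqK_def)

text \<open>The form suited to commutators: their level drops to \<open>m\<close>, which may be 0,
  that is, the factor may lie in \<open>K\<close>.\<close>

lemma Fil_mult_left: "Fil m p \<Longrightarrow> Fil (Suc k) q \<Longrightarrow> Fil (m + k) (p * q)"
  by (cases m) (auto simp: Fil_0_iff intro: Fil.K K_rmult Fil.mult)

lemma Fil_mult_right: "Fil (Suc m) p \<Longrightarrow> Fil k q \<Longrightarrow> Fil (m + k) (p * q)"
  using Fil.mult[of m p] by (cases k) (auto simp: Fil_0_iff intro: Fil.K K_lmult)

lemma Fil_A_mult: "Fil N p \<Longrightarrow> Fil N (A a * p)"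
  using Fil_mult_right[OF Fil.A[of 0 a]] by simp

lemma Fil_uminus: "Fil N p \<Longrightarrow> Fil N (- p)"
proof (rule Fil_eqK)
  assume "Fil N p"
  then show "Fil N (A (- 1) * p)" by (rule Fil_A_mult)
  have "A (- 1) * p \<approx> - 1 * p"
    by (intro eqK_mult eqK_refl eqK_trans[OF A_uminus eqK_uminus[OF rel_eqs(1)]])
  then show "- p \<approx> A (- 1) * p" using eqK_sym by simp
qed

lemma Fil_diff: "Fil N p \<Longrightarrow> Fil N q \<Longrightarrow> Fil N (p - q)"
  using Fil.add[of N p "- q"] Fil_uminus by simp

lemma Fil_sum: "(\<And>i. i \<in> I \<Longrightarrow> Fil N (p i)) \<Longrightarrow> Fil N (sum p I)"
  by (induction I rule: infinite_finite_induct) (auto intro: Fil.add Fil.K K_zero)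

lemma Fil_of_nat_mult: "Fil N p \<Longrightarrow> Fil N (of_nat k * p)"
  by (induction k) (auto intro: Fil.add Fil.K K_zero simp: distrib_right)

lemma Fil_A_ex: "Fil (Suc 0) p \<Longrightarrow> \<exists>a. p \<approx> A a"
proof -
  have "N = Suc 0 \<longrightarrow> (\<exists>a. p \<approx> A a)" if "Fil N p" for N
    using that
  proof induction
    case (K p N)
    then have "p \<approx> 0" "A 0 \<approx> 0" by (simp_all add: eqK_zero_iff A_zero)
    then show ?case using eqK_trans eqK_sym by blast
  next
    case (A N a)
    then show ?case using eqK_refl by blast
  next
    case (add N p q)
    then show ?case using eqK_trans[OF eqK_add eqK_sym[OF rel_eqs(2)]] by blast
  next
    case (mult m p k q)
    show ?case
    proof
      assume "Suc (m + k) = Suc 0"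
      then obtain a b where "p \<approx> A a" "q \<approx> A b" using mult.IH by auto
      then have "p * q \<approx> A (a * b)" using eqK_trans[OF eqK_mult eqK_sym[OF rel_eqs(3)]] by blast
      then show "\<exists>a. p * q \<approx> A a" by blast
    qed
  qed auto
  then show "Fil (Suc 0) p \<Longrightarrow> \<exists>a. p \<approx> A a" by blast
qed

text \<open>Commutation with \<open>A a\<close> obeys the Leibniz rule and turns a letter
  \<open>L b\<close> into the coefficient \<open>A (br b a)\<close>. The truncation at
  \<open>N = 0\<close> is harmless, since \<open>Fil 0\<close> is the ideal
  \<open>K\<close>.\<close>

lemma Fil_comm_A: "Fil N p \<Longrightarrow> Fil (N - 1) (p * A a - A a * p)"
proof (induction rule: Fil.induct)
  case (K p N)
  then have "p * A a - A a * p \<in> K"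
    using K_add[OF K_rmult K_uminus[OF K_lmult]] by fastforce
  then show ?case by (rule Fil.K)
next
  case (A N b)
  show ?case by (rule Fil.K) (use A_commute in \<open>simp add: eqK_def\<close>)
next
  case (L N b)
  have "L b * A a - A a * L b \<approx> A (br b a)"
    using eqK_diff[OF L_A[of b a] eqK_refl[of "A a * L b"]] by simp
  then show ?case by (rule Fil_eqK) (use Fil.A in simp)
next
  case (add N p q)
  have "(p + q) * A a - A a * (p + q) = (p * A a - A a * p) + (q * A a - A a * q)"
    by (simp add: algebra_simps)
  with add Fil.add show ?case by metis
next
  case (mult m p k q)
  have "p * q * A a - A a * (p * q) = p * (q * A a - A a * q) + (p * A a - A a * p) * q"
    by (simp add: algebra_simps)
  with mult Fil.add[OF Fil_mult_right[OF mult.hyps(1)] Fil_mult_left[OF _ mult.hyps(2)]]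
  show ?case by simp
qed

text \<open>Commutation with \<open>L b\<close> turns a letter into the \<open>L\<close> of a
  bracket and a coefficient into a coefficient, so it keeps the degree.\<close>

lemma Fil_comm_L: "Fil N p \<Longrightarrow> Fil N (p * L b - L b * p)"
proof (induction rule: Fil.induct)
  case (K p N)
  then have "p * L b - L b * p \<in> K"
    using K_add[OF K_rmult K_uminus[OF K_lmult]] by fastforce
  then show ?case by (rule Fil.K)
next
  case (A N a)
  have "A a * L b - L b * A a \<approx> - A (br b a)"
    using eqK_diff[OF eqK_refl[of "A a * L b"] L_A[of b a]] by simp
  then show ?case by (rule Fil_eqK) (intro Fil_uminus Fil.A)
next
  case (L N c)
  have "L c * L b - L b * L c \<approx> L (br c b)"
    using eqK_diff[OF L_L[of c b] eqK_refl[of "L b * L c"]] by simp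
  then show ?case by (rule Fil_eqK) (rule Fil.L)
next
  case (add N p q)
  have "(p + q) * L b - L b * (p + q) = (p * L b - L b * p) + (q * L b - L b * q)"
    by (simp add: algebra_simps)
  with add Fil.add show ?case by metis
next
  case (mult m p k q)
  have "p * q * L b - L b * (p * q) = p * (q * L b - L b * q) + (p * L b - L b * p) * q"
    by (simp add: algebra_simps)
  with mult Fil.add[OF Fil.mult[OF mult.hyps(1)] Fil.mult[OF _ mult.hyps(2)]]
  show ?case by simp
qed

lemma Fil_ex: "\<exists>N. Fil N p"
proof (induction p rule: gen_induct)
  case (add p q)
  then obtain N M where "Fil N p" "Fil M q" by blast
  then have "Fil (max N M) (p + q)" by (intro Fil.add) (auto elim: Fil_mono)
  then show ?case by blast
next
  case (mult p q)
  then obtain N M where "Fil N p" "Fil M q" by blast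
  then show ?case using Fil.mult[of N p M q] Fil_mono[of N p "Suc N"] Fil_mono[of M q "Suc M"] by auto
qed (use Fil.intros in blast)+

lemma A_power: "A (a ^ k) \<approx> A a ^ k"
proof (induction k)
  case (Suc k)
  have "A (a * a ^ k) \<approx> A a * A (a ^ k)" by (rule rel_eqs)
  also have "\<dots> \<approx> A a * A a ^ k" by (intro eqK_mult eqK_refl Suc)
  finally show ?case by simp
qed (simp add: rel_eqs)

lemma A_of_nat: "A (of_nat k) \<approx> of_nat k"
proof (induction k)
  case 0
  show ?case by (simp add: eqK_zero_iff A_zero)
next
  case (Suc k)
  have "A (1 + of_nat k) \<approx> A 1 + A (of_nat k)" by (rule rel_eqs)
  also have "\<dots> \<approx> 1 + of_nat k" by (intro eqK_add rel_eqs Suc)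
  finally show ?case by simp
qed

end

section \<open>Euler's formula and torsion\<close>

text \<open>\<open>act\<close> abstracts the representation of the free algebra on the Poisson
  algebra by \<open>env_pi\<close>; its kernel \<open>T\<close> corresponds to the kernel in the
  theorem.\<close>

locale env_act = env_fin scale br A L K n x
  for scale :: "'k::field_char_0 \<Rightarrow> 'a::idom \<Rightarrow> 'a" and br :: "'a \<Rightarrow> 'a \<Rightarrow> 'a"
    and A L :: "'a \<Rightarrow> 'f::ring_1" and K :: "'f set" and n :: nat and x :: "nat \<Rightarrow> 'a" +
  fixes act :: "'f \<Rightarrow> 'a \<Rightarrow> 'a"
  assumes act_add: "act (p + q) y = act p y + act q y"
    and act_mult: "act (p * q) y = act p (act q y)"
    and act_A: "act (A a) y = a * y" and act_K: "p \<in> K \<Longrightarrow> act p y = 0"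
begin

definition T :: "'f set" where
  "T = {p. \<forall>y. act p y = 0}"

lemma act_eqK: "p \<approx> q \<Longrightarrow> act p y = act q y"
  using act_add[of "p - q" q y] act_K[of "p - q" y] by (simp add: eqK_def)

lemma act_zero: "act 0 y = 0"
  by (rule act_K[OF K_zero])

lemma act_uminus: "act (- p) y = - act p y"
  using act_add[of p "- p" y] by (simp add: act_zero minus_unique)

lemma act_diff: "act (p - q) y = act p y - act q y"
  using act_add[of p "- q" y] by (simp add: act_uminus)

lemma act_at_zero: "act p 0 = 0"
  using act_mult[of p "A 0" 0] act_eqK[of "p * A 0" 0] K_lmult[OF A_zero, of p] by (simp add: act_A eqK_zero_iff act_zero)

lemma K_T: "K \<subseteq> T" by (auto simp: T_def act_K)

lemma T_add: "p \<in> T \<Longrightarrow> q \<in> T \<Longrightarrow> p + q \<in> T" by (simp add: T_def act_add)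

lemma T_diff: "p \<in> T \<Longrightarrow> q \<in> T \<Longrightarrow> p - q \<in> T" by (simp add: T_def act_diff)

lemma T_lmult: "p \<in> T \<Longrightarrow> q * p \<in> T" by (simp add: T_def act_mult act_at_zero)

lemma T_rmult: "p \<in> T \<Longrightarrow> p * q \<in> T" by (simp add: T_def act_mult)

lemma T_sum: "(\<And>i. i \<in> I \<Longrightarrow> p i \<in> T) \<Longrightarrow> sum p I \<in> T"
  by (induction I rule: infinite_finite_induct) (use T_add K_T K_zero in auto)

lemma T_of_left_mult:
  assumes "A a * u \<in> K" "a \<noteq> 0"
  shows "u \<in> T"
  using assms act_K[OF assms(1)] by (simp add: T_def act_mult act_A)

text \<open>The operators are differential operators, so \<open>u\<close> and \<open>a\<close> commute up to terms of lower order.\<close>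

lemma T_of_right_mult:
  assumes "u * A a \<in> K" "a \<noteq> 0"
  shows "u \<in> T"
proof -
  have "act u y = 0" if "Fil N u" "\<And>y. act u (a * y) = 0" for N y
    using that
  proof (induction N arbitrary: u y)
    case 0
    then show ?case by (simp add: Fil_0_iff act_K)
  next
    case (Suc N)
    have "Fil N (u * A a - A a * u)" using Fil_comm_A[OF Suc.prems(1), of a] by simp
    \<comment> \<open>The hypothesis on \<open>u\<close> passes to the commutator, which has lower
      degree and therefore acts as zero by induction.\<close>
    moreover have "act (u * A a - A a * u) (a * y) = 0" for y
      by (simp add: act_diff act_mult act_A Suc.prems(2))
    ultimately have "act (u * A a - A a * u) y = 0" by (rule Suc.IH)
    \<comment> \<open>So \<open>act u\<close> commutes with multiplication by \<open>a\<close>, and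
      \<open>a * act u y = act u (a * y) = 0\<close> in a domain.\<close>
    then show ?case using assms(2) by (simp add: act_diff act_mult act_A Suc.prems(2))
  qed
  moreover have "act u (a * y) = 0" for y
    using act_K[OF assms(1), of y] by (simp add: act_mult act_A)
  ultimately show ?thesis using Fil_ex[of u] by (auto simp: T_def)
qed

text \<open>Characteristic zero enters here: the inverse of \<open>Suc k\<close> in the field
  provides a coefficient that undoes the factor modulo \<open>K\<close>.\<close>

lemma of_nat_cancel:
  assumes "of_nat (Suc k) * p \<in> K"
  shows "p \<in> K"
proof -
  let ?c = "scale (1 / of_nat (Suc k)) 1"
  have "scale (of_nat m) 1 = of_nat m" for m
    by (induction m) (simp_all add: scale_left_distrib)
  then have "?c * of_nat (Suc k) = scale (1 / of_nat (Suc k)) (1 * scale (of_nat (Suc k)) 1)"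
    by (simp only: scale_mult)
  also have "\<dots> = 1" by (simp del: of_nat_Suc)
  finally have "?c * of_nat (Suc k) = 1" .
  then have "1 * p \<approx> A (?c * of_nat (Suc k)) * p"
    using eqK_mult[OF eqK_sym[OF rel_eqs(1)] eqK_refl] by simp
  also have "\<dots> \<approx> (A ?c * of_nat (Suc k)) * p"
    by (intro eqK_mult eqK_refl eqK_trans[OF rel_eqs(3)] A_of_nat)
  also have "\<dots> = A ?c * (of_nat (Suc k) * p)" by (simp only: mult.assoc)
  finally have "p \<approx> A ?c * (of_nat (Suc k) * p)" by simp
  from eqK_mem[OF this] K_lmult[OF assms] show ?thesis by blast
qed

end

text \<open>
  Over the localization at \<open>\<mu>\<close> the elements \<open>\<Delta> t\<close> form, by the assumption \<open>L_span_var\<close>, a basis dual to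
  the \<open>y t\<close> of the space of the operators \<open>L b\<close>.
\<close>

locale env_dual = env_act scale br A L K n x act
  for scale :: "'k::field_char_0 \<Rightarrow> 'a::idom \<Rightarrow> 'a" and br :: "'a \<Rightarrow> 'a \<Rightarrow> 'a"
    and A L :: "'a \<Rightarrow> 'f::ring_1" and K :: "'f set" and n :: nat and x :: "nat \<Rightarrow> 'a"
    and act :: "'f \<Rightarrow> 'a \<Rightarrow> 'a" +
  fixes d :: nat and y z :: "nat \<Rightarrow> 'a" and ad :: "nat \<Rightarrow> nat \<Rightarrow> 'a" and \<mu> :: 'a
  assumes mu_nonzero: "\<mu> \<noteq> 0"
    and L_span_var: "i < n \<Longrightarrow>
      A \<mu> * L (x i) - (\<Sum>t<d. A (br (x i) (y t)) * (\<Sum>s<d. A (ad t s) * L (z s))) \<in> K"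
begin

text \<open>When \<open>ad\<close> is the adjugate of the matrix of the
  \<open>br (z s) (y r)\<close>, the commutator of \<open>\<Delta> t\<close> with
  \<open>A (y r)\<close> is \<open>A \<mu>\<close> for \<open>r = t\<close> and 0 otherwise, modulo
  \<open>K\<close>.\<close>

definition \<Delta> :: "nat \<Rightarrow> 'f" where
  "\<Delta> t = (\<Sum>s<d. A (ad t s) * L (z s))"

lemma br_scalar_left: "br (scale c 1) b = 0"
proof -
  have "br b 1 = br b 1 + br b 1" using br_mult_right[of b 1 1] by simp
  then have "br b 1 = 0" by (metis add_diff_cancel_right' diff_self)
  then have "br b (scale c 1) = 0" by (simp add: br_scale_right)
  then show ?thesis using br_swap[of "scale c 1" b] by simp
qed

lemma br_mult_left: "br (a * b) c = a * br b c + b * br a c"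
proof -
  have "br (a * b) c = - (br c a * b + a * br c b)"
    by (simp only: br_swap[of "a * b" c] br_mult_right)
  also have "\<dots> = - ((- br a c) * b + a * (- br b c))"
    by (simp only: br_swap[of c a] br_swap[of c b])
  finally show ?thesis by (simp add: mult.commute add.commute)
qed

text \<open>Modulo \<open>K\<close> both sides obey the same Leibniz rule in \<open>b\<close>, so
  agreement on the variables spreads to sums, products and inverses.\<close>

lemma L_span: "A \<mu> * L b \<approx> (\<Sum>t<d. A (br b (y t)) * \<Delta> t)"
proof (induction b rule: alg_induct)
  case (const c)
  have "(\<Sum>t<d. A (br (scale c 1) (y t)) * \<Delta> t) \<in> K"
    by (intro sum_K K_rmult) (simp add: br_scalar_left A_zero)
  moreover have "A \<mu> * L (scale c 1) \<in> K" by (intro K_lmult L_const)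
  ultimately show ?case using eqK_zero_iff eqK_trans eqK_sym by metis
next
  case (var i)
  then show ?case using L_span_var unfolding \<Delta>_def eqK_def by blast
next
  case (add a b)
  have "A \<mu> * L (a + b) \<approx> A \<mu> * (L a + L b)" by (intro eqK_mult rel_eqs eqK_refl)
  also have "\<dots> = A \<mu> * L a + A \<mu> * L b" by (simp add: distrib_left)
  also have "\<dots> \<approx> (\<Sum>t<d. A (br a (y t)) * \<Delta> t) + (\<Sum>t<d. A (br b (y t)) * \<Delta> t)"
    by (intro eqK_add add)
  also have "\<dots> = (\<Sum>t<d. (A (br a (y t)) + A (br b (y t))) * \<Delta> t)"
    by (simp add: sum.distrib distrib_right)
  also have "\<dots> \<approx> (\<Sum>t<d. A (br (a + b) (y t)) * \<Delta> t)"
    by (intro eqK_sum eqK_mult eqK_refl) (simp add: br_add_left eqK_sym[OF rel_eqs(2)])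
  finally show ?case .
next
  case (mult a b)
  have AA: "A \<mu> * (A a * L b) \<approx> A a * (\<Sum>t<d. A (br b (y t)) * \<Delta> t)"
    if "A \<mu> * L b \<approx> (\<Sum>t<d. A (br b (y t)) * \<Delta> t)" for a b
  proof -
    have "A \<mu> * A a * L b \<approx> A a * A \<mu> * L b" by (intro eqK_mult A_commute eqK_refl)
    also have "\<dots> = A a * (A \<mu> * L b)" by (simp add: mult.assoc)
    also have "\<dots> \<approx> A a * (\<Sum>t<d. A (br b (y t)) * \<Delta> t)" by (intro eqK_mult that eqK_refl)
    finally show ?thesis by (simp add: mult.assoc)
  qed
  have "A \<mu> * L (a * b) \<approx> A \<mu> * (A a * L b + A b * L a)" by (intro eqK_mult rel_eqs eqK_refl)
  also have "\<dots> = A \<mu> * (A a * L b) + A \<mu> * (A b * L a)" by (simp add: distrib_left)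
  also have "\<dots> \<approx> A a * (\<Sum>t<d. A (br b (y t)) * \<Delta> t) + A b * (\<Sum>t<d. A (br a (y t)) * \<Delta> t)"
    by (intro eqK_add AA mult)
  also have "\<dots> = (\<Sum>t<d. (A a * A (br b (y t)) + A b * A (br a (y t))) * \<Delta> t)"
    by (simp add: sum.distrib distrib_right sum_distrib_left mult.assoc)
  also have "\<dots> \<approx> (\<Sum>t<d. A (br (a * b) (y t)) * \<Delta> t)"
    unfolding br_mult_left
    by (intro eqK_sum eqK_mult eqK_refl eqK_sym[OF eqK_trans[OF rel_eqs(2)]] eqK_add rel_eqs)
  finally show ?case .
next
  case (inv s t)
  have br_t: "br t c = - (t * t * br s c)" for c
  proof -
    have "br 1 c = 0" using br_scalar_left[of 1 c] by simp
    then have *: "s * br t c + t * br s c = 0" using br_mult_left[of s t c] inv(2) by simp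
    have "br t c = t * (s * br t c)" using inv(2) by (simp add: mult.assoc[symmetric] mult.commute)
    also have "\<dots> = t * (- (t * br s c))" using * by (metis add_eq_0_iff2)
    finally show ?thesis by (simp add: mult.assoc)
  qed
  have "A \<mu> * L t \<approx> A \<mu> * - (A (t * t) * L s)" by (intro eqK_mult eqK_refl L_inverse inv)
  also have "\<dots> = - (A \<mu> * A (t * t) * L s)" by (simp add: mult.assoc)
  also have "\<dots> \<approx> - (A (t * t) * A \<mu> * L s)" by (intro eqK_uminus eqK_mult A_commute eqK_refl)
  also have "\<dots> = - (A (t * t) * (A \<mu> * L s))" by (simp add: mult.assoc)
  also have "\<dots> \<approx> - (A (t * t) * (\<Sum>r<d. A (br s (y r)) * \<Delta> r))"
    by (intro eqK_uminus eqK_mult eqK_refl inv)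
  also have "\<dots> = (\<Sum>r<d. - (A (t * t) * A (br s (y r))) * \<Delta> r)"
    by (simp add: sum_distrib_left sum_negf mult.assoc)
  also have "\<dots> \<approx> (\<Sum>r<d. A (br t (y r)) * \<Delta> r)"
    unfolding br_t
    by (intro eqK_sum eqK_mult eqK_refl eqK_sym[OF eqK_trans[OF A_uminus]] eqK_uminus rel_eqs)
  finally show ?case .
qed

definition euler :: "'f \<Rightarrow> 'f" where
  "euler u = (\<Sum>t<d. (u * A (y t) - A (y t) * u) * \<Delta> t)"

text \<open>\<open>\<Delta> t\<close> has degree one: commuting \<open>q\<close> with its
  coefficients loses a degree, which the factor \<open>L (z s)\<close> restores, and commuting
  \<open>q\<close> with that factor keeps the degree.\<close>

lemma Fil_comm_\<Delta>:
  assumes "Fil (Suc k) q"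
  shows "Fil (Suc k) (q * \<Delta> t - \<Delta> t * q)"
proof -
  have "q * \<Delta> t - \<Delta> t * q = (\<Sum>s<d. (q * A (ad t s) - A (ad t s) * q) * L (z s)
      + A (ad t s) * (q * L (z s) - L (z s) * q))"
    by (simp add: \<Delta>_def sum_distrib_left sum_distrib_right sum_subtractf[symmetric] algebra_simps)
  moreover have "Fil (k + 1) ((q * A a - A a * q) * L c)" for a c
    by (rule Fil_mult_left) (use Fil_comm_A[OF assms, of a] Fil.L[of 0] in auto)
  then have "Fil (Suc k) ((q * A a - A a * q) * L c)" for a c by simp
  ultimately show ?thesis using assms
    by (auto intro!: Fil_sum Fil.add Fil_A_mult Fil_comm_L)
qed

text \<open>
  Euler's formula: in the associated graded ring \<open>u \<mapsto> u * A (y t) - A (y t) * u\<close> is \<open>\<mu>\<close> times the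
  partial derivative along \<open>\<Delta> t\<close>.
\<close>

lemma euler_formula: "Fil N u \<Longrightarrow> Fil (N - 1) (euler u - of_nat (N - 1) * (A \<mu> * u))"
proof (induction rule: Fil.induct)
  case (K p N)
  have "euler p \<in> K"
    unfolding euler_def
    by (intro sum_K K_rmult) (use K_add[OF K_rmult K_uminus[OF K_lmult]] K in fastforce)
  moreover have "of_nat (N - 1) * (A \<mu> * p) \<in> K" by (intro K_lmult K)
  ultimately show ?case using K_add[OF _ K_uminus] Fil.K by fastforce
next
  case (A N a)
  have e: "euler (A a) \<in> K"
    unfolding euler_def by (intro sum_K K_rmult) (use A_commute in \<open>simp add: eqK_def\<close>)
  show ?case
  proof (cases N)
    case 0
    then show ?thesis using e by (simp add: Fil.K)
  next
    case (Suc M)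
    then show ?thesis using e by (auto intro!: Fil_diff Fil_of_nat_mult Fil_A_mult Fil.A intro: Fil.K simp del: of_nat_Suc)
  qed
next
  case (L N b)
  \<comment> \<open>The commutator of \<open>L b\<close> with \<open>A (y t)\<close> is
    \<open>A (br b (y t))\<close>, so this is the expansion \<open>L_span\<close>. For
    \<open>N = 0\<close> the integer factor is 1 and the difference lies in \<open>K\<close>;
    otherwise both terms already have lower degree.\<close>
  have e: "euler (L b) \<approx> A \<mu> * L b"
  proof (rule eqK_trans[OF _ eqK_sym[OF L_span]])
    show "euler (L b) \<approx> (\<Sum>t<d. A (br b (y t)) * \<Delta> t)"
      unfolding euler_def
      by (intro eqK_sum eqK_mult eqK_refl eqK_sym[OF rel_eqs(6)])
  qed
  show ?case
  proof (cases N)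
    case 0
    have "euler (L b) - of_nat (Suc 0) * (A \<mu> * L b) \<in> K" using e by (simp add: eqK_def)
    then show ?thesis using 0 by (simp add: Fil.K)
  next
    case (Suc M)
    have "Fil (Suc N) (euler (L b))"
      by (rule Fil_eqK[OF e]) (use Suc in \<open>simp add: Fil_A_mult Fil.L\<close>)
    then show ?thesis using Suc by (auto intro!: Fil_diff Fil_of_nat_mult Fil_A_mult Fil.L simp del: of_nat_Suc)
  qed
next
  case (add N p q)
  have "euler (p + q) - of_nat (N - 1) * (A \<mu> * (p + q)) =
      (euler p - of_nat (N - 1) * (A \<mu> * p)) + (euler q - of_nat (N - 1) * (A \<mu> * q))"
    by (simp add: euler_def algebra_simps sum.distrib sum_subtractf)
  with add Fil.add show ?case by metis
next
  case (mult m p k q)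
  let ?c = "\<lambda>p t. p * A (y t) - A (y t) * p"
  \<comment> \<open>The Leibniz rule leaves \<open>q\<close> between the commutator of
    \<open>p\<close> and \<open>\<Delta> t\<close>; \<open>r\<close> is the cost of exchanging
    \<open>q\<close> and \<open>\<Delta> t\<close>.\<close>
  define r where "r = (\<Sum>t<d. ?c p t * (q * \<Delta> t - \<Delta> t * q))"
  have r: "Fil (m + k) r"
    unfolding r_def
    by (intro Fil_sum Fil_mult_left Fil_comm_\<Delta> mult.hyps) (use Fil_comm_A[OF mult.hyps(1)] in simp)
  have euler: "euler (p * q) = p * euler q + euler p * q + r"
    by (simp add: euler_def r_def sum_distrib_left sum_distrib_right sum.distrib[symmetric] algebra_simps)
  \<comment> \<open>\<open>A \<mu>\<close> has to pass \<open>p\<close> to reach \<open>q\<close>;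
    their commutator is of lower degree and is absorbed.\<close>
  have "of_nat (m + k) * (A \<mu> * (p * q)) = of_nat m * (A \<mu> * p) * q + p * (of_nat k * (A \<mu> * q))
      - of_nat k * ((p * A \<mu> - A \<mu> * p) * q)"
  proof -
    show ?thesis by (simp add: of_nat_left_commute algebra_simps)
  qed
  then have "euler (p * q) - of_nat (Suc (m + k) - 1) * (A \<mu> * (p * q)) =
      p * (euler q - of_nat k * (A \<mu> * q)) + (euler p - of_nat m * (A \<mu> * p)) * q
      + of_nat k * ((p * A \<mu> - A \<mu> * p) * q) + r"
    unfolding euler by (simp add: algebra_simps)
  moreover have "Fil (m + k) ((p * A \<mu> - A \<mu> * p) * q)"
    by (rule Fil_mult_left) (use mult.hyps Fil_comm_A[OF mult.hyps(1), of \<mu>] in auto)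
  moreover have "Fil (m + k) (p * (euler q - of_nat k * (A \<mu> * q)))"
    by (rule Fil_mult_right) (use mult in auto)
  moreover have "Fil (m + k) ((euler p - of_nat m * (A \<mu> * p)) * q)"
    by (rule Fil_mult_left) (use mult in auto)
  ultimately show ?case using r by (auto intro!: Fil.add Fil_of_nat_mult)
qed

section \<open>Elements of the kernel are killed by powers of a minor\<close>

lemma power_K_mono: "A \<mu> ^ k * u \<in> K \<Longrightarrow> k \<le> l \<Longrightarrow> A \<mu> ^ l * u \<in> K"
  using K_lmult[of "A \<mu> ^ k * u" "A \<mu> ^ (l - k)"] by (simp add: mult.assoc[symmetric] power_add[symmetric])

lemma power_K_mono_right: "u * A \<mu> ^ k \<in> K \<Longrightarrow> k \<le> l \<Longrightarrow> u * A \<mu> ^ l \<in> K"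
  using K_rmult[of "u * A \<mu> ^ k" "A \<mu> ^ (l - k)"] by (simp add: mult.assoc power_add[symmetric])

lemma T_torsion: "Fil N u \<Longrightarrow> u \<in> T \<Longrightarrow> \<exists>k. A \<mu> ^ k * u \<in> K"
proof (induction N arbitrary: u)
  case 0
  then show ?case using K_lmult by (auto simp: Fil_0_iff)
next
  case (Suc N)
  show ?case
  proof (cases N)
    case 0
    then obtain a where a: "u \<approx> A a" using Suc.prems Fil_A_ex by blast
    \<comment> \<open>In degree zero the operator is multiplication by \<open>a\<close>, which
      evaluation at 1 detects.\<close>
    have "a = act u 1" using act_eqK[OF a, of 1] by (simp add: act_A)
    then have "a = 0" using Suc.prems by (simp add: T_def)
    then have "u \<in> K" using a eqK_mem A_zero by blast
    then show ?thesis using K_lmult by blast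
  next
    case (Suc M)
    define c where "c = (\<lambda>t. u * A (y t) - A (y t) * u)"
    have c_T: "c t \<in> T" for t
      unfolding c_def using \<open>u \<in> T\<close> by (intro T_diff T_rmult T_lmult)
    have "\<exists>k. A \<mu> ^ k * c t \<in> K" for t
      using Suc.IH[OF _ c_T] Fil_comm_A[OF Suc.prems(1)] by (simp add: c_def)
    then obtain k where k: "\<And>t. A \<mu> ^ k t * c t \<in> K" by metis
    \<comment> \<open>One exponent for all \<open>t < d\<close>; the sum is a convenient common
      bound.\<close>
    define l where "l = (\<Sum>t<d. k t)"
    have l: "A \<mu> ^ l * c t \<in> K" if "t < d" for t
      by (rule power_K_mono[OF k]) (use that in \<open>simp add: l_def member_le_sum\<close>)
    have "A \<mu> ^ l * euler u = (\<Sum>t<d. A \<mu> ^ l * c t * \<Delta> t)"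
      by (simp add: euler_def c_def sum_distrib_left mult.assoc)
    also have "\<dots> \<in> K" by (intro sum_K K_rmult l) simp
    finally have eK: "A \<mu> ^ l * euler u \<in> K" .
    \<comment> \<open>The error term in Euler's formula: it lies in \<open>T\<close> again and has
      lower degree, so the induction applies to it as well.\<close>
    define w where "w = euler u - of_nat N * (A \<mu> * u)"
    have "Fil N w" using euler_formula[OF Suc.prems(1)] by (simp add: w_def)
    moreover have "w \<in> T"
      unfolding w_def euler_def c_def[symmetric] using \<open>u \<in> T\<close> c_T
      by (intro T_diff T_lmult T_sum T_rmult)
    ultimately obtain j where j: "A \<mu> ^ j * w \<in> K" using Suc.IH by blast
    have "A \<mu> ^ (l + j) * euler u - A \<mu> ^ (l + j) * w \<in> K"
      using K_add[OF power_K_mono[OF eK, of "l + j"] K_uminus[OF power_K_mono[OF j, of "l + j"]]] by simp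
    also have "A \<mu> ^ (l + j) * euler u - A \<mu> ^ (l + j) * w = A \<mu> ^ (l + j) * (of_nat N * (A \<mu> * u))"
      by (simp add: w_def algebra_simps)
    \<comment> \<open>Once \<open>euler u\<close> and \<open>w\<close> are killed, only a multiple
      of \<open>u\<close> by the positive integer \<open>N\<close> is left, which can be
      cancelled.\<close>
    also have "\<dots> = of_nat (Suc M) * (A \<mu> ^ Suc (l + j) * u)"
      unfolding \<open>N = Suc M\<close> of_nat_left_commute power_Suc2 mult.assoc ..
    finally show ?thesis using of_nat_cancel by blast
  qed
qed

text \<open>The condition \<open>A \<mu> ^ k * u \<in> K\<close> is stable under multiplication of
  \<open>u\<close> from the right, so the sets \<open>I k\<close> form a chain of right
  ideals.\<close>

lemma T_torsion_uniform: "\<exists>k. \<forall>u\<in>T. A \<mu> ^ k * u \<in> K"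
proof -
  define I where "I = (\<lambda>k. {u \<in> T. A \<mu> ^ k * u \<in> K})"
  have "\<exists>k0. \<forall>k\<ge>k0. I k = I k0"
  proof (rule acc_right_ideals[OF acc])
    show "mono I" by (auto simp: mono_def I_def power_K_mono)
    show "K \<subseteq> I k" for k using K_T K_lmult by (auto simp: I_def)
    show "p + q \<in> I k" if "p \<in> I k" "q \<in> I k" for k p q
      using that by (simp add: I_def T_add K_add distrib_left)
    show "p * q \<in> I k" if "p \<in> I k" for k p q
      using that K_rmult by (simp add: I_def T_rmult mult.assoc[symmetric])
  qed
  then obtain k0 where k0: "\<forall>k\<ge>k0. I k = I k0" by blast
  have "u \<in> I k0" if "u \<in> T" for u
  proof -
    obtain k where "A \<mu> ^ k * u \<in> K" using T_torsion Fil_ex \<open>u \<in> T\<close> by blast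
    then have "u \<in> I (max k k0)" using that power_K_mono by (auto simp: I_def)
    then show ?thesis using k0[rule_format, of "max k k0"] by simp
  qed
  then show ?thesis by (auto simp: I_def)
qed

text \<open>Since \<open>A \<mu> ^ k0 * u\<close> lies in \<open>K\<close>, the product
  \<open>u * A \<mu> ^ k0\<close> is congruent to a commutator, which has lower degree and lies in
  \<open>T\<close>. The uniform exponent on the left is essential: the same \<open>k0\<close> must
  serve all the successive commutators.\<close>

lemma T_torsion_right:
  assumes k0: "\<forall>u\<in>T. A \<mu> ^ k0 * u \<in> K"
  shows "Fil N u \<Longrightarrow> u \<in> T \<Longrightarrow> \<exists>k. u * A \<mu> ^ k \<in> K"
proof (induction N arbitrary: u)
  case 0
  then show ?case using K_rmult by (auto simp: Fil_0_iff)
next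
  case (Suc N)
  define v where "v = u * A \<mu> ^ k0 - A \<mu> ^ k0 * u"
  have "v \<approx> u * A (\<mu> ^ k0) - A (\<mu> ^ k0) * u"
    unfolding v_def by (intro eqK_diff eqK_mult eqK_refl eqK_sym[OF A_power])
  then have "Fil N v" by (rule Fil_eqK) (use Fil_comm_A[OF Suc.prems(1)] in simp)
  moreover have "v \<in> T" unfolding v_def using Suc.prems by (intro T_diff T_rmult T_lmult)
  ultimately obtain k where k: "v * A \<mu> ^ k \<in> K" using Suc.IH by blast
  have "v * A \<mu> ^ k + A \<mu> ^ k0 * u * A \<mu> ^ k \<in> K"
    using K_add[OF k K_rmult[OF k0[rule_format, OF Suc.prems(2)]]] .
  also have "v * A \<mu> ^ k + A \<mu> ^ k0 * u * A \<mu> ^ k = u * A \<mu> ^ (k0 + k)"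
    by (simp add: v_def algebra_simps power_add)
  finally show ?case by blast
qed

text \<open>With the power on the right, the condition is stable under multiplication from the left,
  so this time left ideals are needed.\<close>

lemma T_torsion_right_uniform: "\<exists>k. \<forall>u\<in>T. u * A \<mu> ^ k \<in> K"
proof -
  obtain k1 where k1: "\<forall>u\<in>T. A \<mu> ^ k1 * u \<in> K" using T_torsion_uniform by blast
  define I where "I = (\<lambda>k. {u \<in> T. u * A \<mu> ^ k \<in> K})"
  have "\<exists>k0. \<forall>k\<ge>k0. I k = I k0"
  proof (rule acc_left_ideals[OF acc])
    show "mono I" by (auto simp: mono_def I_def power_K_mono_right)
    show "K \<subseteq> I k" for k using K_T K_rmult by (auto simp: I_def)
    show "p + q \<in> I k" if "p \<in> I k" "q \<in> I k" for k p q
      using that by (simp add: I_def T_add K_add distrib_right)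
    show "q * p \<in> I k" if "p \<in> I k" for k p q
      using that K_lmult by (simp add: I_def T_lmult mult.assoc)
  qed
  then obtain k0 where k0: "\<forall>k\<ge>k0. I k = I k0" by blast
  have "u \<in> I k0" if "u \<in> T" for u
  proof -
    obtain k where "u * A \<mu> ^ k \<in> K" using T_torsion_right[OF k1] Fil_ex \<open>u \<in> T\<close> by blast
    then have "u \<in> I (max k k0)" using that power_K_mono_right by (auto simp: I_def)
    then show ?thesis using k0[rule_format, of "max k k0"] by simp
  qed
  then show ?thesis by (auto simp: I_def)
qed

theorem T_annihilated: "\<exists>k. \<forall>u\<in>T. A (\<mu> ^ k) * u \<in> K \<and> u * A (\<mu> ^ k) \<in> K"
proof -
  obtain k l where kl: "\<forall>u\<in>T. A \<mu> ^ k * u \<in> K" "\<forall>u\<in>T. u * A \<mu> ^ l \<in> K"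
    using T_torsion_uniform T_torsion_right_uniform by blast
  have "A (\<mu> ^ max k l) * u \<in> K \<and> u * A (\<mu> ^ max k l) \<in> K" if "u \<in> T" for u
  proof -
    have "A (\<mu> ^ max k l) * u \<approx> A \<mu> ^ max k l * u" "u * A (\<mu> ^ max k l) \<approx> u * A \<mu> ^ max k l"
      by (intro eqK_mult A_power eqK_refl)+
    moreover have "A \<mu> ^ max k l * u \<in> K" "u * A \<mu> ^ max k l \<in> K"
      using kl that power_K_mono power_K_mono_right by auto
    ultimately show ?thesis using eqK_mem by blast
  qed
  then show ?thesis by blast
qed

end

section \<open>Minors of a matrix of given rank\<close>

text \<open>\<open>P\<close> consists of a maximal independent set of columns and \<open>Q\<close>
  of the coefficients of all columns in it. The facts about minors of size equal to the rank are
  read off from this factorization.\<close>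

lemma rank_factorization:
  fixes C :: "'b::field mat"
  assumes C: "C \<in> carrier_mat n m"
  shows "\<exists>P Q. \<forall>i<n. \<forall>j<m. C $$ (i, j) = (\<Sum>k<vec_space.rank n C. P i k * Q k j)"
proof -
  interpret vec_space "TYPE('b)" n .
  let ?S = "set (cols C)" and ?P = "\<lambda>U. U \<subseteq> set (cols C) \<and> lin_indpt U"
  have SC: "?S \<subseteq> carrier_vec n" using cols_dim C by blast
  have "?P {}" by (simp add: lin_dep_def)
  then obtain U where U: "finite U" "maximal U ?P"
    using maximal_exists_superset[of ?S ?P "{}"] by auto
  have U': "U \<subseteq> ?S" "lin_indpt U" "\<And>B. U \<subseteq> B \<Longrightarrow> ?P B \<Longrightarrow> B = U"
    using U(2) unfolding maximal_def by auto
  have rank: "rank C = card U" by (rule rank_card_indpt[OF C U(2)])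
  have UC: "U \<subseteq> carrier_vec n" using U' SC by blast
  have col: "\<exists>a. v = lincomb a U" if "v \<in> ?S" for v
  proof -
    have v: "v \<in> carrier_vec n" using that SC by blast
    have "v \<in> span U"
    proof (cases "v \<in> U")
      case True
      then show ?thesis using in_own_span[OF UC] by blast
    next
      case False
      have "lin_dep (U \<union> {v})" using U'(3)[of "U \<union> {v}"] U'(1) that False by blast
      then show ?thesis using lin_dep_iff_in_span[OF UC U'(2) v False] by blast
    qed
    then show ?thesis using finite_span[OF U(1) UC] by auto
  qed
  obtain us where us: "set us = U" "distinct us" using finite_distinct_list[OF U(1)] by blast
  have len: "length us = rank C" using rank us distinct_card by metis
  have "\<forall>j. \<exists>a. j < m \<longrightarrow> Matrix.col C j = lincomb a U"
    using col C by (metis carrier_matD(2) cols_length cols_nth nth_mem)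
  then obtain a where a: "\<And>j. j < m \<Longrightarrow> Matrix.col C j = lincomb (a j) U" by metis
  have "C $$ (i, j) = (\<Sum>k<rank C. us ! k $ i * a j (us ! k))" if "i < n" "j < m" for i j
  proof -
    have "C $$ (i, j) = Matrix.col C j $ i" using that C by simp
    also have "\<dots> = (\<Sum>v\<in>U. a j v * v $ i)" using a that by (simp add: lincomb_index UC)
    also have "\<dots> = (\<Sum>k<length us. a j (us ! k) * us ! k $ i)"
      unfolding us(1)[symmetric]
      by (rule sum.reindex_bij_betw[OF bij_betw_nth[OF us(2) refl refl], symmetric])
    finally show ?thesis by (simp add: len mult.commute)
  qed
  then have "\<forall>i<n. \<forall>j<m. C $$ (i, j) = (\<Sum>k<rank C. (\<lambda>i k. us ! k $ i) i k * (\<lambda>k j. a j (us ! k)) k j)"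
    by simp
  then show ?thesis by (intro exI)
qed

lemma mult_mat_entry:
  assumes "M \<in> carrier_mat a b" "N \<in> carrier_mat b c" "i < a" "j < c"
  shows "(M * N) $$ (i, j) = (\<Sum>k<b. M $$ (i, k) * N $$ (k, j))"
  using assms by (simp add: scalar_prod_def lessThan_atLeast0)

lemma comm_ring_hom_to_fract: "comm_ring_hom (to_fract :: 'a::idom \<Rightarrow> 'a fract)"
  by unfold_locales simp_all

lemma index_tuples_nth:
  assumes "is \<in> index_tuples n d" "s < d"
  shows "is ! s < n"
proof -
  have "s < length is" "set is \<subseteq> {..<n}" using assms by (simp_all add: index_tuples_def)
  then show ?thesis using nth_mem lessThan_iff by blast
qed

section \<open>Adjugates and minors of size equal to the rank\<close>

definition minor_mat :: "('a::comm_ring_1 \<Rightarrow> 'a \<Rightarrow> 'a) \<Rightarrow> (nat \<Rightarrow> 'a) \<Rightarrow> nat list \<Rightarrow> nat list \<Rightarrow> 'a mat" where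
  "minor_mat br x is js = mat (length is) (length js) (\<lambda>(s, t). br (x (is ! s)) (x (js ! t)))"

lemma minor_eq: "minor br x is js = det (minor_mat br x is js)"
  by (simp add: minor_def minor_mat_def)

definition minor_adj :: "('a::comm_ring_1 \<Rightarrow> 'a \<Rightarrow> 'a) \<Rightarrow> (nat \<Rightarrow> 'a) \<Rightarrow> nat list \<Rightarrow> nat list
    \<Rightarrow> nat \<Rightarrow> nat \<Rightarrow> 'a" where
  "minor_adj br x is js t s = adj_mat (minor_mat br x is js) $$ (t, s)"

lemma minor_adj_row:
  assumes "length is = d" "length js = d" "r < d" "s < d"
  shows "(\<Sum>t<d. br (x (is ! r)) (x (js ! t)) * minor_adj br x is js t s)
    = (if r = s then minor br x is js else 0)"
proof -
  let ?M = "minor_mat br x is js"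
  have M: "?M \<in> carrier_mat d d" using assms by (simp add: minor_mat_def)
  have "(?M * adj_mat ?M) $$ (r, s) = (det ?M \<cdot>\<^sub>m 1\<^sub>m d) $$ (r, s)" by (simp add: adj_mat(2)[OF M])
  then show ?thesis
    using assms M adj_mat(1)[OF M]
    by (simp add: scalar_prod_def minor_eq minor_adj_def minor_mat_def lessThan_atLeast0 cong: if_cong)
qed

text \<open>Laplace expansion along the appended row. It identifies the signed minors in
  \<open>kappa_gen\<close> with the coefficients of Cramer's rule.\<close>

lemma minor_replace_row:
  assumes len: "length is = d" "length js = d" and s: "s < d"
  shows "(-1) ^ (Suc s + d + 1) * minor br x (take s is @ drop (Suc s) is @ [\<nu>]) js
    = - (\<Sum>t<d. br (x \<nu>) (x (js ! t)) * minor_adj br x is js t s)"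
proof -
  let ?is = "take s is @ drop (Suc s) is @ [\<nu>]"
  let ?M = "minor_mat br x is js" and ?N = "minor_mat br x ?is js"
  \<comment> \<open>\<open>e\<close> is the position of the appended row.\<close>
  obtain e where e: "d = Suc e" using s by (cases d) auto
  have len': "length ?is = d" using len s by simp
  have nth: "?is ! i = (if i < s then is ! i else if i < e then is ! Suc i else \<nu>)" if "i < d" for i
    using that s len e by (auto simp: nth_append)
  have N: "?N \<in> carrier_mat d d" using len len' by (simp add: minor_mat_def)
  \<comment> \<open>Without its last row the new matrix is the old one without row \<open>s\<close>,
    with the remaining rows in the same order; so the cofactors differ at most by sign.\<close>
  have del: "mat_delete ?N e t = mat_delete ?M s t" if "t < d" for t
    unfolding mat_delete_def minor_mat_def len len'
    using that s e by (intro eq_matI) (auto simp: nth)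
  have "det ?N = (\<Sum>t<d. ?N $$ (e, t) * cofactor ?N e t)"
    by (rule laplace_expansion_row[OF N]) (simp add: e)
  also have "\<dots> = (\<Sum>t<d. br (x \<nu>) (x (js ! t)) * ((-1) ^ (e + t) * det (mat_delete ?M s t)))"
    using s e by (intro sum.cong refl) (simp add: cofactor_def del, simp add: minor_mat_def len len' nth)
  finally have "(-1) ^ (Suc s + d + 1) * minor br x ?is js =
      (\<Sum>t<d. br (x \<nu>) (x (js ! t)) * ((-1) ^ (Suc s + d + 1) * (-1) ^ (e + t) * det (mat_delete ?M s t)))"
    by (simp add: minor_eq sum_distrib_left ac_simps)
  also have "\<dots> = (\<Sum>t<d. br (x \<nu>) (x (js ! t)) * (- minor_adj br x is js t s))"
  proof (intro sum.cong refl arg_cong2[of _ _ _ _ "(*)"])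
    fix t assume t: "t \<in> {..<d}"
    have "(-1) ^ (Suc s + d + 1) * (-1) ^ (e + t) = (- ((-1) ^ (s + t)) :: 'a)"
    proof -
      have "Suc s + d + 1 + (e + t) = Suc (s + t) + 2 * (e + 1)" by (simp add: e)
      then show ?thesis by (simp only: power_add[symmetric]) (simp add: power_add power_mult)
    qed
    then show "(-1) ^ (Suc s + d + 1) * (-1) ^ (e + t) * det (mat_delete ?M s t) = - minor_adj br x is js t s"
      using t s len by (simp add: minor_adj_def adj_mat_def cofactor_def minor_mat_def)
  qed
  finally show ?thesis by (simp add: sum_negf)
qed

context
  fixes br :: "'a::idom \<Rightarrow> 'a \<Rightarrow> 'a" and n :: nat and x :: "nat \<Rightarrow> 'a" and d :: nat
    and P Q :: "nat \<Rightarrow> nat \<Rightarrow> 'a fract"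
  assumes PQ: "\<And>i j. i < n \<Longrightarrow> j < n \<Longrightarrow> to_fract (br (x i) (x j)) = (\<Sum>k<d. P i k * Q k j)"
begin

private definition "PI is = mat d d (\<lambda>(s, k). P (is ! s) k)"
private definition "QJ js = mat d d (\<lambda>(k, t). Q k (js ! t))"

lemma minor_mat_PQ:
  assumes "is \<in> index_tuples n d" "js \<in> index_tuples n d"
  shows "map_mat to_fract (minor_mat br x is js) = PI is * QJ js"
proof (rule eq_matI)
  fix s t assume "s < dim_row (PI is * QJ js)" "t < dim_col (PI is * QJ js)"
  then have st: "s < d" "t < d" by (simp_all add: PI_def QJ_def)
  then have "is ! s < n" "js ! t < n"
    using assms index_tuples_nth by blast+
  from PQ[OF this] st assms show "map_mat to_fract (minor_mat br x is js) $$ (s, t) = (PI is * QJ js) $$ (s, t)"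
    by (simp add: minor_mat_def PI_def QJ_def index_tuples_def scalar_prod_def lessThan_atLeast0)
qed (use assms in \<open>auto simp: minor_mat_def PI_def QJ_def index_tuples_def\<close>)

lemma minor_PQ:
  assumes "is \<in> index_tuples n d" "js \<in> index_tuples n d"
  shows "to_fract (minor br x is js) = det (PI is) * det (QJ js)"
proof -
  interpret comm_ring_hom "to_fract :: 'a \<Rightarrow> 'a fract" by (rule comm_ring_hom_to_fract)
  have "to_fract (minor br x is js) = det (map_mat to_fract (minor_mat br x is js))"
    by (simp add: minor_eq)
  also have "\<dots> = det (PI is * QJ js)" by (simp only: minor_mat_PQ[OF assms])
  also have "\<dots> = det (PI is) * det (QJ js)" by (rule det_mult[of _ d]) (simp_all add: PI_def QJ_def)
  finally show ?thesis .
qed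

text \<open>The minor is the product of a determinant depending only on the rows and one depending
  only on the columns. Each is non-zero because some non-zero minor contains it.\<close>

lemma minor_nonzero_PQ:
  assumes "is \<in> minor_rows br n x d" "js \<in> minor_cols br n x d"
  shows "minor br x is js \<noteq> 0"
proof -
  obtain js' where js': "is \<in> index_tuples n d" "js' \<in> index_tuples n d" "minor br x is js' \<noteq> 0"
    using assms(1) by (auto simp: minor_rows_def)
  obtain is' where is': "js \<in> index_tuples n d" "is' \<in> index_tuples n d" "minor br x is' js \<noteq> 0"
    using assms(2) by (auto simp: minor_cols_def)
  have "det (PI is) \<noteq> 0" using minor_PQ[OF js'(1,2)] js'(3) by (metis mult_zero_left to_fract_eq_0_iff)
  moreover have "det (QJ js) \<noteq> 0" using minor_PQ[OF is'(2,1)] is'(3) by (metis mult_zero_right to_fract_eq_0_iff)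
  ultimately have "to_fract (minor br x is js) \<noteq> 0" using minor_PQ js'(1) is'(1) by simp
  then show ?thesis by simp
qed

text \<open>Equivalent to the vanishing of the bordered minor of size \<open>d + 1\<close>. Here it
  follows from the factorization: \<open>QJ js\<close> times the adjugate times \<open>PI is\<close>
  is \<open>\<mu>\<close> times the identity, and is placed between a row of \<open>P\<close> and a
  column of \<open>Q\<close>.\<close>

lemma minor_column_PQ:
  assumes tup: "is \<in> index_tuples n d" "js \<in> index_tuples n d" and nz: "minor br x is js \<noteq> 0"
    and \<nu>: "\<nu> < n" and j: "j < n"
  shows "minor br x is js * br (x \<nu>) (x j) =
    (\<Sum>t<d. br (x \<nu>) (x (js ! t)) * (\<Sum>s<d. minor_adj br x is js t s * br (x (is ! s)) (x j)))"
proof -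
  let ?M = "minor_mat br x is js"
  define \<mu> where "\<mu> = to_fract (minor br x is js)"
  define D where "D = map_mat to_fract (adj_mat ?M)"
  define p where "p = mat 1 d (\<lambda>(_, k). P \<nu> k)"
  define q where "q = mat d 1 (\<lambda>(k, _). Q k j)"
  have len: "length is = d" "length js = d" using tup by (simp_all add: index_tuples_def)
  have lt: "is ! s < n" "js ! s < n" if "s < d" for s
    using tup that index_tuples_nth by blast+
  have M: "?M \<in> carrier_mat d d" using len by (simp add: minor_mat_def)
  have cr: "PI is \<in> carrier_mat d d" "QJ js \<in> carrier_mat d d" "D \<in> carrier_mat d d"
    "p \<in> carrier_mat 1 d" "q \<in> carrier_mat d 1"
    using adj_mat(1)[OF M] by (simp_all add: PI_def QJ_def D_def p_def q_def)
  interpret comm_ring_hom "to_fract :: 'a \<Rightarrow> 'a fract" by (rule comm_ring_hom_to_fract)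
  have "D * (PI is * QJ js) = map_mat to_fract (adj_mat ?M * ?M)"
    unfolding D_def minor_mat_PQ[OF tup, symmetric] by (rule mat_hom_mult[OF adj_mat(1)[OF M] M, symmetric])
  also have "\<dots> = \<mu> \<cdot>\<^sub>m 1\<^sub>m d"
    unfolding adj_mat(3)[OF M] by (rule eq_matI) (auto simp: \<mu>_def minor_eq)
  finally have DPQ: "D * (PI is * QJ js) = \<mu> \<cdot>\<^sub>m 1\<^sub>m d" .
  have \<mu>: "\<mu> \<noteq> 0" using nz by (simp add: \<mu>_def)
  let ?B = "(1 / \<mu>) \<cdot>\<^sub>m (D * PI is)"
  have B: "?B \<in> carrier_mat d d" using cr by simp
  have "?B * QJ js = (1 / \<mu>) \<cdot>\<^sub>m (D * PI is * QJ js)"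
    using cr by (intro mult_smult_assoc_mat[of _ d d _ d]) auto
  also have "\<dots> = (1 / \<mu>) \<cdot>\<^sub>m (\<mu> \<cdot>\<^sub>m 1\<^sub>m d)" using DPQ assoc_mult_mat[OF cr(3,1,2)] by simp
  also have "\<dots> = 1\<^sub>m d" using \<mu> by (intro eq_matI) auto
  \<comment> \<open>A left inverse of a square matrix is also a right inverse; this brings
    \<open>QJ js\<close> to the front.\<close>
  finally have "QJ js * ?B = 1\<^sub>m d" using mat_mult_left_right_inverse[OF B cr(2)] by simp
  moreover have "QJ js * ?B = (1 / \<mu>) \<cdot>\<^sub>m (QJ js * (D * PI is))"
    using cr by (intro mult_smult_distrib[of _ d d _ d]) auto
  ultimately have "\<mu> \<cdot>\<^sub>m 1\<^sub>m d = \<mu> \<cdot>\<^sub>m ((1 / \<mu>) \<cdot>\<^sub>m (QJ js * (D * PI is)))" by simp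
  also have "\<dots> = QJ js * (D * PI is)" using \<mu> by (intro eq_matI) auto
  finally have QDP: "QJ js * (D * PI is) = \<mu> \<cdot>\<^sub>m 1\<^sub>m d" ..
  have "(p * QJ js) * (D * (PI is * q)) = p * ((QJ js * (D * PI is)) * q)"
  proof -
    have "D * (PI is * q) = D * PI is * q" using cr by (intro assoc_mult_mat[symmetric, of _ d d _ d _ 1]) auto
    moreover have "QJ js * (D * PI is * q) = QJ js * (D * PI is) * q"
      using cr by (intro assoc_mult_mat[symmetric, of _ d d _ d _ 1]) auto
    moreover have "(p * QJ js) * (D * PI is * q) = p * (QJ js * (D * PI is * q))"
      using cr by (intro assoc_mult_mat[of _ 1 d _ d _ 1]) auto
    ultimately show ?thesis by simp
  qed
  also have "\<dots> = p * (\<mu> \<cdot>\<^sub>m q)"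
    unfolding QDP using mult_smult_assoc_mat[of "1\<^sub>m d" d d q 1 \<mu>] cr by simp
  also have "\<dots> = \<mu> \<cdot>\<^sub>m (p * q)" using cr by (intro mult_smult_distrib[of _ 1 d _ 1]) auto
  finally have "((p * QJ js) * (D * (PI is * q))) $$ (0, 0) = (\<mu> \<cdot>\<^sub>m (p * q)) $$ (0, 0)" by simp
  moreover have "(p * q) $$ (0, 0) = to_fract (br (x \<nu>) (x j))"
    by (simp add: p_def q_def PQ[OF \<nu> j] scalar_prod_def lessThan_atLeast0)
  moreover have "((p * QJ js) * (D * (PI is * q))) $$ (0, 0) = (\<Sum>t<d. to_fract (br (x \<nu>) (x (js ! t))) *
      (\<Sum>s<d. to_fract (minor_adj br x is js t s) * to_fract (br (x (is ! s)) (x j))))"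
  proof -
    have 1: "(p * QJ js) $$ (0, t) = to_fract (br (x \<nu>) (x (js ! t)))" if "t < d" for t
      using that PQ[OF \<nu> lt(2)[OF that]] by (simp add: p_def QJ_def scalar_prod_def lessThan_atLeast0)
    have 2: "(PI is * q) $$ (s, 0) = to_fract (br (x (is ! s)) (x j))" if "s < d" for s
      using that PQ[OF lt(1)[OF that] j] by (simp add: q_def PI_def scalar_prod_def lessThan_atLeast0)
    have 3: "(D * (PI is * q)) $$ (t, 0) = (\<Sum>s<d. to_fract (minor_adj br x is js t s) * to_fract (br (x (is ! s)) (x j)))"
      if "t < d" for t
    proof -
      have "(D * (PI is * q)) $$ (t, 0) = (\<Sum>s<d. D $$ (t, s) * (PI is * q) $$ (s, 0))"
        using that by (intro mult_mat_entry[OF cr(3) mult_carrier_mat[OF cr(1,5)]]) auto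
      then show ?thesis using that adj_mat(1)[OF M] by (simp add: 2 D_def minor_adj_def del: index_mult_mat(1))
    qed
    have "((p * QJ js) * (D * (PI is * q))) $$ (0, 0) = (\<Sum>t<d. (p * QJ js) $$ (0, t) * (D * (PI is * q)) $$ (t, 0))"
      using cr by (intro mult_mat_entry[of _ 1 d _ 1]) auto
    then show ?thesis by (simp add: 1 3 del: index_mult_mat(1))
  qed
  ultimately have "to_fract (minor br x is js * br (x \<nu>) (x j)) =
    to_fract (\<Sum>t<d. br (x \<nu>) (x (js ! t)) * (\<Sum>s<d. minor_adj br x is js t s * br (x (is ! s)) (x j)))"
    using cr by (simp add: \<mu>_def)
  then show ?thesis by (simp only: to_fract_eq_iff)
qed

end

lemma poisson_rank_factorization:
  "\<exists>P Q. \<forall>i<n. \<forall>j<n. to_fract (br (x i) (x j)) = (\<Sum>k<poisson_rank br n x. P i k * Q k j)"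
proof -
  let ?C = "map_mat to_fract (mat n n (\<lambda>(i, j). br (x i) (x j)))"
  have "?C \<in> carrier_mat n n" by simp
  from rank_factorization[OF this] show ?thesis by (simp add: poisson_rank_def)
qed

lemma minor_nonzero:
  assumes "is \<in> minor_rows br n x (poisson_rank br n x)" "js \<in> minor_cols br n x (poisson_rank br n x)"
  shows "minor br x is js \<noteq> 0"
proof -
  obtain P Q where "\<And>i j. i < n \<Longrightarrow> j < n \<Longrightarrow>
      to_fract (br (x i) (x j)) = (\<Sum>k<poisson_rank br n x. P i k * Q k j)"
    using poisson_rank_factorization[of n br x] by blast
  from minor_nonzero_PQ[OF this assms] show ?thesis .
qed

lemma minor_column:
  assumes d: "d = poisson_rank br n x"
    and "is \<in> index_tuples n d" "js \<in> index_tuples n d" "minor br x is js \<noteq> 0" "\<nu> < n" "j < n"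
  shows "minor br x is js * br (x \<nu>) (x j) =
    (\<Sum>t<d. br (x \<nu>) (x (js ! t)) * (\<Sum>s<d. minor_adj br x is js t s * br (x (is ! s)) (x j)))"
proof -
  obtain P Q where "\<And>i j. i < n \<Longrightarrow> j < n \<Longrightarrow> to_fract (br (x i) (x j)) = (\<Sum>k<d. P i k * Q k j)"
    using poisson_rank_factorization[of n br x] unfolding d by blast
  from minor_column_PQ[OF this assms(2-)] show ?thesis .
qed

text \<open>The difference \<open>D\<close> of the two sides is a derivation in \<open>b\<close>,
  and \<open>minor_column\<close> makes it vanish on the variables. With
  \<open>minor_replace_row\<close> this says that the generators of kappa act as zero.\<close>

lemma kappa_derivation_zero:
  fixes br :: "'a::idom \<Rightarrow> 'a \<Rightarrow> 'a"
  assumes "poisson_algebra scale br" and "ess_finite scale n x" and d: "d = poisson_rank br n x"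
    and rows: "is \<in> minor_rows br n x d" and cols: "js \<in> minor_cols br n x d" and \<nu>: "\<nu> < n"
  shows "minor br x is js * br (x \<nu>) b = (\<Sum>s<d. (\<Sum>t<d. br (x \<nu>) (x (js ! t)) *
      minor_adj br x is js t s) * br (x (is ! s)) b)"
proof -
  interpret poisson_algebra scale br by fact
  interpret ess_finite scale n x by fact
  have tup: "is \<in> index_tuples n d" "js \<in> index_tuples n d"
    using rows cols by (simp_all add: minor_rows_def minor_cols_def)
  have nz: "minor br x is js \<noteq> 0" using minor_nonzero rows cols unfolding d by blast
  define D where "D = (\<lambda>b. minor br x is js * br (x \<nu>) b - (\<Sum>s<d. (\<Sum>t<d. br (x \<nu>) (x (js ! t)) *
      minor_adj br x is js t s) * br (x (is ! s)) b))"
  have D_add: "D (a + b) = D a + D b" for a b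
    by (simp add: D_def br_add_right distrib_left sum.distrib)
  have D_mult: "D (a * b) = D a * b + a * D b" for a b
    by (simp add: D_def br_mult_right algebra_simps sum.distrib sum_distrib_left sum_distrib_right)
  have br_const: "br a (scale c 1) = 0" for a c
  proof -
    have "br a 1 = br a 1 + br a 1" using br_mult_right[of a 1 1] by simp
    then have "br a 1 = 0" by (metis add_diff_cancel_right' diff_self)
    then show ?thesis by (simp add: br_scale_right)
  qed
  then have D_const: "D (scale c 1) = 0" for c by (simp add: D_def)
  have "D b = 0"
  proof (induction b rule: alg_induct)
    case (const c)
    show ?case by (rule D_const)
  next
    case (var j)
    have "(\<Sum>s<d. (\<Sum>t<d. br (x \<nu>) (x (js ! t)) * minor_adj br x is js t s) * br (x (is ! s)) (x j)) =
      (\<Sum>t<d. br (x \<nu>) (x (js ! t)) * (\<Sum>s<d. minor_adj br x is js t s * br (x (is ! s)) (x j)))"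
      by (simp only: sum_distrib_left sum_distrib_right mult.assoc) (rule sum.swap)
    then show ?case using minor_column[OF d tup nz \<nu> var] by (simp add: D_def)
  next
    case (inv s t)
    \<comment> \<open>Apply \<open>D\<close> to \<open>s * t = 1\<close>.\<close>
    have "s * D t = 0" using D_mult[of s t] inv D_const[of 1] by simp
    moreover have "s \<noteq> 0" using inv(2) by auto
    ultimately show ?case by simp
  qed (simp_all add: D_add D_mult)
  then show ?thesis by (simp add: D_def)
qed

section \<open>From the generators of kappa to Cramer's rule and annihilators\<close>

context env_mod
begin

lemma A_sum: "finite I \<Longrightarrow> A (sum f I) \<approx> (\<Sum>i\<in>I. A (f i))"
proof (induction I rule: finite_induct)
  case empty
  show ?case by (simp add: eqK_zero_iff A_zero)
next
  case (insert i I)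
  have "A (f i + sum f I) \<approx> A (f i) + A (sum f I)" by (rule rel_eqs)
  also have "\<dots> \<approx> A (f i) + (\<Sum>i\<in>I. A (f i))" by (intro eqK_add eqK_refl insert)
  finally show ?case using insert by simp
qed

lemma A_sum_swap:
  fixes d :: nat
  shows "(\<Sum>t<d. A (c t) * (\<Sum>s<d. A (ad t s) * L (z s))) \<approx> (\<Sum>s<d. A (\<Sum>t<d. c t * ad t s) * L (z s))"
proof -
  have "(\<Sum>t<d. A (c t) * (\<Sum>s<d. A (ad t s) * L (z s))) = (\<Sum>s<d. (\<Sum>t<d. A (c t) * A (ad t s)) * L (z s))"
    by (simp only: sum_distrib_left sum_distrib_right mult.assoc) (rule sum.swap)
  also have "\<dots> \<approx> (\<Sum>s<d. (\<Sum>t<d. A (c t * ad t s)) * L (z s))"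
    by (intro eqK_sum eqK_mult eqK_refl eqK_sym[OF rel_eqs(3)])
  also have "\<dots> \<approx> (\<Sum>s<d. A (\<Sum>t<d. c t * ad t s) * L (z s))"
    by (intro eqK_sum eqK_mult eqK_refl eqK_sym[OF A_sum] finite_lessThan)
  finally show ?thesis .
qed

end

locale env_poisson = env_act scale br A L K n x act
  for scale :: "'k::field_char_0 \<Rightarrow> 'a::idom \<Rightarrow> 'a" and br :: "'a \<Rightarrow> 'a \<Rightarrow> 'a"
    and A L :: "'a \<Rightarrow> 'f::ring_1" and K :: "'f set" and n :: nat and x :: "nat \<Rightarrow> 'a"
    and act :: "'f \<Rightarrow> 'a \<Rightarrow> 'a" +
  fixes d :: nat
  assumes d: "d = poisson_rank br n x"
    and kappa_mem: "is \<in> minor_rows br n x d \<Longrightarrow> js \<in> minor_cols br n x d \<Longrightarrow> \<nu> < n \<Longrightarrow> \<nu> \<notin> set is \<Longrightarrow>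
      A (minor br x is js) * L (x \<nu>) + (\<Sum>s<d. A ((-1) ^ (Suc s + d + 1)
          * minor br x (take s is @ drop (Suc s) is @ [\<nu>]) js) * L (x (is ! s))) \<in> K"
begin

text \<open>For a variable in a row of the minor, the expansion is the identity between a matrix and
  its adjugate; for any other variable, it is a generator of kappa.\<close>

lemma env_dual:
  assumes rows: "is \<in> minor_rows br n x d" and cols: "js \<in> minor_cols br n x d"
  shows "env_dual scale br A L K n x act d (\<lambda>t. x (js ! t)) (\<lambda>s. x (is ! s)) (minor_adj br x is js)
    (minor br x is js)"
proof unfold_locales
  let ?\<mu> = "minor br x is js" and ?ad = "minor_adj br x is js"
  show "?\<mu> \<noteq> 0" using minor_nonzero rows cols unfolding d by blast
  have len: "length is = d" "length js = d"
    using rows cols by (simp_all add: minor_rows_def minor_cols_def index_tuples_def)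
  fix i assume i: "i < n"
  let ?c = "\<lambda>s. \<Sum>t<d. br (x i) (x (js ! t)) * ?ad t s"
  have "A ?\<mu> * L (x i) \<approx> (\<Sum>s<d. A (?c s) * L (x (is ! s)))"
  proof (cases "i \<in> set is")
    case True
    then obtain r where r: "r < d" "i = is ! r" using len by (metis in_set_conv_nth)
    have "?c s = (if r = s then ?\<mu> else 0)" if "s < d" for s
      unfolding r(2) by (rule minor_adj_row[OF len r(1) that])
    then have "(\<Sum>s<d. A (?c s) * L (x (is ! s))) = (\<Sum>s<d. A (if r = s then ?\<mu> else 0) * L (x (is ! s)))"
      by (intro sum.cong refl) simp
    also have "\<dots> \<approx> (\<Sum>s<d. if r = s then A ?\<mu> * L (x (is ! s)) else 0)"
      by (intro eqK_sum) (use K_rmult[OF A_zero] in \<open>auto simp: eqK_zero_iff\<close>)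
    also have "\<dots> = A ?\<mu> * L (x i)" using r by simp
    finally show ?thesis by (rule eqK_sym)
  next
    case False
    have "A ?\<mu> * L (x i) + (\<Sum>s<d. A (- ?c s) * L (x (is ! s))) \<in> K"
    proof -
      have "(\<Sum>s<d. A ((-1) ^ (Suc s + d + 1) * minor br x (take s is @ drop (Suc s) is @ [i]) js) * L (x (is ! s)))
        = (\<Sum>s<d. A (- ?c s) * L (x (is ! s)))"
        by (intro sum.cong refl arg_cong2[of _ _ _ _ "(*)"] arg_cong[of _ _ A] minor_replace_row[OF len]) simp
      then show ?thesis using kappa_mem[OF rows cols i False] by (simp only:)
    qed
    moreover have "A ?\<mu> * L (x i) + (\<Sum>s<d. A (- ?c s) * L (x (is ! s))) \<approx>
        A ?\<mu> * L (x i) + (\<Sum>s<d. - A (?c s) * L (x (is ! s)))"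
      by (intro eqK_add eqK_sum eqK_mult eqK_refl A_uminus)
    ultimately have "A ?\<mu> * L (x i) + (\<Sum>s<d. - A (?c s) * L (x (is ! s))) \<in> K"
      using eqK_mem by blast
    then show ?thesis by (simp add: eqK_def sum_negf)
  qed
  also have "\<dots> \<approx> (\<Sum>t<d. A (br (x i) (x (js ! t))) * (\<Sum>s<d. A (?ad t s) * L (x (is ! s))))"
    by (rule eqK_sym[OF A_sum_swap])
  finally show "A ?\<mu> * L (x i) - (\<Sum>t<d. A (br (x i) (x (js ! t))) * (\<Sum>s<d. A (?ad t s) * L (x (is ! s)))) \<in> K"
    by (simp only: eqK_def)
qed

lemma T_annihilated_minor:
  assumes "is \<in> minor_rows br n x d" "js \<in> minor_cols br n x d"
  shows "\<exists>k. \<forall>u\<in>T. A (minor br x is js ^ k) * u \<in> K \<and> u * A (minor br x is js ^ k) \<in> K"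
  using env_dual.T_annihilated[OF env_dual[OF assms]] .

text \<open>The two-sided annihilator of \<open>T\<close> modulo \<open>K\<close> inside the Poisson
  algebra. As an ideal containing a power of each minor, it contains a power of the ideal of
  minors.\<close>

definition Ann :: "'a set" where
  "Ann = {a. \<forall>u\<in>T. A a * u \<in> K \<and> u * A a \<in> K}"

lemma ring_ideal_Ann: "ring_ideal Ann"
  unfolding ring_ideal_def
proof (intro conjI ballI allI)
  show "0 \<in> Ann" using A_zero K_lmult K_rmult by (simp add: Ann_def)
next
  fix a b assume ab: "a \<in> Ann" "b \<in> Ann"
  have "A (a + b) * u \<in> K \<and> u * A (a + b) \<in> K" if "u \<in> T" for u
  proof -
    have "A (a + b) * u \<approx> A a * u + A b * u" "u * A (a + b) \<approx> u * A a + u * A b"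
      using eqK_mult[OF rel_eqs(2) eqK_refl[of u]] eqK_mult[OF eqK_refl[of u] rel_eqs(2)]
      by (simp_all add: distrib_left distrib_right)
    moreover have "A a * u + A b * u \<in> K" "u * A a + u * A b \<in> K"
      using ab that K_add by (auto simp: Ann_def)
    ultimately show ?thesis using eqK_mem by blast
  qed
  then show "a + b \<in> Ann" by (simp add: Ann_def)
next
  fix a r assume a: "a \<in> Ann"
  have "A (r * a) * u \<in> K \<and> u * A (r * a) \<in> K" if "u \<in> T" for u
  proof -
    have "A (r * a) * u \<approx> A r * A a * u" by (intro eqK_mult rel_eqs eqK_refl)
    \<comment> \<open>The Poisson algebra is commutative, so \<open>A a\<close> can be placed next
      to \<open>u\<close>.\<close>
    moreover have "u * A (r * a) \<approx> u * (A a * A r)"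
      by (intro eqK_mult eqK_trans[OF rel_eqs(3)] A_commute eqK_refl)
    moreover have "A r * A a * u \<in> K" "u * (A a * A r) \<in> K"
      using a that K_lmult[of "A a * u" "A r"] K_rmult[of "u * A a" "A r"]
      by (simp_all add: Ann_def mult.assoc)
    ultimately show ?thesis using eqK_mem by blast
  qed
  then show "r * a \<in> Ann" by (simp add: Ann_def)
qed

end

section \<open>Powers of the ideal of minors\<close>

lemma ideal_of_ring_ideal:
  assumes "ring_ideal I"
  shows "ideal I class_ring"
proof (rule idealI)
  note id = ring_idealD[OF assms]
  show "ring (class_ring :: 'a::comm_ring_1 ring)" by (rule class_ring.ring_axioms)
  have inv: "inv\<^bsub>add_monoid (class_ring :: 'a ring)\<^esub> a = - a" for a
    unfolding a_inv_def[symmetric] by (simp add: class_ring_simps)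
  show "subgroup I (add_monoid class_ring)"
    by unfold_locales (use id inv in auto)
qed (use ring_idealD(3)[OF assms] in \<open>auto simp: mult.commute\<close>)

lemma ring_ideal_colon: "ring_ideal R \<Longrightarrow> ring_ideal {a. a * b \<in> R}"
  by (auto simp: ring_ideal_def distrib_right mult.assoc)

lemma genideal_subset:
  assumes "ring_ideal R" "B \<subseteq> R"
  shows "Idl\<^bsub>class_ring\<^esub> B \<subseteq> R"
  using assms(2) by (rule ring.genideal_minimal[OF class_ring.ring_axioms ideal_of_ring_ideal[OF assms(1)]])

text \<open>Passing to a colon ideal reduces a product to its generators, one factor at a time;
  therefore \<open>R\<close> must vary in the induction.\<close>

lemma ideal_power_subset_of_prods:
  assumes "ring_ideal R" "\<And>gs. length gs = t \<Longrightarrow> set gs \<subseteq> B \<Longrightarrow> prod_list gs \<in> R"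
  shows "Idl\<^bsub>class_ring\<^esub> B [^]\<^bsub>ideals_set class_ring\<^esub> t \<subseteq> R"
  using assms
proof (induction t arbitrary: R)
  case 0
  \<comment> \<open>The zeroth power of an ideal is the whole ring, and the empty product is
    1.\<close>
  have "1 \<in> R" using 0(2)[of "[]"] by simp
  then have "a * 1 \<in> R" for a using 0(1) ring_idealD(3) by blast
  then show ?case by (auto simp: nat_pow_def ideals_set_def)
next
  case (Suc t)
  have "a * b \<in> R" if a: "a \<in> Idl\<^bsub>class_ring\<^esub> B [^]\<^bsub>ideals_set class_ring\<^esub> t" and b: "b \<in> Idl\<^bsub>class_ring\<^esub> B" for a b
  proof -
    have "prod_list gs * b \<in> R" if "length gs = t" "set gs \<subseteq> B" for gs
    proof -
      have "B \<subseteq> {b. b * prod_list gs \<in> R}"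
        using Suc.prems(2)[of "_ # gs"] that by auto
      from genideal_subset[OF ring_ideal_colon[OF Suc.prems(1)] this] b show ?thesis
        by (auto simp: mult.commute)
    qed
    then have "Idl\<^bsub>class_ring\<^esub> B [^]\<^bsub>ideals_set class_ring\<^esub> t \<subseteq> {a. a * b \<in> R}"
      by (intro Suc.IH ring_ideal_colon Suc.prems) auto
    then show ?thesis using a by blast
  qed
  moreover have "Idl\<^bsub>class_ring\<^esub> B [^]\<^bsub>ideals_set class_ring\<^esub> Suc t =
      ideal_prod class_ring (Idl\<^bsub>class_ring\<^esub> B [^]\<^bsub>ideals_set class_ring\<^esub> t) (Idl\<^bsub>class_ring\<^esub> B)"
    by (simp add: nat_pow_def ideals_set_def)
  moreover have "a \<in> R" if "a \<in> ideal_prod class_ring X Y" "\<And>a b. a \<in> X \<Longrightarrow> b \<in> Y \<Longrightarrow> a * b \<in> R" for a X Y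
    using that(1) by induction (use that(2) ring_idealD(2)[OF Suc.prems(1)] in auto)
  ultimately show ?case by blast
qed

lemma power_count_dvd_prod_list: "g ^ count_list gs g dvd prod_list (gs :: 'a::comm_monoid_mult list)"
  by (induction gs) (auto intro: mult_dvd_mono dvd_mult)

text \<open>Pigeonhole: in a product of more than \<open>sum k B\<close> generators, some
  \<open>g\<close> occurs at least \<open>k g\<close> times.\<close>

theorem ideal_power_subset:
  assumes R: "ring_ideal R" and B: "finite B" "\<And>g. g \<in> B \<Longrightarrow> \<exists>k. g ^ k \<in> R"
  shows "\<exists>t0. \<forall>t\<ge>t0. Idl\<^bsub>class_ring\<^esub> B [^]\<^bsub>ideals_set class_ring\<^esub> (t::nat) \<subseteq> R"
proof -
  obtain k where k: "\<And>g. g \<in> B \<Longrightarrow> g ^ k g \<in> R" using B(2) by metis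
  have "Idl\<^bsub>class_ring\<^esub> B [^]\<^bsub>ideals_set class_ring\<^esub> t \<subseteq> R" if t: "t \<ge> Suc (sum k B)" for t
  proof (rule ideal_power_subset_of_prods[OF R])
    fix gs assume gs: "length gs = t" "set gs \<subseteq> B"
    have "\<exists>g\<in>B. k g \<le> count_list gs g"
    proof (rule ccontr)
      assume "\<not> ?thesis"
      then have "sum (count_list gs) B \<le> sum k B" by (intro sum_mono) auto
      moreover have "sum (count_list gs) B = length gs" by (rule sum_count_set) (use gs B in auto)
      ultimately show False using t gs by simp
    qed
    then obtain g where g: "g \<in> B" "k g \<le> count_list gs g" by blast
    have "g ^ k g dvd prod_list gs"
      using power_count_dvd_prod_list[of g gs] le_imp_power_dvd[OF g(2)] dvd_trans by blast
    then obtain r where "prod_list gs = r * g ^ k g" by (auto simp: dvd_def mult.commute)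
    then show "prod_list gs \<in> R" using ring_idealD(3)[OF R k[OF g(1)]] by simp
  qed
  then show ?thesis by blast
qed

lemma power_mem_ideal_power:
  fixes g :: "'a::comm_ring_1"
  assumes "g \<in> I"
  shows "g ^ t \<in> I [^]\<^bsub>ideals_set class_ring\<^esub> (t::nat)"
proof (induction t)
  case 0
  show ?case by (simp add: nat_pow_def ideals_set_def)
next
  case (Suc t)
  have "g ^ t \<otimes>\<^bsub>class_ring\<^esub> g \<in> ideal_prod class_ring (I [^]\<^bsub>ideals_set class_ring\<^esub> t) I"
    by (rule ideal_prod.prod[OF Suc assms])
  then have "g ^ t * g \<in> I [^]\<^bsub>ideals_set class_ring\<^esub> Suc t" by (simp add: nat_pow_def ideals_set_def)
  then show ?case by (simp only: power_Suc2)
qed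

lemma finite_index_tuples: "finite (index_tuples n d)"
  by (rule finite_subset[OF _ finite_lists_length_eq[of "{..<n}" d]]) (auto simp: index_tuples_def)

context env_poisson
begin

lemma minor_ideal_power_Ann:
  "\<exists>t0. \<forall>t\<ge>t0. minor_ideal br n x d [^]\<^bsub>ideals_set class_ring\<^esub> (t::nat) \<subseteq> Ann"
  unfolding minor_ideal_def
proof (rule ideal_power_subset[OF ring_ideal_Ann])
  let ?B = "{minor br x is js | is js. is \<in> index_tuples n d \<and> js \<in> index_tuples n d}"
  have "?B = (\<lambda>(is, js). minor br x is js) ` (index_tuples n d \<times> index_tuples n d)" by auto
  then show "finite ?B" using finite_index_tuples by simp
  fix g assume "g \<in> ?B"
  then obtain "is" js where g: "g = minor br x is js" "is \<in> index_tuples n d" "js \<in> index_tuples n d" by blast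
  show "\<exists>k. g ^ k \<in> Ann"
  \<comment> \<open>The annihilation result concerns non-zero minors; the zero minors lie in
    \<open>Ann\<close> trivially.\<close>
  proof (cases "g = 0")
    case True
    then have "g ^ 1 \<in> Ann" using ring_idealD(1)[OF ring_ideal_Ann] by simp
    then show ?thesis by blast
  next
    case False
    then have "is \<in> minor_rows br n x d" "js \<in> minor_cols br n x d"
      using g by (auto simp: minor_rows_def minor_cols_def)
    from T_annihilated_minor[OF this] show ?thesis by (auto simp: Ann_def g)
  qed
qed

text \<open>\<open>t0\<close> precedes the tuples because the inclusion of the ideal power in
  \<open>Ann\<close> does not mention them. For the converse, the ideal power contains
  \<open>minor br x is js ^ t\<close>, which is non-zero, and a single non-zero annihilator on
  either side forces \<open>u \<in> T\<close>.\<close>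

theorem T_characterization:
  "\<exists>t0. \<forall>t\<ge>t0. \<forall>is \<in> minor_rows br n x d. \<forall>js \<in> minor_cols br n x d. \<forall>u.
    (u \<in> T \<longleftrightarrow> (\<exists>a. a \<noteq> 0 \<and> A a * u \<in> K)) \<and>
    (u \<in> T \<longleftrightarrow> (\<exists>k. A (minor br x is js ^ k) * u \<in> K)) \<and>
    (u \<in> T \<longleftrightarrow> (\<forall>a \<in> minor_ideal br n x d [^]\<^bsub>ideals_set class_ring\<^esub> (t::nat). A a * u \<in> K)) \<and>
    (u \<in> T \<longleftrightarrow> (\<forall>a \<in> minor_ideal br n x d [^]\<^bsub>ideals_set class_ring\<^esub> t. u * A a \<in> K))"
proof -
  obtain t0 where t0: "\<And>t. t \<ge> t0 \<Longrightarrow> minor_ideal br n x d [^]\<^bsub>ideals_set class_ring\<^esub> (t::nat) \<subseteq> Ann"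
    using minor_ideal_power_Ann by blast
  show ?thesis
  proof (intro exI[of _ t0] allI impI ballI)
    fix t "is" js u
    assume t: "t \<ge> t0" and rows: "is \<in> minor_rows br n x d" and cols: "js \<in> minor_cols br n x d"
    let ?\<mu> = "minor br x is js" and ?c = "minor_ideal br n x d [^]\<^bsub>ideals_set class_ring\<^esub> t"
    have "?\<mu> \<noteq> 0" using minor_nonzero rows cols unfolding d by blast
    then have nz: "?\<mu> ^ k \<noteq> 0" for k by simp
    obtain k where k: "\<forall>u\<in>T. A (?\<mu> ^ k) * u \<in> K" using T_annihilated_minor[OF rows cols] by blast
    have "?\<mu> \<in> minor_ideal br n x d"
      unfolding minor_ideal_def using rows cols
      by (intro subsetD[OF ring.genideal_self[OF class_ring.ring_axioms]])
        (auto simp: minor_rows_def minor_cols_def)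
    then have \<mu>c: "?\<mu> ^ t \<in> ?c" by (rule power_mem_ideal_power)
    note left = T_of_left_mult and right = T_of_right_mult
    have c: "A a * u \<in> K" "u * A a \<in> K" if "u \<in> T" "a \<in> ?c" for a
      using t0[OF t] that by (auto simp: Ann_def)
    show "(u \<in> T \<longleftrightarrow> (\<exists>a. a \<noteq> 0 \<and> A a * u \<in> K)) \<and> (u \<in> T \<longleftrightarrow> (\<exists>k. A (?\<mu> ^ k) * u \<in> K)) \<and>
      (u \<in> T \<longleftrightarrow> (\<forall>a \<in> ?c. A a * u \<in> K)) \<and> (u \<in> T \<longleftrightarrow> (\<forall>a \<in> ?c. u * A a \<in> K))"
      using k left[OF _ nz] left right[OF _ nz] nz \<mu>c c by blast
  qed
qed

end

section \<open>Localizations and the concrete enveloping algebra\<close>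

lemma ess_finite_of_localization:
  fixes scale :: "'k::field \<Rightarrow> 'a::idom \<Rightarrow> 'a"
  assumes alg: "comm_algebra scale" and I: "ideal I (mpoly_ring n)"
    and loc: "is_localization (mpoly_ring n Quot I) S class_ring h"
    and const: "\<And>c. h (I +>\<^bsub>mpoly_ring n\<^esub> mpoly_const c) = scale c 1"
    and var: "\<And>i. i < n \<Longrightarrow> x i = h (I +>\<^bsub>mpoly_ring n\<^esub> mpoly_var i)"
  shows "ess_finite scale n x"
proof -
  interpret comm_algebra scale by fact
  interpret I: ideal I "mpoly_ring n" by fact
  let ?R = "mpoly_ring n :: 'k mpoly ring"
  define \<psi> where "\<psi> p = h (I +>\<^bsub>?R\<^esub> p)" for p
  have carr: "p \<in> carrier ?R \<longleftrightarrow> (\<forall>m \<in> Poly_Mapping.keys p. Poly_Mapping.keys m \<subseteq> {..<n})" for p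
    by (simp add: mpoly_ring_def)
  have ops: "p \<oplus>\<^bsub>?R\<^esub> q = p + q" "p \<otimes>\<^bsub>?R\<^esub> q = p * q" "\<zero>\<^bsub>?R\<^esub> = 0" for p q
    by (simp_all add: mpoly_ring_def)
  note quot = I.rcos_ring_hom
  have hh: "h \<in> Ring.ring_hom (?R Quot I) class_ring" using loc by (simp add: is_localization_def)
  have \<psi>_add: "\<psi> (p + q) = \<psi> p + \<psi> q" if "p \<in> carrier ?R" "q \<in> carrier ?R" for p q
    using ring_hom_add[OF quot that] ring_hom_add[OF hh ring_hom_closed[OF quot that(1)] ring_hom_closed[OF quot that(2)]]
    by (simp add: \<psi>_def ops)
  have \<psi>_mult: "\<psi> (p * q) = \<psi> p * \<psi> q" if "p \<in> carrier ?R" "q \<in> carrier ?R" for p q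
    using ring_hom_mult[OF quot that] ring_hom_mult[OF hh ring_hom_closed[OF quot that(1)] ring_hom_closed[OF quot that(2)]]
    by (simp add: \<psi>_def ops)
  have single_carr: "Poly_Mapping.single m c \<in> carrier ?R" if "Poly_Mapping.keys m \<subseteq> {..<n}" for m and c :: 'k
    using that by (simp add: carr)
  have single: "\<psi> (Poly_Mapping.single m c) \<in> poly_alg scale n x" if "Poly_Mapping.keys m \<subseteq> {..<n}" for m c
    using that
  proof (induction "\<Sum>k<n. Poly_Mapping.lookup m k" arbitrary: m rule: less_induct)
    case less
    show ?case
    proof (cases "m = 0")
      case True
      then show ?thesis using poly_alg.const const by (simp add: \<psi>_def mpoly_const_def)
    next
      case False
      then obtain i where i: "i \<in> Poly_Mapping.keys m" by (metis all_not_in_conv keys_eq_empty)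
      then have "i < n" using less.prems by auto
      let ?e = "Poly_Mapping.single i 1 :: nat \<Rightarrow>\<^sub>0 nat"
      \<comment> \<open>A non-constant monomial is a variable times a monomial of smaller total
        degree.\<close>
      let ?m = "m - ?e"
      have m: "m = ?e + ?m"
        using i by (intro poly_mapping_eqI) (auto simp: lookup_add lookup_minus lookup_single when_def in_keys_iff)
      have keys: "Poly_Mapping.keys ?m \<subseteq> {..<n}"
        using less.prems by (auto simp: in_keys_iff lookup_minus subset_iff)
      have "(\<Sum>k<n. Poly_Mapping.lookup ?m k) < (\<Sum>k<n. Poly_Mapping.lookup m k)"
        using i \<open>i < n\<close>
        by (intro sum_strict_mono_ex1) (auto simp: lookup_minus lookup_single in_keys_iff intro!: bexI[of _ i])
      from less.hyps[OF this keys] have "x i * \<psi> (Poly_Mapping.single ?m c) \<in> poly_alg scale n x"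
        using \<open>i < n\<close> by (intro poly_alg.var)
      also have "x i * \<psi> (Poly_Mapping.single ?m c) = \<psi> (mpoly_var i * Poly_Mapping.single ?m c)"
        using \<open>i < n\<close> keys single_carr
        by (subst \<psi>_mult) (auto simp: mpoly_var_def \<psi>_def var)
      also have "mpoly_var i * Poly_Mapping.single ?m c = Poly_Mapping.single m c"
        using m by (simp add: mpoly_var_def mult_single)
      finally show ?thesis .
    qed
  qed
  have poly: "\<psi> p \<in> poly_alg scale n x" if p: "p \<in> carrier ?R" for p
  proof -
    let ?s = "\<lambda>M. \<Sum>m\<in>M. Poly_Mapping.single m (Poly_Mapping.lookup p m)"
    have "finite M \<Longrightarrow> M \<subseteq> Poly_Mapping.keys p \<Longrightarrow> ?s M \<in> carrier ?R \<and> \<psi> (?s M) \<in> poly_alg scale n x" for M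
    proof (induction M rule: finite_induct)
      case empty
      show ?case using single[of 0 0] single_carr[of 0 0] by simp
    next
      case (insert m M)
      have m: "Poly_Mapping.keys m \<subseteq> {..<n}" using insert.prems p by (auto simp: carr)
      have "?s M \<in> carrier ?R" "\<psi> (?s M) \<in> poly_alg scale n x" using insert by auto
      then show ?case
        using insert.hyps single[OF m] single_carr[OF m] \<psi>_add poly_alg.add I.add.m_closed[of "Poly_Mapping.single m (Poly_Mapping.lookup p m)" "?s M"]
        by (simp add: ops poly_alg.add)
    qed
    moreover have "?s (Poly_Mapping.keys p) = p"
      by (rule poly_mapping_eqI) (simp add: lookup_sum lookup_single when_def in_keys_iff)
    ultimately show ?thesis by (metis finite_keys order_refl)
  qed
  have quot_carr: "\<exists>p \<in> carrier ?R. C = I +>\<^bsub>?R\<^esub> p" if "C \<in> carrier (?R Quot I)" for C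
    using that by (auto simp: FactRing_def A_RCOSETS_def' a_r_coset_def)
  show ?thesis
  proof
    fix b :: 'a
    have "b \<in> carrier class_ring" by simp
    then obtain r s where rs: "r \<in> carrier (?R Quot I)" "s \<in> S" "b = h r \<otimes>\<^bsub>class_ring\<^esub> inv\<^bsub>class_ring\<^esub> (h s)"
      using loc unfolding is_localization_def by blast
    have "s \<in> carrier (?R Quot I)" using rs(2) loc submonoid.subset unfolding is_localization_def by blast
    then have h_poly: "h r \<in> poly_alg scale n x" "h s \<in> poly_alg scale n x"
      using quot_carr rs(1) poly unfolding \<psi>_def by metis+
    have "h s \<in> Units class_ring" using rs(2) loc unfolding is_localization_def by blast
    then have "h s \<otimes>\<^bsub>class_ring\<^esub> inv\<^bsub>class_ring\<^esub> (h s) = \<one>\<^bsub>class_ring\<^esub>"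
      by (rule monoid.Units_r_inv[OF ring.is_monoid[OF class_ring.ring_axioms]])
    then show "\<exists>r\<in>poly_alg scale n x. \<exists>s\<in>poly_alg scale n x. \<exists>t. s * t = 1 \<and> b = r * t"
      using h_poly rs(3)
      by (intro bexI[of _ "h r"] bexI[of _ "h s"] exI[of _ "inv\<^bsub>class_ring\<^esub> (h s)"] conjI) simp_all
  qed
qed

text \<open>The free algebra parametrizes both the enveloping algebra and its quotient, so one
  equivalence about its elements yields both kernel statements.\<close>

lemma env_kernel_glue:
  fixes \<phi> :: "'u \<Rightarrow> 'v"
  assumes U: "carrier U = range c" and V: "carrier V = range (\<lambda>p. \<phi> (c p))"
    and \<pi>bar: "\<And>p. \<pi>bar (\<phi> (c p)) = \<pi> (c p)" and X: "X \<subseteq> carrier V"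
    and iff: "\<And>p. \<pi> (c p) = \<zero>\<^bsub>P\<^esub> \<longleftrightarrow> \<phi> (c p) \<in> X"
  shows "a_kernel U P \<pi> = {u \<in> carrier U. \<phi> u \<in> X}" and "a_kernel V P \<pi>bar = X"
proof -
  show "a_kernel U P \<pi> = {u \<in> carrier U. \<phi> u \<in> X}"
    using U iff by (auto simp: a_kernel_def')
  show "a_kernel V P \<pi>bar = X"
    using V X iff \<pi>bar by (auto simp: a_kernel_def')
qed

section \<open>The free algebra modulo the preimage of kappa\<close>

lemma env_rels_cases:
  fixes scale :: "'k::field \<Rightarrow> 'a::comm_ring_1 \<Rightarrow> 'a" and br :: "'a \<Rightarrow> 'a \<Rightarrow> 'a"
  defines "A \<equiv> \<lambda>a. free_gen (Alg a) :: ('k, 'a) env_free"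
    and "L \<equiv> \<lambda>a. free_gen (Lie a) :: ('k, 'a) env_free"
  shows "A 1 - 1 \<in> env_rels scale br"
    and "A (a + b) - (A a + A b) \<in> env_rels scale br"
    and "A (a * b) - A a * A b \<in> env_rels scale br"
    and "A (scale c a) - free_const c * A a \<in> env_rels scale br"
    and "L (a + b) - (L a + L b) \<in> env_rels scale br"
    and "L (scale c a) - free_const c * L a \<in> env_rels scale br"
    and "L (br a b) - (L a * L b - L b * L a) \<in> env_rels scale br"
    and "A (br a b) - (L a * A b - A b * L a) \<in> env_rels scale br"
    and "L (a * b) - (A a * L b + A b * L a) \<in> env_rels scale br"
  unfolding env_rels_def Let_def A_def L_def by blast+

definition env_cos :: "('k::field \<Rightarrow> 'a::comm_ring_1 \<Rightarrow> 'a) \<Rightarrow> ('a \<Rightarrow> 'a \<Rightarrow> 'a)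
    \<Rightarrow> ('k, 'a) env_free \<Rightarrow> ('k, 'a) env_free set" where
  "env_cos scale br p = env_ideal scale br +>\<^bsub>class_ring\<^esub> p"

lemma env_cos_simps:
  shows "env_cos scale br p \<in> carrier (env scale br)"
    and "env_cos scale br (p + q) = env_cos scale br p \<oplus>\<^bsub>env scale br\<^esub> env_cos scale br q"
    and "env_cos scale br (p * q) = env_cos scale br p \<otimes>\<^bsub>env scale br\<^esub> env_cos scale br q"
    and "env_cos scale br 0 = \<zero>\<^bsub>env scale br\<^esub>"
proof -
  interpret U: ring "env scale br" by (rule ring_env)
  show 1: "env_cos scale br p \<in> carrier (env scale br)" for p
    unfolding env_cos_def by (rule env_coset_simps)
  show 2: "env_cos scale br (p + q) = env_cos scale br p \<oplus>\<^bsub>env scale br\<^esub> env_cos scale br q" for p q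
    unfolding env_cos_def by (rule env_coset_simps)
  show "env_cos scale br (p * q) = env_cos scale br p \<otimes>\<^bsub>env scale br\<^esub> env_cos scale br q"
    unfolding env_cos_def by (rule env_coset_simps)
  show "env_cos scale br 0 = \<zero>\<^bsub>env scale br\<^esub>"
    using 2[of 0 0] 1[of 0] by (metis U.add.r_cancel_one' add_0)
qed

lemma env_carrier: "carrier (env scale br) = range (env_cos scale br)"
proof
  show "carrier (env scale br) \<subseteq> range (env_cos scale br)"
    by (auto simp: env_def FactRing_def A_RCOSETS_def' a_r_coset_def env_cos_def)
qed (auto simp: env_cos_simps)

lemma env_cos_sum:
  assumes "finite I"
  shows "env_cos scale br (\<Sum>i\<in>I. f i) = (\<Oplus>\<^bsub>env scale br\<^esub>i\<in>I. env_cos scale br (f i))"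
proof -
  interpret U: ring "env scale br" by (rule ring_env)
  show ?thesis
    using assms by induction (simp_all add: env_cos_simps)
qed

lemma kappa_gen_eq:
  "kappa_gen scale br x is \<nu> js = env_cos scale br (free_gen (Alg (minor br x is js)) * free_gen (Lie (x \<nu>))
    + (\<Sum>s<length is. free_gen (Alg ((-1) ^ (Suc s + length is + 1)
          * minor br x (take s is @ drop (Suc s) is @ [\<nu>]) js)) * free_gen (Lie (x (is ! s)))))"
  unfolding kappa_gen_def Let_def env_cos_simps(2,3) env_cos_sum[OF finite_lessThan]
  by (simp only: env_cos_def env_alpha_def env_beta_def)

text \<open>Pulled back to the free algebra, the defining relations of the enveloping algebra and
  the elements of \<open>\<kappa>\<close> become members of a single ideal.\<close>

lemma env_mod_preimage:
  fixes scale :: "'k::field \<Rightarrow> 'a::comm_ring_1 \<Rightarrow> 'a"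
  assumes poisson: "poisson_algebra scale br" and ideal: "ideal \<kappa> (env scale br)"
  shows "env_mod scale br (\<lambda>a. free_gen (Alg a) :: ('k, 'a) env_free) (\<lambda>a. free_gen (Lie a))
    {p. env_cos scale br p \<in> \<kappa>}"
proof -
  interpret poisson_algebra scale br by fact
  interpret \<kappa>: ideal \<kappa> "env scale br" by fact
  let ?K = "{p. env_cos scale br p \<in> \<kappa>}"
  let ?A = "\<lambda>a. free_gen (Alg a) :: ('k, 'a) env_free" and ?L = "\<lambda>a. free_gen (Lie a) :: ('k, 'a) env_free"
  have rels: "p \<in> ?K" if "p \<in> env_rels scale br" for p
    using env_coset_eq[of p 0 scale br] that env_cos_simps(4)[of scale br] by (simp add: env_cos_def)
  have K: "p + q \<in> ?K" if "p \<in> ?K" "q \<in> ?K" for p q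
    using that by (simp add: env_cos_simps)
  have lm: "q * p \<in> ?K" and rm: "p * q \<in> ?K" if "p \<in> ?K" for p q
    using that by (simp_all add: env_cos_simps \<kappa>.I_l_closed \<kappa>.I_r_closed)
  have um: "- p \<in> ?K" if "p \<in> ?K" for p using lm[OF that, of "-1"] by simp
  note R = env_rels_cases[THEN rels]
  have L1: "?L 1 \<in> ?K"
  proof -
    \<comment> \<open>This combination of relations equals \<open>?L 1\<close>: the Leibniz rule
      gives \<open>L 1 = 2 * L 1\<close> once \<open>A 1\<close> is replaced by 1.\<close>
    have "- (?L (1 * 1) - (?A 1 * ?L 1 + ?A 1 * ?L 1)) + (- ((?A 1 - 1) * ?L 1) + - ((?A 1 - 1) * ?L 1)) \<in> ?K"
      by (intro K um rm R)
    then show ?thesis by (simp add: algebra_simps)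
  qed
  show ?thesis
  proof (unfold_locales, goal_cases)
    case 1
    show ?case by (simp add: env_cos_simps)
  next
    case (9 c)
    have "(?L (scale c 1) - free_const c * ?L 1) + free_const c * ?L 1 \<in> ?K" by (intro K R lm L1)
    then show ?case by simp
  next
    case (13 P u)
    show ?case
    proof (induction u rule: free_algebra_induct)
      case (const c)
      \<comment> \<open>The constant \<open>c\<close> is congruent to \<open>?A (scale c 1)\<close>,
        so the induction principle can do without a case for scalars.\<close>
      have "- (?A (scale c 1) - free_const c * ?A 1) + - (free_const c * (?A 1 - 1)) \<in> ?K"
        by (intro K um lm R)
      from 13(4)[OF 13(1)[OF this] 13(2)[of "scale c 1"]] show ?case by (simp add: algebra_simps)
    next
      case (gen g)
      then show ?case using 13 by (cases g) auto
    qed (rule 13(4) 13(5), assumption+)+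
  qed ((rule K; assumption) | (rule lm; assumption) | (rule rm; assumption) | rule R)+
qed

lemma quotient_carrier: "carrier (R Quot I) = (\<lambda>u. I +>\<^bsub>R\<^esub> u) ` carrier R"
  by (auto simp: FactRing_def A_RCOSETS_def')

lemma quotient_zero_iff:
  assumes "ideal I R" "u \<in> carrier R"
  shows "I +>\<^bsub>R\<^esub> u = \<zero>\<^bsub>R Quot I\<^esub> \<longleftrightarrow> u \<in> I"
proof -
  interpret ideal I R by fact
  show ?thesis using rcos_const_imp_mem[OF assms(2)] a_rcos_const[of u] by (auto simp: FactRing_def)
qed

text \<open>Well-definedness of the map induced on the quotient: \<open>f\<close> is constant on the
  coset.\<close>

lemma the_elem_image_coset:
  assumes "ideal I R" "\<And>k. k \<in> I \<Longrightarrow> f (k \<oplus>\<^bsub>R\<^esub> u) = f u"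
  shows "the_elem (f ` (I +>\<^bsub>R\<^esub> u)) = f u"
proof -
  interpret ideal I R by fact
  have "f ` (I +>\<^bsub>R\<^esub> u) = (\<lambda>k. f (k \<oplus>\<^bsub>R\<^esub> u)) ` I" by (auto simp: a_r_coset_def')
  also have "\<dots> = (\<lambda>_. f u) ` I" by (rule image_cong) (simp_all add: assms(2))
  also have "\<dots> = {f u}" by (rule image_constant[OF additive_subgroup.zero_closed[OF ideal.axioms(1)[OF assms(1)]]])
  finally show ?thesis by simp
qed

theorem theorem6p7:
  fixes n m d :: nat
    and f :: "nat \<Rightarrow> 'k::field_char_0 mpoly"
    and I :: "'k mpoly set"
    and S :: "'k mpoly set set"
    and h :: "'k mpoly set \<Rightarrow> 'a::idom"
    and scale :: "'k \<Rightarrow> 'a \<Rightarrow> 'a"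
    and br :: "'a \<Rightarrow> 'a \<Rightarrow> 'a"
    and x :: "nat \<Rightarrow> 'a"
    and U :: "('k, 'a) env_free set ring"
    and Ubar :: "('k, 'a) env_free set set ring"
    and PD :: "('a \<Rightarrow> 'a) ring"
  assumes "f ` {1..m} \<subseteq> carrier (mpoly_ring n)"
    and "I = Idl\<^bsub>mpoly_ring n\<^esub> (f ` {1..m})"
    and "primeideal I (mpoly_ring n)"
    and "\<not> maximalideal I (mpoly_ring n)"
    and "poisson_algebra scale br"
    and "is_localization (mpoly_ring n Quot I) S class_ring h"
    and "\<And>c. h (I +>\<^bsub>mpoly_ring n\<^esub> mpoly_const c) = scale c 1"
    and "\<And>i. i < n \<Longrightarrow> x i = h (I +>\<^bsub>mpoly_ring n\<^esub> mpoly_var i)"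
    and "d = poisson_rank br n x"
    and "U = env scale br"
    and "PD = poisson_diff_ops scale br"
    and "\<pi> = env_pi scale br"
    and "\<kappa> = kappa scale br n x d"
    and "Ubar = U Quot \<kappa>"
    and "\<phi> = (\<lambda>u. \<kappa> +>\<^bsub>U\<^esub> u)"
    and "\<pi>bar = (\<lambda>C. the_elem (\<pi> ` C))"
    and "\<epsilon> = (\<lambda>a. \<phi> (env_alpha scale br a))"
    and "\<And>t::nat. \<cc> t = minor_ideal br n x d [^]\<^bsub>ideals_set class_ring\<^esub> t"
  shows "\<exists>t0. \<forall>t \<ge> t0. \<forall>is \<in> minor_rows br n x d. \<forall>js \<in> minor_cols br n x d.
    (a_kernel U PD \<pi> = {u \<in> carrier U. \<phi> u \<in> torsion Ubar (\<epsilon> ` (UNIV - {0}))} \<and>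
     a_kernel U PD \<pi> = {u \<in> carrier U. \<phi> u \<in> torsion Ubar (\<epsilon> ` {minor br x is js ^ k | k. True})} \<and>
     a_kernel U PD \<pi> = {u \<in> carrier U. \<phi> u \<in> right_ann Ubar (\<epsilon> ` \<cc> t)} \<and>
     a_kernel U PD \<pi> = {u \<in> carrier U. \<phi> u \<in> left_ann Ubar (\<epsilon> ` \<cc> t)}) \<and>
    (a_kernel Ubar PD \<pi>bar = torsion Ubar (\<epsilon> ` (UNIV - {0})) \<and>
     a_kernel Ubar PD \<pi>bar = torsion Ubar (\<epsilon> ` {minor br x is js ^ k | k. True}) \<and>
     a_kernel Ubar PD \<pi>bar = right_ann Ubar (\<epsilon> ` \<cc> t) \<and>
     a_kernel Ubar PD \<pi>bar = left_ann Ubar (\<epsilon> ` \<cc> t))"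
proof -
  let ?cos = "env_cos scale br"
  let ?A = "\<lambda>a. free_gen (Alg a) :: ('k, 'a) env_free" and ?L = "\<lambda>a. free_gen (Lie a) :: ('k, 'a) env_free"
  note poisson = assms(5) and d = assms(9)
  note U = assms(10) and PD = assms(11) and \<pi> = assms(12) and \<kappa> = assms(13) and Ubar = assms(14)
    and \<phi> = assms(15) and \<pi>bar = assms(16) and \<epsilon> = assms(17) and c = assms(18)
  interpret poisson_algebra scale br by (rule poisson)
  have "ideal I (mpoly_ring n)" using assms(3) by (simp add: primeideal_def)
  then have ess: "ess_finite scale n x"
    using ess_finite_of_localization[OF comm_algebra_axioms _ assms(6,7,8)] by blast
  interpret U: ring U unfolding U by (rule ring_env)
  interpret PD: ring PD unfolding PD by (rule poisson_triple.ring_B[OF poisson_diff_ops_triple[OF poisson]])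
  have hom: "\<pi> \<in> Ring.ring_hom U PD" unfolding \<pi> U PD by (rule env_pi_hom[OF poisson])
  interpret \<pi>: ring_hom_ring U PD \<pi> by (rule ring_hom_ringI2[OF U.ring_axioms PD.ring_axioms hom])
  note cos = env_cos_simps[of scale br, folded U]
  define G where "G = {kappa_gen scale br x is \<nu> js | is \<nu> js.
        is \<in> minor_rows br n x d \<and> js \<in> minor_cols br n x d \<and> \<nu> \<in> {..<n} - set is}"
  have G: "G \<subseteq> carrier U" by (auto simp: G_def kappa_gen_eq cos)
  have \<kappa>G: "\<kappa> = Idl\<^bsub>U\<^esub> G" by (simp add: \<kappa> kappa_def G_def U)
  have ideal: "ideal \<kappa> U" unfolding \<kappa>G by (rule U.genideal_ideal[OF G])
  interpret \<kappa>: ideal \<kappa> U by (rule ideal)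
  have PD_ops: "(f \<oplus>\<^bsub>PD\<^esub> g) y = f y + g y" "(f \<otimes>\<^bsub>PD\<^esub> g) y = f (g y)" for f g y
    by (simp_all add: PD poisson_diff_ops_def endo_ring_def)
  define act where "act = (\<lambda>p. \<pi> (?cos p))"
  have act: "act (p + q) y = act p y + act q y" "act (p * q) y = act p (act q y)"
    "act (?A a) y = a * y" "act (?L a) y = br a y" for p q y a
    using env_pi_hom(2,3)[OF poisson, of a, folded \<pi>] cos(1)
    by (simp_all add: act_def cos PD_ops) (simp_all add: env_cos_def env_alpha_def env_beta_def)
  have act_fold: "\<pi> (?cos p) = act p" for p by (simp add: act_def)
  have PD_zero: "\<zero>\<^bsub>PD\<^esub> = (\<lambda>_. 0)" by (simp add: PD poisson_diff_ops_def endo_ring_def)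
  have act_zero: "act 0 y = 0" for y
    using act(1)[of 0 0 y] by (metis add_0 add_diff_cancel_right' diff_self)
  have act_sum: "act (\<Sum>s<m. p s) y = (\<Sum>s<m. act (p s) y)" for p y and m :: nat
    by (induction m) (simp_all add: act act_zero)
  have len: "length is = d" if "is \<in> minor_rows br n x d \<or> is \<in> minor_cols br n x d" for "is"
    using that by (auto simp: minor_rows_def minor_cols_def index_tuples_def)
  \<comment> \<open>This makes \<open>\<pi>bar\<close> well defined and lets \<open>act\<close>
    vanish on \<open>?K\<close>.\<close>
  have "G \<subseteq> a_kernel U PD \<pi>"
  proof
    fix g assume "g \<in> G"
    then obtain "is" \<nu> js where g: "g = kappa_gen scale br x is \<nu> js" "is \<in> minor_rows br n x d"
      "js \<in> minor_cols br n x d" "\<nu> < n" "\<nu> \<notin> set is" by (auto simp: G_def)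
    have l: "length is = d" "length js = d" using g len by auto
    have "\<pi> g y = 0" for y
    proof -
      have "\<pi> g y = minor br x is js * br (x \<nu>) y + (\<Sum>s<d. (-1) ^ (Suc s + d + 1)
          * minor br x (take s is @ drop (Suc s) is @ [\<nu>]) js * br (x (is ! s)) y)"
        unfolding g(1) kappa_gen_eq act_fold act act_sum l ..
      also have "\<dots> = minor br x is js * br (x \<nu>) y + (\<Sum>s<d. - (\<Sum>t<d. br (x \<nu>) (x (js ! t)) *
          minor_adj br x is js t s) * br (x (is ! s)) y)"
        by (intro arg_cong2[of _ _ _ _ "(+)"] sum.cong refl arg_cong2[of _ _ _ _ "(*)"] minor_replace_row[OF l]) simp
      also have "\<dots> = 0"
        using kappa_derivation_zero[OF poisson ess d g(2,3,4), of y] by (simp add: sum_negf)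
      finally show ?thesis .
    qed
    then have "\<pi> g = \<zero>\<^bsub>PD\<^esub>" unfolding PD_zero by (rule ext)
    moreover have "g \<in> carrier U" using G \<open>g \<in> G\<close> by blast
    ultimately show "g \<in> a_kernel U PD \<pi>" unfolding a_kernel_def' by blast
  qed
  then have \<kappa>_ker: "\<kappa> \<subseteq> a_kernel U PD \<pi>"
    unfolding \<kappa>G by (rule U.genideal_minimal[OF \<pi>.kernel_is_ideal])
  then have \<pi>_\<kappa>: "\<pi> k = \<zero>\<^bsub>PD\<^esub>" if "k \<in> \<kappa>" for k
    using that unfolding a_kernel_def' by blast
  let ?K = "{p. ?cos p \<in> \<kappa>}"
  interpret E: env_mod scale br ?A ?L ?K
    by (rule env_mod_preimage[OF poisson ideal[unfolded U]])
  interpret F: ess_finite scale n x by (rule ess)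
  interpret E: env_poisson scale br ?A ?L ?K n x act d
  proof
    fix p y assume "p \<in> ?K"
    then have "act p = (\<lambda>_. 0)" unfolding act_def PD_zero[symmetric] by (intro \<pi>_\<kappa>) blast
    then show "act p y = 0" by (rule fun_cong)
  next
    fix "is" js \<nu>
    assume *: "is \<in> minor_rows br n x d" "js \<in> minor_cols br n x d" "\<nu> < n" "\<nu> \<notin> set is"
    then have "kappa_gen scale br x is \<nu> js \<in> \<kappa>"
      unfolding \<kappa>G by (intro subsetD[OF U.genideal_self[OF G]]) (auto simp: G_def)
    moreover have "length is = d" using * len by blast
    ultimately show "?A (minor br x is js) * ?L (x \<nu>) + (\<Sum>s<d. ?A ((-1) ^ (Suc s + d + 1)
          * minor br x (take s is @ drop (Suc s) is @ [\<nu>]) js) * ?L (x (is ! s))) \<in> ?K"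
      by (simp only: kappa_gen_eq mem_Collect_eq)
  qed (simp_all only: act d)
  have T_iff: "p \<in> E.T \<longleftrightarrow> \<pi> (?cos p) = \<zero>\<^bsub>PD\<^esub>" for p
    unfolding E.T_def act_fold PD_zero by (auto simp only: mem_Collect_eq fun_eq_iff)
  have \<phi>_hom: "\<phi> \<in> Ring.ring_hom U Ubar" unfolding \<phi> Ubar by (rule \<kappa>.rcos_ring_hom)
  have Ubar_carrier: "carrier Ubar = range (\<lambda>p. \<phi> (?cos p))"
    unfolding Ubar \<phi> quotient_carrier env_carrier[of scale br, folded U] image_image ..
  have \<phi>_zero: "\<phi> (?cos p) = \<zero>\<^bsub>Ubar\<^esub> \<longleftrightarrow> p \<in> ?K" for p
    unfolding Ubar \<phi> quotient_zero_iff[OF ideal cos(1)] by (rule mem_Collect_eq[symmetric])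
  have \<epsilon>_eq: "\<epsilon> a = \<phi> (?cos (?A a))" for a by (simp add: \<epsilon> env_alpha_def env_cos_def)
  \<comment> \<open>Through this equivalence torsion and annihilators in the quotient become
    conditions on products in the free algebra modulo \<open>?K\<close>.\<close>
  have prod_zero: "\<phi> (?cos p) \<otimes>\<^bsub>Ubar\<^esub> \<phi> (?cos q) = \<zero>\<^bsub>Ubar\<^esub> \<longleftrightarrow> p * q \<in> ?K" for p q
    using \<phi>_zero[of "p * q"] ring_hom_mult[OF \<phi>_hom cos(1) cos(1), of p q] by (simp add: cos)
  have \<pi>bar_eq: "\<pi>bar (\<phi> (?cos p)) = \<pi> (?cos p)" for p
  proof -
    have "\<pi> (k \<oplus>\<^bsub>U\<^esub> ?cos p) = \<pi> (?cos p)" if "k \<in> \<kappa>" for k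
      using \<pi>_\<kappa>[OF that] \<kappa>.Icarr[OF that] cos(1)[of p] by simp
    then show ?thesis unfolding \<pi>bar \<phi> by (rule the_elem_image_coset[OF ideal])
  qed
  have mem: "\<phi> (?cos p) \<in> torsion Ubar (\<epsilon> ` X) \<longleftrightarrow> (\<exists>a\<in>X. ?A a * p \<in> ?K)"
    "\<phi> (?cos p) \<in> right_ann Ubar (\<epsilon> ` X) \<longleftrightarrow> (\<forall>a\<in>X. ?A a * p \<in> ?K)"
    "\<phi> (?cos p) \<in> left_ann Ubar (\<epsilon> ` X) \<longleftrightarrow> (\<forall>a\<in>X. p * ?A a \<in> ?K)" for p X
    using rangeI[of "\<lambda>p. \<phi> (?cos p)" p, folded Ubar_carrier]
    by (simp_all only: torsion_def right_ann_def left_ann_def mem_Collect_eq ball_simps bex_simps \<epsilon>_eq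
        prod_zero simp_thms)
  have sub: "torsion Ubar Y \<subseteq> carrier Ubar" "right_ann Ubar Y \<subseteq> carrier Ubar" "left_ann Ubar Y \<subseteq> carrier Ubar" for Y
    by (auto simp: torsion_def right_ann_def left_ann_def)
  have U_carrier: "carrier U = range ?cos" unfolding U by (rule env_carrier)
  note glue = env_kernel_glue[where c = ?cos and \<phi> = \<phi> and \<pi> = \<pi> and \<pi>bar = \<pi>bar and P = PD,
      OF U_carrier Ubar_carrier \<pi>bar_eq]
  obtain t0 where t0: "\<forall>t\<ge>t0. \<forall>is \<in> minor_rows br n x d. \<forall>js \<in> minor_cols br n x d. \<forall>u.
    (u \<in> E.T \<longleftrightarrow> (\<exists>a. a \<noteq> 0 \<and> ?A a * u \<in> ?K)) \<and>
    (u \<in> E.T \<longleftrightarrow> (\<exists>k. ?A (minor br x is js ^ k) * u \<in> ?K)) \<and>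
    (u \<in> E.T \<longleftrightarrow> (\<forall>a \<in> \<cc> t. ?A a * u \<in> ?K)) \<and> (u \<in> E.T \<longleftrightarrow> (\<forall>a \<in> \<cc> t. u * ?A a \<in> ?K))"
    using E.T_characterization unfolding c by (rule exE)
  show ?thesis
  proof (intro exI[of _ t0] allI impI ballI)
    fix t "is" js
    assume t: "t \<ge> t0" and rows: "is \<in> minor_rows br n x d" and cols: "js \<in> minor_cols br n x d"
    note char = t0[THEN spec, THEN mp, OF t, THEN bspec, OF rows, THEN bspec, OF cols, THEN spec]
    have 1: "\<pi> (?cos p) = \<zero>\<^bsub>PD\<^esub> \<longleftrightarrow> \<phi> (?cos p) \<in> torsion Ubar (\<epsilon> ` (UNIV - {0}))" for p
      using char[of p] unfolding mem T_iff by blast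
    have 2: "\<pi> (?cos p) = \<zero>\<^bsub>PD\<^esub> \<longleftrightarrow> \<phi> (?cos p) \<in> torsion Ubar (\<epsilon> ` {minor br x is js ^ k | k. True})" for p
      using char[of p] unfolding mem T_iff by blast
    have 3: "\<pi> (?cos p) = \<zero>\<^bsub>PD\<^esub> \<longleftrightarrow> \<phi> (?cos p) \<in> right_ann Ubar (\<epsilon> ` \<cc> t)" for p
      using char[of p] unfolding mem T_iff by blast
    have 4: "\<pi> (?cos p) = \<zero>\<^bsub>PD\<^esub> \<longleftrightarrow> \<phi> (?cos p) \<in> left_ann Ubar (\<epsilon> ` \<cc> t)" for p
      using char[of p] unfolding mem T_iff by blast
    show "(a_kernel U PD \<pi> = {u \<in> carrier U. \<phi> u \<in> torsion Ubar (\<epsilon> ` (UNIV - {0}))} \<and>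
     a_kernel U PD \<pi> = {u \<in> carrier U. \<phi> u \<in> torsion Ubar (\<epsilon> ` {minor br x is js ^ k | k. True})} \<and>
     a_kernel U PD \<pi> = {u \<in> carrier U. \<phi> u \<in> right_ann Ubar (\<epsilon> ` \<cc> t)} \<and>
     a_kernel U PD \<pi> = {u \<in> carrier U. \<phi> u \<in> left_ann Ubar (\<epsilon> ` \<cc> t)}) \<and>
    (a_kernel Ubar PD \<pi>bar = torsion Ubar (\<epsilon> ` (UNIV - {0})) \<and>
     a_kernel Ubar PD \<pi>bar = torsion Ubar (\<epsilon> ` {minor br x is js ^ k | k. True}) \<and>
     a_kernel Ubar PD \<pi>bar = right_ann Ubar (\<epsilon> ` \<cc> t) \<and>
     a_kernel Ubar PD \<pi>bar = left_ann Ubar (\<epsilon> ` \<cc> t))"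
      by (intro conjI glue sub 1 2 3 4)
  qed
qed

end
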